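(* The system $\mathsf{KT} + \mathsf{UBF} + \mathsf{IA} + \mathsf{In}^+ + \mathsf{In}^-$ is consistent.
   Context: Language. $\mathcal{L}$ is the first-order language with equality having the arithmetic symbols $\underline{0}, S, +, \cdot$, a unary predicate $U$, a unary function symbol $u$, a unary predicate $\mathrm{K}^1$, a binary relation $\mathrm{K}^2$ (both written $\mathrm{K}$ when the arity is clear), a unary predicate $\mathrm{T}$ and a unary predicate $\mathrm{Ag}$. $\mathcal{L}_{\mathrm{PA}}$ is the sublanguage of arithmetic symbols; $\mathcal{L}_-$ is the sublanguage with symbols $\underline{0}, S, +, \cdot, U, u, \mathrm{Ag}$. For a language $L$: $L^n$ is the set of $L$-formulas with exactly $n$ free variables, $L^1[v]$ those with exactly $v$ free, $\mathrm{Atom}_L^n$ the atomic ones with exactly $n$ free variables, $\mathrm{Term}_L^0$ the closed $L$-terms, $\mathrm{Var}$ the variables. $\mathrm{PA}(\mathcal{L})$ is Peano Arithmetic with induction for all $\mathcal{L}$-formulas. Syntax coding. A Gödel numbering is fixed; $\ulcorner \phi \urcorner = \mathrm{gq}(\phi)$ is the numeral of the code of $\phi$. $\mathrm{num}(n)$ is the numeral of $n$; $\mathrm{sbt}(\phi,t,v)$ is the result of substituting $t$ for $v$ in $\phi$. A dot under a symbol denotes the representation in arithmetic of the corresponding syntactic relation or function (e.g. $\text{\d{$\mathcal{L}$}}^0$ represents the set of codes of sentences, $\text{\d{$\rightarrow$}}$ the function forming implications, $\text{\d{T}}$ the function forming $\mathrm{T}(t)$ from $t$, $\text{\d{K}}$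 the function forming $\mathrm{K}(s,t)$ from $s,t$); $t^\circ$ represents the value of a closed $\mathcal{L}_{\mathrm{PA}}$-term $t$. $\forall x \in \phi\,(\psi)$ abbreviates $\forall x(\phi(x) \rightarrow \psi)$. Systems. An $\mathcal{L}$-system is a recursively enumerable set of $\mathcal{L}$-sentences containing a Hilbert-style axiomatization of first-order logic and closed under modus ponens; it is given by axioms and rules, where a rule of a system may be applied to any theorem (but not to undischarged assumptions), and in an extension of the system it may be applied to any theorem of the extension. $\mathsf{Base}$ is $\mathrm{PA}(\mathcal{L})$. $\Pr_S$ is the standard provability predicate of $S$. $\mathsf{DCB}$ extends $\mathsf{Base}$ with the axioms: (Non-triviality) $\exists \alpha\, \mathrm{Ag}(\alpha)$; ($\mathrm{K}^1$-$\mathrm{K}^2$) $\forall \phi \in \text{\d{$\mathcal{L}$}}^0 (\mathrm{K}^1(\phi) \leftrightarrow \forall \alpha \in \mathrm{Ag}\ \mathrm{K}^2(\alpha,\phi))$; ($\mathsf{UK}^{\mathrm{K}}$) $\forall \alpha \in \mathrm{Ag}\ \forall \phi,\psi \in \text{\d{$\mathcal{L}$}}^0 ((\mathrm{K}(\alpha,\phi) \wedge \mathrm{K}(\alpha,\phi \mathbin{\text{\d{$\rightarrow$}}} \psi)) \rightarrow \mathrm{K}(\alpha,\psi))$; ($\mathsf{R}_{\mathsf{DCB}}$) $\forall \alpha \in \mathrm{Ag}\ \forall \phi \in \text{\d{$\mathcal{L}$}}^0 (\Pr_{\mathsf{DCB}}(\phi) \rightarrow \mathrm{K}(\alpha,\phi))$,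 where $\Pr_{\mathsf{DCB}}$ is the provability predicate of the very system $\mathsf{DCB}$ of which this is an axiom (obtained by the Gödel fixed-point lemma). $\mathsf{FS}$ extends $\mathsf{Base}$ with the axioms: $\forall t_1,\dots,t_n \in \text{\d{Term}}^0_{\mathcal{L}_{\mathrm{PA}}} (\mathrm{T}(\text{\d{$R$}}(t_1,\dots,t_n)) \leftrightarrow R(t_1^\circ,\dots,t_n^\circ))$ for each $R(\vec x) \in \mathrm{Atom}^n_{\mathcal{L}_-}$; $\forall \phi \in \text{\d{$\mathcal{L}$}}^0 (\mathrm{T}(\text{\d{$\neg$}}\phi) \leftrightarrow \neg \mathrm{T}(\phi))$; $\forall \phi,\psi \in \text{\d{$\mathcal{L}$}}^0 (\mathrm{T}(\phi \mathbin{\text{\d{$\circ$}}} \psi) \leftrightarrow (\mathrm{T}(\phi) \circ \mathrm{T}(\psi)))$ for each $\circ \in \{\rightarrow,\wedge,\vee\}$; $\forall v \in \text{\d{Var}}\ \forall \phi \in \text{\d{$\mathcal{L}$}}^1[v] (\mathrm{T}(\text{\d{$Q$}} v \phi) \leftrightarrow Q t \in \text{\d{Term}}^0_{\mathcal{L}}\ \mathrm{T}(\text{\d{sbt}}(\phi,t,v)))$ for each $Q \in \{\forall,\exists\}$; and the rules, for $\phi \in \mathcal{L}^0$: ($\mathsf{NEC}^{\mathrm{T}}$) from $\vdash \phi$ infer $\vdash \mathrm{T}(\ulcorner\phi\urcorner)$; ($\mathsf{CONEC}^{\mathrm{T}}$) from $\vdash \mathrm{T}(\ulcorner\phi\urcorner)$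 infer $\vdash \phi$. $\mathsf{KT}$ extends $\mathsf{DCB}$ and $\mathsf{FS}$ with the axiom ($\mathsf{V}$) $\forall \alpha \in \mathrm{Ag}\ \forall \phi \in \text{\d{$\mathcal{L}$}}^0 (\mathrm{K}(\alpha,\phi) \rightarrow \mathrm{T}(\phi))$ and the rule, for $\phi \in \mathcal{L}^0$: ($\mathsf{NEC}^{\mathrm{K}}$) from $\vdash \phi$ infer $\vdash \forall \alpha \in \mathrm{Ag}\ \mathrm{K}(\alpha,\ulcorner\phi\urcorner)$. Supplementary axioms: ($\mathsf{UBF}$) $\forall \alpha \in \mathrm{Ag}\ \forall v \in \text{\d{Var}}\ \forall \phi \in \text{\d{$\mathcal{L}$}}^1[v] ((\forall t \in \text{\d{Term}}^0_{\mathcal{L}_{\mathrm{PA}}}\ \mathrm{K}(\alpha,\text{\d{sbt}}(\phi,t,v))) \rightarrow \mathrm{K}(\alpha,\text{\d{$\forall$}} v \phi))$; ($\mathsf{IA}$) $\forall \alpha \in \mathrm{Ag}\ \forall \phi \in \text{\d{$\mathcal{L}$}}^0 (\mathrm{K}(\alpha,\text{\d{T}}(\text{\d{gq}}(\phi))) \leftrightarrow \mathrm{T}(\text{\d{K}}(\text{\d{num}}(\alpha),\text{\d{gq}}(\phi))))$; ($\mathsf{In}^+$) $\forall \alpha \in \mathrm{Ag}\ \forall \phi \in \text{\d{$\mathcal{L}$}}^0 (\mathrm{K}(\alpha,\text{\d{T}}(\text{\d{gq}}(\phi))) \rightarrow \mathrm{K}(\alpha,\text{\d{K}}(\text{\d{num}}(\alpha),\text{\d{gq}}(\phi))))$;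 ($\mathsf{In}^-$) $\forall \alpha \in \mathrm{Ag}\ \forall \phi \in \text{\d{$\mathcal{L}$}}^0 (\neg\mathrm{K}(\alpha,\text{\d{T}}(\text{\d{gq}}(\phi))) \rightarrow \mathrm{K}(\alpha,\text{\d{$\neg$}}\text{\d{K}}(\text{\d{num}}(\alpha),\text{\d{gq}}(\phi))))$. *)

theory Defs
  imports "HOL-Library.Nat_Bijection"
begin

section \<open>The language\<close>

datatype tm = Var nat | Zero | Sc tm | Plus tm tm | Times tm tm | Fu tm

datatype fm =
    Eq tm tm (infix "\<^bold>=" 60)
  | PU tm
  | K1 tm
  | K2 tm tm
  | Tr tm
  | Ag tm
  | Neg fm ("\<^bold>\<not> _" [55] 55)
  | Imp fm fm (infixr "\<^bold>\<longrightarrow>" 45)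
  | And fm fm (infixr "\<^bold>\<and>" 50)
  | Or fm fm (infixr "\<^bold>\<or>" 48)
  | Forall nat fm
  | Exists nat fm

definition Iff :: "fm \<Rightarrow> fm \<Rightarrow> fm" (infix "\<^bold>\<longleftrightarrow>" 44)
  where "(\<phi> \<^bold>\<longleftrightarrow> \<psi>) = ((\<phi> \<^bold>\<longrightarrow> \<psi>) \<^bold>\<and> (\<psi> \<^bold>\<longrightarrow> \<phi>))"

definition Conj :: "fm list \<Rightarrow> fm"
  where "Conj \<phi>s = foldr And \<phi>s (Zero \<^bold>= Zero)"

definition Disj :: "fm list \<Rightarrow> fm"
  where "Disj \<phi>s = foldr Or \<phi>s (Zero \<^bold>= Sc Zero)"

primrec tvars :: "tm \<Rightarrow> nat set" where
  "tvars (Var n) = {n}"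
| "tvars Zero = {}"
| "tvars (Sc t) = tvars t"
| "tvars (Plus s t) = tvars s \<union> tvars t"
| "tvars (Times s t) = tvars s \<union> tvars t"
| "tvars (Fu t) = tvars t"

primrec fv :: "fm \<Rightarrow> nat set" where
  "fv (s \<^bold>= t) = tvars s \<union> tvars t"
| "fv (PU t) = tvars t"
| "fv (K1 t) = tvars t"
| "fv (K2 s t) = tvars s \<union> tvars t"
| "fv (Tr t) = tvars t"
| "fv (Ag t) = tvars t"
| "fv (\<^bold>\<not> \<phi>) = fv \<phi>"
| "fv (\<phi> \<^bold>\<longrightarrow> \<psi>) = fv \<phi> \<union> fv \<psi>"
| "fv (\<phi> \<^bold>\<and> \<psi>) = fv \<phi> \<union> fv \<psi>"
| "fv (\<phi> \<^bold>\<or> \<psi>) = fv \<phi> \<union> fv \<psi>"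
| "fv (Forall v \<phi>) = fv \<phi> - {v}"
| "fv (Exists v \<phi>) = fv \<phi> - {v}"

definition sentence :: "fm \<Rightarrow> bool"
  where "sentence \<phi> \<longleftrightarrow> fv \<phi> = {}"

text \<open>\<open>tsbt s t v\<close> and \<open>sbt \<phi> t v\<close> put \<open>t\<close> for the free occurrences of the variable \<open>v\<close>; capture is
  excluded by \<open>free_for\<close> where it could occur.\<close>

primrec tsbt :: "tm \<Rightarrow> tm \<Rightarrow> nat \<Rightarrow> tm" where
  "tsbt (Var n) t v = (if n = v then t else Var n)"
| "tsbt Zero t v = Zero"
| "tsbt (Sc s) t v = Sc (tsbt s t v)"
| "tsbt (Plus r s) t v = Plus (tsbt r t v) (tsbt s t v)"
| "tsbt (Times r s) t v = Times (tsbt r t v) (tsbt s t v)"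
| "tsbt (Fu s) t v = Fu (tsbt s t v)"

primrec sbt :: "fm \<Rightarrow> tm \<Rightarrow> nat \<Rightarrow> fm" where
  "sbt (r \<^bold>= s) t v = (tsbt r t v \<^bold>= tsbt s t v)"
| "sbt (PU s) t v = PU (tsbt s t v)"
| "sbt (K1 s) t v = K1 (tsbt s t v)"
| "sbt (K2 r s) t v = K2 (tsbt r t v) (tsbt s t v)"
| "sbt (Tr s) t v = Tr (tsbt s t v)"
| "sbt (Ag s) t v = Ag (tsbt s t v)"
| "sbt (\<^bold>\<not> \<phi>) t v = (\<^bold>\<not> sbt \<phi> t v)"
| "sbt (\<phi> \<^bold>\<longrightarrow> \<psi>) t v = (sbt \<phi> t v \<^bold>\<longrightarrow> sbt \<psi> t v)"
| "sbt (\<phi> \<^bold>\<and> \<psi>) t v = (sbt \<phi> t v \<^bold>\<and> sbt \<psi> t v)"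
| "sbt (\<phi> \<^bold>\<or> \<psi>) t v = (sbt \<phi> t v \<^bold>\<or> sbt \<psi> t v)"
| "sbt (Forall w \<phi>) t v = (if w = v then Forall w \<phi> else Forall w (sbt \<phi> t v))"
| "sbt (Exists w \<phi>) t v = (if w = v then Exists w \<phi> else Exists w (sbt \<phi> t v))"

fun free_for :: "tm \<Rightarrow> nat \<Rightarrow> fm \<Rightarrow> bool" where
  "free_for t v (\<^bold>\<not> \<phi>) = free_for t v \<phi>"
| "free_for t v (\<phi> \<^bold>\<longrightarrow> \<psi>) = (free_for t v \<phi> \<and> free_for t v \<psi>)"
| "free_for t v (\<phi> \<^bold>\<and> \<psi>) = (free_for t v \<phi> \<and> free_for t v \<psi>)"
| "free_for t v (\<phi> \<^bold>\<or> \<psi>) = (free_for t v \<phi> \<and> free_for t v \<psi>)"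
| "free_for t v (Forall w \<phi>) = (v \<notin> fv (Forall w \<phi>) \<or> w \<notin> tvars t \<and> free_for t v \<phi>)"
| "free_for t v (Exists w \<phi>) = (v \<notin> fv (Exists w \<phi>) \<or> w \<notin> tvars t \<and> free_for t v \<phi>)"
| "free_for t v _ = True"

text \<open>To write long formulas of the object language, quantifiers are bound in the style of
  higher-order abstract syntax: \<open>\<^bold>\<forall>x. F x\<close> is \<open>Forall v (F (Var v))\<close>, where \<open>v\<close> is larger than every
  variable (free or bound) of \<open>F Zero\<close>.\<close>

primrec tmax :: "tm \<Rightarrow> nat" where
  "tmax (Var n) = n"
| "tmax Zero = 0"
| "tmax (Sc t) = tmax t"
| "tmax (Plus s t) = max (tmax s) (tmax t)"
| "tmax (Times s t) = max (tmax s) (tmax t)"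
| "tmax (Fu t) = tmax t"

primrec fmax :: "fm \<Rightarrow> nat" where
  "fmax (s \<^bold>= t) = max (tmax s) (tmax t)"
| "fmax (PU t) = tmax t"
| "fmax (K1 t) = tmax t"
| "fmax (K2 s t) = max (tmax s) (tmax t)"
| "fmax (Tr t) = tmax t"
| "fmax (Ag t) = tmax t"
| "fmax (\<^bold>\<not> \<phi>) = fmax \<phi>"
| "fmax (\<phi> \<^bold>\<longrightarrow> \<psi>) = max (fmax \<phi>) (fmax \<psi>)"
| "fmax (\<phi> \<^bold>\<and> \<psi>) = max (fmax \<phi>) (fmax \<psi>)"
| "fmax (\<phi> \<^bold>\<or> \<psi>) = max (fmax \<phi>) (fmax \<psi>)"
| "fmax (Forall v \<phi>) = max v (fmax \<phi>)"
| "fmax (Exists v \<phi>) = max v (fmax \<phi>)"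

definition all_fm :: "(tm \<Rightarrow> fm) \<Rightarrow> fm" (binder "\<^bold>\<forall>" 40)
  where "all_fm F = (let v = Suc (fmax (F Zero)) in Forall v (F (Var v)))"

definition ex_fm :: "(tm \<Rightarrow> fm) \<Rightarrow> fm" (binder "\<^bold>\<exists>" 40)
  where "ex_fm F = (let v = Suc (fmax (F Zero)) in Exists v (F (Var v)))"


section \<open>Goedel numbering\<close>

primrec num :: "nat \<Rightarrow> tm" where
  "num 0 = Zero"
| "num (Suc n) = Sc (num n)"

primrec code_tm :: "tm \<Rightarrow> nat" where
  "code_tm (Var n) = prod_encode (0, n)"
| "code_tm Zero = prod_encode (1, 0)"
| "code_tm (Sc t) = prod_encode (2, code_tm t)"
| "code_tm (Plus s t) = prod_encode (3, prod_encode (code_tm s, code_tm t))"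
| "code_tm (Times s t) = prod_encode (4, prod_encode (code_tm s, code_tm t))"
| "code_tm (Fu t) = prod_encode (5, code_tm t)"

primrec code :: "fm \<Rightarrow> nat" where
  "code (s \<^bold>= t) = prod_encode (6, prod_encode (code_tm s, code_tm t))"
| "code (PU t) = prod_encode (7, code_tm t)"
| "code (K1 t) = prod_encode (8, code_tm t)"
| "code (K2 s t) = prod_encode (9, prod_encode (code_tm s, code_tm t))"
| "code (Tr t) = prod_encode (10, code_tm t)"
| "code (Ag t) = prod_encode (11, code_tm t)"
| "code (\<^bold>\<not> \<phi>) = prod_encode (12, code \<phi>)"
| "code (\<phi> \<^bold>\<longrightarrow> \<psi>) = prod_encode (13, prod_encode (code \<phi>, code \<psi>))"
| "code (\<phi> \<^bold>\<and> \<psi>) = prod_encode (14, prod_encode (code \<phi>, code \<psi>))"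
| "code (\<phi> \<^bold>\<or> \<psi>) = prod_encode (15, prod_encode (code \<phi>, code \<psi>))"
| "code (Forall v \<phi>) = prod_encode (16, prod_encode (code_tm (Var v), code \<phi>))"
| "code (Exists v \<phi>) = prod_encode (17, prod_encode (code_tm (Var v), code \<phi>))"

definition gq :: "fm \<Rightarrow> tm"
  where "gq \<phi> = num (code \<phi>)"

definition gq_tm :: "tm \<Rightarrow> tm"
  where "gq_tm t = num (code_tm t)"


section \<open>Systems\<close>

inductive_set logical_schemes :: "fm set" where
  "(\<phi> \<^bold>\<longrightarrow> \<psi> \<^bold>\<longrightarrow> \<phi>) \<in> logical_schemes"
| "((\<phi> \<^bold>\<longrightarrow> \<psi> \<^bold>\<longrightarrow> \<chi>) \<^bold>\<longrightarrow> (\<phi> \<^bold>\<longrightarrow> \<psi>) \<^bold>\<longrightarrow> (\<phi> \<^bold>\<longrightarrow> \<chi>)) \<in> logical_schemes"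
| "((\<^bold>\<not> \<phi> \<^bold>\<longrightarrow> \<^bold>\<not> \<psi>) \<^bold>\<longrightarrow> (\<psi> \<^bold>\<longrightarrow> \<phi>)) \<in> logical_schemes"
| "(\<phi> \<^bold>\<and> \<psi> \<^bold>\<longrightarrow> \<phi>) \<in> logical_schemes"
| "(\<phi> \<^bold>\<and> \<psi> \<^bold>\<longrightarrow> \<psi>) \<in> logical_schemes"
| "(\<phi> \<^bold>\<longrightarrow> \<psi> \<^bold>\<longrightarrow> \<phi> \<^bold>\<and> \<psi>) \<in> logical_schemes"
| "(\<phi> \<^bold>\<longrightarrow> \<phi> \<^bold>\<or> \<psi>) \<in> logical_schemes"
| "(\<psi> \<^bold>\<longrightarrow> \<phi> \<^bold>\<or> \<psi>) \<in> logical_schemes"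
| "((\<phi> \<^bold>\<longrightarrow> \<chi>) \<^bold>\<longrightarrow> (\<psi> \<^bold>\<longrightarrow> \<chi>) \<^bold>\<longrightarrow> (\<phi> \<^bold>\<or> \<psi> \<^bold>\<longrightarrow> \<chi>)) \<in> logical_schemes"
| "free_for t v \<phi> \<Longrightarrow> (Forall v \<phi> \<^bold>\<longrightarrow> sbt \<phi> t v) \<in> logical_schemes"
| "(Forall v (\<phi> \<^bold>\<longrightarrow> \<psi>) \<^bold>\<longrightarrow> (Forall v \<phi> \<^bold>\<longrightarrow> Forall v \<psi>)) \<in> logical_schemes"
| "v \<notin> fv \<phi> \<Longrightarrow> (\<phi> \<^bold>\<longrightarrow> Forall v \<phi>) \<in> logical_schemes"
| "(Exists v \<phi> \<^bold>\<longrightarrow> \<^bold>\<not> Forall v (\<^bold>\<not> \<phi>)) \<in> logical_schemes"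
| "(\<^bold>\<not> Forall v (\<^bold>\<not> \<phi>) \<^bold>\<longrightarrow> Exists v \<phi>) \<in> logical_schemes"

definition equality_axioms :: "fm list" where
  "equality_axioms =
    [\<^bold>\<forall>x. x \<^bold>= x,
     \<^bold>\<forall>x. \<^bold>\<forall>y. x \<^bold>= y \<^bold>\<longrightarrow> y \<^bold>= x,
     \<^bold>\<forall>x. \<^bold>\<forall>y. \<^bold>\<forall>z. x \<^bold>= y \<^bold>\<longrightarrow> y \<^bold>= z \<^bold>\<longrightarrow> x \<^bold>= z,
     \<^bold>\<forall>x. \<^bold>\<forall>y. x \<^bold>= y \<^bold>\<longrightarrow> Sc x \<^bold>= Sc y,
     \<^bold>\<forall>x. \<^bold>\<forall>y. \<^bold>\<forall>z. \<^bold>\<forall>w. x \<^bold>= y \<^bold>\<longrightarrow> z \<^bold>= w \<^bold>\<longrightarrow> Plus x z \<^bold>= Plus y w,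
     \<^bold>\<forall>x. \<^bold>\<forall>y. \<^bold>\<forall>z. \<^bold>\<forall>w. x \<^bold>= y \<^bold>\<longrightarrow> z \<^bold>= w \<^bold>\<longrightarrow> Times x z \<^bold>= Times y w,
     \<^bold>\<forall>x. \<^bold>\<forall>y. x \<^bold>= y \<^bold>\<longrightarrow> Fu x \<^bold>= Fu y,
     \<^bold>\<forall>x. \<^bold>\<forall>y. x \<^bold>= y \<^bold>\<longrightarrow> PU x \<^bold>\<longrightarrow> PU y,
     \<^bold>\<forall>x. \<^bold>\<forall>y. x \<^bold>= y \<^bold>\<longrightarrow> K1 x \<^bold>\<longrightarrow> K1 y,
     \<^bold>\<forall>x. \<^bold>\<forall>y. \<^bold>\<forall>z. \<^bold>\<forall>w. x \<^bold>= y \<^bold>\<longrightarrow> z \<^bold>= w \<^bold>\<longrightarrow> K2 x z \<^bold>\<longrightarrow> K2 y w,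
     \<^bold>\<forall>x. \<^bold>\<forall>y. x \<^bold>= y \<^bold>\<longrightarrow> Tr x \<^bold>\<longrightarrow> Tr y,
     \<^bold>\<forall>x. \<^bold>\<forall>y. x \<^bold>= y \<^bold>\<longrightarrow> Ag x \<^bold>\<longrightarrow> Ag y]"

definition successor_axioms :: "fm list" where
  "successor_axioms =
    [\<^bold>\<forall>x. \<^bold>\<not> Sc x \<^bold>= Zero,
     \<^bold>\<forall>x. \<^bold>\<forall>y. Sc x \<^bold>= Sc y \<^bold>\<longrightarrow> x \<^bold>= y,
     \<^bold>\<forall>x. Plus x Zero \<^bold>= x,
     \<^bold>\<forall>x. \<^bold>\<forall>y. Plus x (Sc y) \<^bold>= Sc (Plus x y),
     \<^bold>\<forall>x. Times x Zero \<^bold>= Zero,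
     \<^bold>\<forall>x. \<^bold>\<forall>y. Times x (Sc y) \<^bold>= Plus (Times x y) x]"

definition induction_instances :: "fm set" where
  "induction_instances =
    {(sbt \<phi> Zero v \<^bold>\<and> Forall v (\<phi> \<^bold>\<longrightarrow> sbt \<phi> (Sc (Var v)) v)) \<^bold>\<longrightarrow> Forall v \<phi> | \<phi> v. True}"

inductive_set generalizations :: "fm set \<Rightarrow> fm set" for \<Gamma> where
  "\<phi> \<in> \<Gamma> \<Longrightarrow> \<phi> \<in> generalizations \<Gamma>"
| "\<phi> \<in> generalizations \<Gamma> \<Longrightarrow> Forall v \<phi> \<in> generalizations \<Gamma>"

text \<open>Theorems are sentences and modus ponens is the only logical rule, so the schemes enter through
  all their generalizations that are sentences; generalization is then a derived rule.\<close>

definition logical_axioms :: "fm set" where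
  "logical_axioms = {\<phi> \<in> generalizations logical_schemes. sentence \<phi>} \<union> set equality_axioms"

definition PA_axioms :: "fm set" where
  "PA_axioms = set successor_axioms \<union> {\<phi> \<in> generalizations induction_instances. sentence \<phi>}"

text \<open>A rule is the set of its (premise, conclusion) pairs.\<close>

record system =
  axms :: "fm set"
  rules :: "(fm \<times> fm) set"

inductive_set theorems :: "system \<Rightarrow> fm set" for S where
  logical: "\<phi> \<in> logical_axioms \<Longrightarrow> \<phi> \<in> theorems S"
| axiom: "\<phi> \<in> axms S \<Longrightarrow> \<phi> \<in> theorems S"
| mp: "(\<phi> \<^bold>\<longrightarrow> \<psi>) \<in> theorems S \<Longrightarrow> \<phi> \<in> theorems S \<Longrightarrow> \<psi> \<in> theorems S"
| rule: "\<phi> \<in> theorems S \<Longrightarrow> (\<phi>, \<psi>) \<in> rules S \<Longrightarrow> \<psi> \<in> theorems S"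

definition consistent :: "system \<Rightarrow> bool"
  where "consistent S \<longleftrightarrow> \<not> (\<exists>\<phi>. \<phi> \<in> theorems S \<and> (\<^bold>\<not> \<phi>) \<in> theorems S)"

definition join :: "system \<Rightarrow> system \<Rightarrow> system"
  where "join S S' = \<lparr>axms = axms S \<union> axms S', rules = rules S \<union> rules S'\<rparr>"

definition add_axioms :: "system \<Rightarrow> fm set \<Rightarrow> system" (infixl "\<oplus>" 65)
  where "S \<oplus> \<Gamma> = \<lparr>axms = axms S \<union> \<Gamma>, rules = rules S\<rparr>"

definition add_rule :: "system \<Rightarrow> (fm \<times> fm) set \<Rightarrow> system"
  where "add_rule S R = \<lparr>axms = axms S, rules = rules S \<union> R\<rparr>"

definition Base :: system
  where "Base = \<lparr>axms = PA_axioms, rules = {}\<rparr>"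


section \<open>Arithmetization\<close>

text \<open>Formulas whose names end in \<open>F\<close> define relations on codes in the arithmetical part of the
  language. A function is represented by its graph, the value being the last argument.\<close>

definition lessF :: "tm \<Rightarrow> tm \<Rightarrow> fm"
  where "lessF s t = (\<^bold>\<exists>d. Plus s (Sc d) \<^bold>= t)"

text \<open>The graph of \<open>prod_encode\<close>: \<open>2 z = (x + y) (x + y + 1) + 2 x\<close>.\<close>

definition pairF :: "tm \<Rightarrow> tm \<Rightarrow> tm \<Rightarrow> fm" where
  "pairF x y z = (Plus z z \<^bold>= Plus (Times (Plus x y) (Sc (Plus x y))) (Plus x x))"

definition nodeF :: "nat \<Rightarrow> tm \<Rightarrow> tm \<Rightarrow> fm"
  where "nodeF k x z = pairF (num k) x z"

definition node2F :: "nat \<Rightarrow> tm \<Rightarrow> tm \<Rightarrow> tm \<Rightarrow> fm"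
  where "node2F k x y z = (\<^bold>\<exists>p. pairF x y p \<^bold>\<and> nodeF k p z)"

text \<open>Goedel's beta function: \<open>y = a mod (1 + (i + 1) b)\<close>.\<close>

definition betaF :: "tm \<Rightarrow> tm \<Rightarrow> tm \<Rightarrow> tm \<Rightarrow> fm" where
  "betaF a b i y =
    (lessF y (Sc (Times (Sc i) b)) \<^bold>\<and> (\<^bold>\<exists>q. a \<^bold>= Plus (Times q (Sc (Times (Sc i) b))) y))"

text \<open>\<open>x\<close> is the last entry of a finite sequence each of whose entries \<open>y\<close> satisfies \<open>step y prev\<close>,
  where \<open>prev z\<close> says that \<open>z\<close> is an earlier entry.\<close>

definition inductiveF :: "(tm \<Rightarrow> (tm \<Rightarrow> fm) \<Rightarrow> fm) \<Rightarrow> tm \<Rightarrow> fm" where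
  "inductiveF step x =
    (\<^bold>\<exists>a. \<^bold>\<exists>b. \<^bold>\<exists>n. betaF a b n x \<^bold>\<and>
      (\<^bold>\<forall>i. lessF i (Sc n) \<^bold>\<longrightarrow>
        (\<^bold>\<exists>y. betaF a b i y \<^bold>\<and> step y (\<lambda>z. \<^bold>\<exists>j. lessF j i \<^bold>\<and> betaF a b j z))))"

subsection \<open>Terms and formulas\<close>

definition varF :: "tm \<Rightarrow> fm"
  where "varF x = (\<^bold>\<exists>n. nodeF 0 n x)"

definition pa_ctermF :: "tm \<Rightarrow> fm" where
  "pa_ctermF = inductiveF (\<lambda>x prev.
      x \<^bold>= gq_tm Zero
    \<^bold>\<or> (\<^bold>\<exists>y. prev y \<^bold>\<and> nodeF 2 y x)
    \<^bold>\<or> (\<^bold>\<exists>y. \<^bold>\<exists>z. prev y \<^bold>\<and> prev z \<^bold>\<and> (node2F 3 y z x \<^bold>\<or> node2F 4 y z x)))"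

definition ctermF :: "tm \<Rightarrow> fm" where
  "ctermF = inductiveF (\<lambda>x prev.
      x \<^bold>= gq_tm Zero
    \<^bold>\<or> (\<^bold>\<exists>y. prev y \<^bold>\<and> (nodeF 2 y x \<^bold>\<or> nodeF 5 y x))
    \<^bold>\<or> (\<^bold>\<exists>y. \<^bold>\<exists>z. prev y \<^bold>\<and> prev z \<^bold>\<and> (node2F 3 y z x \<^bold>\<or> node2F 4 y z x)))"

definition termF :: "tm \<Rightarrow> fm" where
  "termF = inductiveF (\<lambda>x prev.
      varF x \<^bold>\<or> x \<^bold>= gq_tm Zero
    \<^bold>\<or> (\<^bold>\<exists>y. prev y \<^bold>\<and> (nodeF 2 y x \<^bold>\<or> nodeF 5 y x))
    \<^bold>\<or> (\<^bold>\<exists>y. \<^bold>\<exists>z. prev y \<^bold>\<and> prev z \<^bold>\<and> (node2F 3 y z x \<^bold>\<or> node2F 4 y z x)))"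

definition atomF :: "tm \<Rightarrow> fm" where
  "atomF x =
    ((\<^bold>\<exists>s. termF s \<^bold>\<and> Disj (map (\<lambda>k. nodeF k s x) [7, 8, 10, 11]))
    \<^bold>\<or> (\<^bold>\<exists>s. \<^bold>\<exists>t. termF s \<^bold>\<and> termF t \<^bold>\<and> (node2F 6 s t x \<^bold>\<or> node2F 9 s t x)))"

definition formulaF :: "tm \<Rightarrow> fm" where
  "formulaF = inductiveF (\<lambda>x prev.
      atomF x
    \<^bold>\<or> (\<^bold>\<exists>y. prev y \<^bold>\<and> nodeF 12 y x)
    \<^bold>\<or> (\<^bold>\<exists>y. \<^bold>\<exists>z. prev y \<^bold>\<and> prev z \<^bold>\<and> Disj (map (\<lambda>k. node2F k y z x) [13, 14, 15]))
    \<^bold>\<or> (\<^bold>\<exists>v. \<^bold>\<exists>y. varF v \<^bold>\<and> prev y \<^bold>\<and> (node2F 16 v y x \<^bold>\<or> node2F 17 v y x)))"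

subsection \<open>Substitution\<close>

text \<open>\<open>y\<close> codes the result of substituting (the term coded by) \<open>t\<close> for the variable \<open>v\<close> in the term
  or formula \<open>x\<close>; the sequence lists pairs of inputs and outputs.\<close>

definition sbtF :: "tm \<Rightarrow> tm \<Rightarrow> tm \<Rightarrow> tm \<Rightarrow> fm" where
  "sbtF x t v y = (\<^bold>\<exists>p. pairF x y p \<^bold>\<and> inductiveF (\<lambda>p prev. \<^bold>\<exists>x. \<^bold>\<exists>y. pairF x y p \<^bold>\<and>
     (  (x \<^bold>= v \<^bold>\<and> y \<^bold>= t)
      \<^bold>\<or> (varF x \<^bold>\<and> \<^bold>\<not> x \<^bold>= v \<^bold>\<and> y \<^bold>= x)
      \<^bold>\<or> (x \<^bold>= gq_tm Zero \<^bold>\<and> y \<^bold>= x)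
      \<^bold>\<or> (\<^bold>\<exists>x1. \<^bold>\<exists>y1. (\<^bold>\<exists>q. pairF x1 y1 q \<^bold>\<and> prev q) \<^bold>\<and>
            Disj (map (\<lambda>k. nodeF k x1 x \<^bold>\<and> nodeF k y1 y) [2, 5, 7, 8, 10, 11, 12]))
      \<^bold>\<or> (\<^bold>\<exists>x1. \<^bold>\<exists>y1. \<^bold>\<exists>x2. \<^bold>\<exists>y2. (\<^bold>\<exists>q. pairF x1 y1 q \<^bold>\<and> prev q) \<^bold>\<and> (\<^bold>\<exists>q. pairF x2 y2 q \<^bold>\<and> prev q) \<^bold>\<and>
            Disj (map (\<lambda>k. node2F k x1 x2 x \<^bold>\<and> node2F k y1 y2 y) [3, 4, 6, 9, 13, 14, 15]))
      \<^bold>\<or> (\<^bold>\<exists>x1. Disj (map (\<lambda>k. node2F k v x1 x) [16, 17]) \<^bold>\<and> y \<^bold>= x)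
      \<^bold>\<or> (\<^bold>\<exists>w. \<^bold>\<exists>x1. \<^bold>\<exists>y1. varF w \<^bold>\<and> \<^bold>\<not> w \<^bold>= v \<^bold>\<and> (\<^bold>\<exists>q. pairF x1 y1 q \<^bold>\<and> prev q) \<^bold>\<and>
            Disj (map (\<lambda>k. node2F k w x1 x \<^bold>\<and> node2F k w y1 y) [16, 17])))) p)"

text \<open>A variable is not free in an expression iff putting \<open>Zero\<close> for it changes nothing. Variables
  occurring in a formula have codes below that of the formula.\<close>

definition not_freeF :: "tm \<Rightarrow> tm \<Rightarrow> fm"
  where "not_freeF v x = sbtF x (gq_tm Zero) v x"

definition freeF :: "tm \<Rightarrow> tm \<Rightarrow> fm"
  where "freeF v x = (\<^bold>\<exists>z. sbtF x (gq_tm Zero) v z \<^bold>\<and> \<^bold>\<not> z \<^bold>= x)"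

definition sentenceF :: "tm \<Rightarrow> fm" where
  "sentenceF x = (formulaF x \<^bold>\<and> (\<^bold>\<forall>v. lessF v x \<^bold>\<longrightarrow> varF v \<^bold>\<longrightarrow> not_freeF v x))"

text \<open>\<open>x\<close> codes a formula whose only free variable is \<open>v\<close>.\<close>

definition formula1F :: "tm \<Rightarrow> tm \<Rightarrow> fm" where
  "formula1F v x = (formulaF x \<^bold>\<and> freeF v x \<^bold>\<and>
    (\<^bold>\<forall>w. lessF w x \<^bold>\<longrightarrow> varF w \<^bold>\<longrightarrow> \<^bold>\<not> w \<^bold>= v \<^bold>\<longrightarrow> not_freeF w x))"

definition free_forF :: "tm \<Rightarrow> tm \<Rightarrow> tm \<Rightarrow> fm" where
  "free_forF t v = inductiveF (\<lambda>x prev.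
      atomF x
    \<^bold>\<or> (\<^bold>\<exists>y. prev y \<^bold>\<and> nodeF 12 y x)
    \<^bold>\<or> (\<^bold>\<exists>y. \<^bold>\<exists>z. prev y \<^bold>\<and> prev z \<^bold>\<and> Disj (map (\<lambda>k. node2F k y z x) [13, 14, 15]))
    \<^bold>\<or> (\<^bold>\<exists>w. \<^bold>\<exists>y. varF w \<^bold>\<and> (node2F 16 w y x \<^bold>\<or> node2F 17 w y x) \<^bold>\<and>
          (not_freeF v x \<^bold>\<or> (not_freeF w t \<^bold>\<and> prev y))))"

subsection \<open>Numerals and values\<close>

definition numF :: "tm \<Rightarrow> tm \<Rightarrow> fm" where
  "numF n x = (\<^bold>\<exists>p. pairF n x p \<^bold>\<and> inductiveF (\<lambda>p prev.
      pairF Zero (gq_tm Zero) p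
    \<^bold>\<or> (\<^bold>\<exists>m. \<^bold>\<exists>y. \<^bold>\<exists>z. (\<^bold>\<exists>q. pairF m y q \<^bold>\<and> prev q) \<^bold>\<and> nodeF 2 y z \<^bold>\<and> pairF (Sc m) z p)) p)"

definition valF :: "tm \<Rightarrow> tm \<Rightarrow> fm" where
  "valF x n = (\<^bold>\<exists>p. pairF x n p \<^bold>\<and> inductiveF (\<lambda>p prev.
      pairF (gq_tm Zero) Zero p
    \<^bold>\<or> (\<^bold>\<exists>y. \<^bold>\<exists>m. \<^bold>\<exists>z. (\<^bold>\<exists>q. pairF y m q \<^bold>\<and> prev q) \<^bold>\<and> nodeF 2 y z \<^bold>\<and> pairF z (Sc m) p)
    \<^bold>\<or> (\<^bold>\<exists>y1. \<^bold>\<exists>m1. \<^bold>\<exists>y2. \<^bold>\<exists>m2. \<^bold>\<exists>z.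
          (\<^bold>\<exists>q. pairF y1 m1 q \<^bold>\<and> prev q) \<^bold>\<and> (\<^bold>\<exists>q. pairF y2 m2 q \<^bold>\<and> prev q) \<^bold>\<and>
          (  (node2F 3 y1 y2 z \<^bold>\<and> pairF z (Plus m1 m2) p)
           \<^bold>\<or> (node2F 4 y1 y2 z \<^bold>\<and> pairF z (Times m1 m2) p)))) p)"

subsection \<open>Dotted expressions\<close>

text \<open>Expressions built with the functions that the represented syntactic operations stand for.
  \<open>z \<doteq> d\<close> says that \<open>z\<close> is the value of \<open>d\<close>, and \<open>P \<bullet> d\<close> is \<open>P\<close> of the value of \<open>d\<close>.\<close>

datatype dx =
    Cst tm ("\<langle>_\<rangle>")
  | Node nat dx
  | Node2 nat dx dx
  | dSbt dx dx dx
  | dNum dx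

primrec is_value :: "dx \<Rightarrow> tm \<Rightarrow> fm" where
  "is_value \<langle>t\<rangle> = (\<lambda>z. z \<^bold>= t)"
| "is_value (Node k d) = (\<lambda>z. \<^bold>\<exists>x. is_value d x \<^bold>\<and> nodeF k x z)"
| "is_value (Node2 k d e) = (\<lambda>z. \<^bold>\<exists>x. \<^bold>\<exists>y. is_value d x \<^bold>\<and> is_value e y \<^bold>\<and> node2F k x y z)"
| "is_value (dSbt d e f) =
    (\<lambda>z. \<^bold>\<exists>x. \<^bold>\<exists>t. \<^bold>\<exists>v. is_value d x \<^bold>\<and> is_value e t \<^bold>\<and> is_value f v \<^bold>\<and> sbtF x t v z)"
| "is_value (dNum d) = (\<lambda>z. \<^bold>\<exists>x. is_value d x \<^bold>\<and> numF x z)"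

abbreviation is_value_of :: "tm \<Rightarrow> dx \<Rightarrow> fm" (infix "\<doteq>" 60)
  where "z \<doteq> d \<equiv> is_value d z"

definition at_value :: "(tm \<Rightarrow> fm) \<Rightarrow> dx \<Rightarrow> fm" (infix "\<bullet>" 60)
  where "P \<bullet> d = (\<^bold>\<exists>z. z \<doteq> d \<^bold>\<and> P z)"

abbreviation "dSc \<equiv> Node 2"
abbreviation "dT \<equiv> Node 10"
abbreviation "dK \<equiv> Node2 9"
abbreviation "dNeg \<equiv> Node 12"
abbreviation dImp (infixr "\<rightarrow>\<^sub>d" 65) where "dImp \<equiv> Node2 13"
abbreviation dAnd (infixr "\<and>\<^sub>d" 68) where "dAnd \<equiv> Node2 14"
abbreviation dOr (infixr "\<or>\<^sub>d" 67) where "dOr \<equiv> Node2 15"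
abbreviation "dAll \<equiv> Node2 16"
abbreviation "dEx \<equiv> Node2 17"

text \<open>\<open>gq \<phi>\<close> is the numeral of the code of \<open>\<phi>\<close>, so on codes the operation \<open>gq\<close> is \<open>num\<close>.\<close>

abbreviation "dGq \<equiv> dNum"

subsection \<open>Provability\<close>

definition logical_schemesF :: "tm \<Rightarrow> fm" where
  "logical_schemesF x =
    (\<^bold>\<exists>p. \<^bold>\<exists>q. \<^bold>\<exists>r. \<^bold>\<exists>v. \<^bold>\<exists>t.
      formulaF p \<^bold>\<and> formulaF q \<^bold>\<and> formulaF r \<^bold>\<and> varF v \<^bold>\<and> termF t \<^bold>\<and> Disj
      [x \<doteq> \<langle>p\<rangle> \<rightarrow>\<^sub>d \<langle>q\<rangle> \<rightarrow>\<^sub>d \<langle>p\<rangle>,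
       x \<doteq> (\<langle>p\<rangle> \<rightarrow>\<^sub>d \<langle>q\<rangle> \<rightarrow>\<^sub>d \<langle>r\<rangle>) \<rightarrow>\<^sub>d (\<langle>p\<rangle> \<rightarrow>\<^sub>d \<langle>q\<rangle>) \<rightarrow>\<^sub>d (\<langle>p\<rangle> \<rightarrow>\<^sub>d \<langle>r\<rangle>),
       x \<doteq> (dNeg \<langle>p\<rangle> \<rightarrow>\<^sub>d dNeg \<langle>q\<rangle>) \<rightarrow>\<^sub>d (\<langle>q\<rangle> \<rightarrow>\<^sub>d \<langle>p\<rangle>),
       x \<doteq> (\<langle>p\<rangle> \<and>\<^sub>d \<langle>q\<rangle>) \<rightarrow>\<^sub>d \<langle>p\<rangle>,
       x \<doteq> (\<langle>p\<rangle> \<and>\<^sub>d \<langle>q\<rangle>) \<rightarrow>\<^sub>d \<langle>q\<rangle>,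
       x \<doteq> \<langle>p\<rangle> \<rightarrow>\<^sub>d \<langle>q\<rangle> \<rightarrow>\<^sub>d (\<langle>p\<rangle> \<and>\<^sub>d \<langle>q\<rangle>),
       x \<doteq> \<langle>p\<rangle> \<rightarrow>\<^sub>d (\<langle>p\<rangle> \<or>\<^sub>d \<langle>q\<rangle>),
       x \<doteq> \<langle>q\<rangle> \<rightarrow>\<^sub>d (\<langle>p\<rangle> \<or>\<^sub>d \<langle>q\<rangle>),
       x \<doteq> (\<langle>p\<rangle> \<rightarrow>\<^sub>d \<langle>r\<rangle>) \<rightarrow>\<^sub>d (\<langle>q\<rangle> \<rightarrow>\<^sub>d \<langle>r\<rangle>) \<rightarrow>\<^sub>d ((\<langle>p\<rangle> \<or>\<^sub>d \<langle>q\<rangle>) \<rightarrow>\<^sub>d \<langle>r\<rangle>),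
       free_forF t v p \<^bold>\<and> x \<doteq> dAll \<langle>v\<rangle> \<langle>p\<rangle> \<rightarrow>\<^sub>d dSbt \<langle>p\<rangle> \<langle>t\<rangle> \<langle>v\<rangle>,
       x \<doteq> dAll \<langle>v\<rangle> (\<langle>p\<rangle> \<rightarrow>\<^sub>d \<langle>q\<rangle>) \<rightarrow>\<^sub>d (dAll \<langle>v\<rangle> \<langle>p\<rangle> \<rightarrow>\<^sub>d dAll \<langle>v\<rangle> \<langle>q\<rangle>),
       not_freeF v p \<^bold>\<and> x \<doteq> \<langle>p\<rangle> \<rightarrow>\<^sub>d dAll \<langle>v\<rangle> \<langle>p\<rangle>,
       x \<doteq> dEx \<langle>v\<rangle> \<langle>p\<rangle> \<rightarrow>\<^sub>d dNeg (dAll \<langle>v\<rangle> (dNeg \<langle>p\<rangle>)),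
       x \<doteq> dNeg (dAll \<langle>v\<rangle> (dNeg \<langle>p\<rangle>)) \<rightarrow>\<^sub>d dEx \<langle>v\<rangle> \<langle>p\<rangle>])"

definition induction_instancesF :: "tm \<Rightarrow> fm" where
  "induction_instancesF x =
    (\<^bold>\<exists>p. \<^bold>\<exists>v. formulaF p \<^bold>\<and> varF v \<^bold>\<and>
      x \<doteq> (dSbt \<langle>p\<rangle> \<langle>gq_tm Zero\<rangle> \<langle>v\<rangle> \<and>\<^sub>d dAll \<langle>v\<rangle> (\<langle>p\<rangle> \<rightarrow>\<^sub>d dSbt \<langle>p\<rangle> (dSc \<langle>v\<rangle>) \<langle>v\<rangle>)) \<rightarrow>\<^sub>d
            dAll \<langle>v\<rangle> \<langle>p\<rangle>)"

definition generalizationsF :: "(tm \<Rightarrow> fm) \<Rightarrow> tm \<Rightarrow> fm" where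
  "generalizationsF A = inductiveF (\<lambda>x prev.
      A x \<^bold>\<or> (\<^bold>\<exists>v. \<^bold>\<exists>y. varF v \<^bold>\<and> prev y \<^bold>\<and> node2F 16 v y x))"

definition listF :: "fm list \<Rightarrow> tm \<Rightarrow> fm"
  where "listF \<phi>s x = Disj (map (\<lambda>\<phi>. x \<^bold>= gq \<phi>) \<phi>s)"

definition logical_axiomsF :: "tm \<Rightarrow> fm" where
  "logical_axiomsF x =
    ((generalizationsF logical_schemesF x \<^bold>\<and> sentenceF x) \<^bold>\<or> listF equality_axioms x)"

definition PA_axiomsF :: "tm \<Rightarrow> fm" where
  "PA_axiomsF x =
    (listF successor_axioms x \<^bold>\<or> (generalizationsF induction_instancesF x \<^bold>\<and> sentenceF x))"

text \<open>The standard provability predicate of a system whose axioms are given by \<open>A\<close> and which has no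
  rule except modus ponens: \<open>x\<close> ends a sequence of axioms and consequences by modus ponens.\<close>

definition provableF :: "(tm \<Rightarrow> fm) \<Rightarrow> tm \<Rightarrow> fm" where
  "provableF A = inductiveF (\<lambda>x prev.
      logical_axiomsF x \<^bold>\<or> A x \<^bold>\<or> (\<^bold>\<exists>y. prev y \<^bold>\<and> prev \<bullet> (\<langle>y\<rangle> \<rightarrow>\<^sub>d \<langle>x\<rangle>)))"


section \<open>The systems\<close>

definition all_in :: "(tm \<Rightarrow> fm) \<Rightarrow> (tm \<Rightarrow> fm) \<Rightarrow> fm"
  where "all_in P F = (\<^bold>\<forall>x. P x \<^bold>\<longrightarrow> F x)"

definition ex_in :: "(tm \<Rightarrow> fm) \<Rightarrow> (tm \<Rightarrow> fm) \<Rightarrow> fm"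
  where "ex_in P F = (\<^bold>\<exists>x. P x \<^bold>\<and> F x)"

syntax
  "_all_in" :: "pttrn \<Rightarrow> (tm \<Rightarrow> fm) \<Rightarrow> fm \<Rightarrow> fm" ("(3\<^bold>\<forall>_\<^bold>\<in>_./ _)" [0, 0, 40] 40)
  "_ex_in" :: "pttrn \<Rightarrow> (tm \<Rightarrow> fm) \<Rightarrow> fm \<Rightarrow> fm" ("(3\<^bold>\<exists>_\<^bold>\<in>_./ _)" [0, 0, 40] 40)
translations
  "\<^bold>\<forall>x\<^bold>\<in>P. F" == "CONST all_in P (\<lambda>x. F)"
  "\<^bold>\<exists>x\<^bold>\<in>P. F" == "CONST ex_in P (\<lambda>x. F)"

definition Nontriviality :: fm
  where "Nontriviality = (\<^bold>\<exists>\<alpha>. Ag \<alpha>)"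

definition K1_K2 :: fm
  where "K1_K2 = (\<^bold>\<forall>\<phi>\<^bold>\<in>sentenceF. K1 \<phi> \<^bold>\<longleftrightarrow> (\<^bold>\<forall>\<alpha>\<^bold>\<in>Ag. K2 \<alpha> \<phi>))"

definition UK :: fm where
  "UK = (\<^bold>\<forall>\<alpha>\<^bold>\<in>Ag. \<^bold>\<forall>\<phi>\<^bold>\<in>sentenceF. \<^bold>\<forall>\<psi>\<^bold>\<in>sentenceF.
          (K2 \<alpha> \<phi> \<^bold>\<and> K2 \<alpha> \<bullet> (\<langle>\<phi>\<rangle> \<rightarrow>\<^sub>d \<langle>\<psi>\<rangle>)) \<^bold>\<longrightarrow> K2 \<alpha> \<psi>)"

text \<open>The provability predicate of DCB has to mention the axiom \<open>R_DCB\<close>, in which it occurs itself.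
  The circle is closed by diagonalization: the code of \<open>R_DCB\<close> is computed inside arithmetic as the
  result of substituting the numeral of \<open>gq R_template\<close> for \<open>Var 0\<close> in \<open>R_template\<close>. That this
  describes \<open>R_DCB\<close> is lemma \<open>R_DCB_fixed_point\<close> below.\<close>

definition DCB_axiomsF :: "tm \<Rightarrow> tm \<Rightarrow> fm" where
  "DCB_axiomsF d x =
    (PA_axiomsF x \<^bold>\<or> listF [Nontriviality, K1_K2, UK] x
      \<^bold>\<or> x \<doteq> dSbt \<langle>d\<rangle> (dNum \<langle>d\<rangle>) \<langle>gq_tm (Var 0)\<rangle>)"

definition R_template :: fm where
  "R_template =
    (\<^bold>\<forall>\<alpha>\<^bold>\<in>Ag. \<^bold>\<forall>\<phi>\<^bold>\<in>sentenceF. provableF (DCB_axiomsF (Var 0)) \<phi> \<^bold>\<longrightarrow> K2 \<alpha> \<phi>)"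

definition Pr_DCB :: "tm \<Rightarrow> fm"
  where "Pr_DCB = provableF (DCB_axiomsF (gq R_template))"

definition R_DCB :: fm
  where "R_DCB = (\<^bold>\<forall>\<alpha>\<^bold>\<in>Ag. \<^bold>\<forall>\<phi>\<^bold>\<in>sentenceF. Pr_DCB \<phi> \<^bold>\<longrightarrow> K2 \<alpha> \<phi>)"

definition DCB :: system
  where "DCB = Base \<oplus> {Nontriviality, K1_K2, UK, R_DCB}"

text \<open>The atomic formulas of the language without the epistemic predicates and truth.\<close>

fun atomic_minus :: "fm \<Rightarrow> bool" where
  "atomic_minus (s \<^bold>= t) = True"
| "atomic_minus (PU t) = True"
| "atomic_minus (Ag t) = True"
| "atomic_minus _ = False"

definition Foralls :: "nat list \<Rightarrow> fm \<Rightarrow> fm"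
  where "Foralls xs \<phi> = foldr Forall xs \<phi>"

text \<open>For \<open>R\<close> with the free variables \<open>xs\<close>, the term substituted for \<open>x\<close> is held by the new variable
  \<open>N + x\<close>, and \<open>x\<close> itself ranges over the value of that term. The terms being closed, iterated and
  simultaneous substitution agree.\<close>

definition T_atomic :: "fm \<Rightarrow> fm" where
  "T_atomic R =
    (let xs = sorted_list_of_set (fv R); N = Suc (fmax R) in
      Foralls (map (\<lambda>x. N + x) xs)
        (Conj (map (\<lambda>x. pa_ctermF (Var (N + x))) xs) \<^bold>\<longrightarrow>
          Foralls xs
            (Conj (map (\<lambda>x. valF (Var (N + x)) (Var x)) xs) \<^bold>\<longrightarrow>
              (Tr \<bullet> fold (\<lambda>x d. dSbt d \<langle>Var (N + x)\<rangle> \<langle>gq_tm (Var x)\<rangle>) xs \<langle>gq R\<rangle> \<^bold>\<longleftrightarrow> R))))"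

definition T_neg :: fm
  where "T_neg = (\<^bold>\<forall>\<phi>\<^bold>\<in>sentenceF. Tr \<bullet> dNeg \<langle>\<phi>\<rangle> \<^bold>\<longleftrightarrow> \<^bold>\<not> Tr \<phi>)"

definition T_imp :: fm where
  "T_imp = (\<^bold>\<forall>\<phi>\<^bold>\<in>sentenceF. \<^bold>\<forall>\<psi>\<^bold>\<in>sentenceF. Tr \<bullet> (\<langle>\<phi>\<rangle> \<rightarrow>\<^sub>d \<langle>\<psi>\<rangle>) \<^bold>\<longleftrightarrow> (Tr \<phi> \<^bold>\<longrightarrow> Tr \<psi>))"

definition T_and :: fm where
  "T_and = (\<^bold>\<forall>\<phi>\<^bold>\<in>sentenceF. \<^bold>\<forall>\<psi>\<^bold>\<in>sentenceF. Tr \<bullet> (\<langle>\<phi>\<rangle> \<and>\<^sub>d \<langle>\<psi>\<rangle>) \<^bold>\<longleftrightarrow> (Tr \<phi> \<^bold>\<and> Tr \<psi>))"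

definition T_or :: fm where
  "T_or = (\<^bold>\<forall>\<phi>\<^bold>\<in>sentenceF. \<^bold>\<forall>\<psi>\<^bold>\<in>sentenceF. Tr \<bullet> (\<langle>\<phi>\<rangle> \<or>\<^sub>d \<langle>\<psi>\<rangle>) \<^bold>\<longleftrightarrow> (Tr \<phi> \<^bold>\<or> Tr \<psi>))"

definition T_all :: fm where
  "T_all = (\<^bold>\<forall>v\<^bold>\<in>varF. \<^bold>\<forall>\<phi>\<^bold>\<in>formula1F v.
     Tr \<bullet> dAll \<langle>v\<rangle> \<langle>\<phi>\<rangle> \<^bold>\<longleftrightarrow> (\<^bold>\<forall>t\<^bold>\<in>ctermF. Tr \<bullet> dSbt \<langle>\<phi>\<rangle> \<langle>t\<rangle> \<langle>v\<rangle>))"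

definition T_ex :: fm where
  "T_ex = (\<^bold>\<forall>v\<^bold>\<in>varF. \<^bold>\<forall>\<phi>\<^bold>\<in>formula1F v.
     Tr \<bullet> dEx \<langle>v\<rangle> \<langle>\<phi>\<rangle> \<^bold>\<longleftrightarrow> (\<^bold>\<exists>t\<^bold>\<in>ctermF. Tr \<bullet> dSbt \<langle>\<phi>\<rangle> \<langle>t\<rangle> \<langle>v\<rangle>))"

definition NEC_T :: "(fm \<times> fm) set"
  where "NEC_T = {(\<phi>, Tr (gq \<phi>)) | \<phi>. sentence \<phi>}"

definition CONEC_T :: "(fm \<times> fm) set"
  where "CONEC_T = {(Tr (gq \<phi>), \<phi>) | \<phi>. sentence \<phi>}"

definition FS :: system where
  "FS = add_rule (add_rule
     (Base \<oplus> {T_atomic R | R. atomic_minus R} \<oplus> {T_neg, T_imp, T_and, T_or, T_all, T_ex})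
     NEC_T) CONEC_T"

definition V :: fm
  where "V = (\<^bold>\<forall>\<alpha>\<^bold>\<in>Ag. \<^bold>\<forall>\<phi>\<^bold>\<in>sentenceF. K2 \<alpha> \<phi> \<^bold>\<longrightarrow> Tr \<phi>)"

definition NEC_K :: "(fm \<times> fm) set"
  where "NEC_K = {(\<phi>, \<^bold>\<forall>\<alpha>\<^bold>\<in>Ag. K2 \<alpha> (gq \<phi>)) | \<phi>. sentence \<phi>}"

definition KT :: system
  where "KT = add_rule (join DCB FS \<oplus> {V}) NEC_K"

definition UBF :: fm where
  "UBF = (\<^bold>\<forall>\<alpha>\<^bold>\<in>Ag. \<^bold>\<forall>v\<^bold>\<in>varF. \<^bold>\<forall>\<phi>\<^bold>\<in>formula1F v.
     (\<^bold>\<forall>t\<^bold>\<in>pa_ctermF. K2 \<alpha> \<bullet> dSbt \<langle>\<phi>\<rangle> \<langle>t\<rangle> \<langle>v\<rangle>) \<^bold>\<longrightarrow> K2 \<alpha> \<bullet> dAll \<langle>v\<rangle> \<langle>\<phi>\<rangle>)"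

definition IA :: fm where
  "IA = (\<^bold>\<forall>\<alpha>\<^bold>\<in>Ag. \<^bold>\<forall>\<phi>\<^bold>\<in>sentenceF.
     K2 \<alpha> \<bullet> dT (dGq \<langle>\<phi>\<rangle>) \<^bold>\<longleftrightarrow> Tr \<bullet> dK (dNum \<langle>\<alpha>\<rangle>) (dGq \<langle>\<phi>\<rangle>))"

definition In_plus :: fm where
  "In_plus = (\<^bold>\<forall>\<alpha>\<^bold>\<in>Ag. \<^bold>\<forall>\<phi>\<^bold>\<in>sentenceF.
     K2 \<alpha> \<bullet> dT (dGq \<langle>\<phi>\<rangle>) \<^bold>\<longrightarrow> K2 \<alpha> \<bullet> dK (dNum \<langle>\<alpha>\<rangle>) (dGq \<langle>\<phi>\<rangle>))"

definition In_minus :: fm where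
  "In_minus = (\<^bold>\<forall>\<alpha>\<^bold>\<in>Ag. \<^bold>\<forall>\<phi>\<^bold>\<in>sentenceF.
     \<^bold>\<not> K2 \<alpha> \<bullet> dT (dGq \<langle>\<phi>\<rangle>) \<^bold>\<longrightarrow> K2 \<alpha> \<bullet> dNeg (dK (dNum \<langle>\<alpha>\<rangle>) (dGq \<langle>\<phi>\<rangle>)))"


section \<open>All axioms are sentences, and the provability predicate of DCB mentions its own axiom\<close>

definition fvs_in :: "fm \<Rightarrow> nat set \<Rightarrow> bool"
  where "fvs_in \<phi> A \<longleftrightarrow> fv \<phi> \<subseteq> A"

named_theorems fvI

lemma [fvI]:
  "tvars s \<subseteq> A \<Longrightarrow> tvars t \<subseteq> A \<Longrightarrow> fvs_in (s \<^bold>= t) A"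
  "tvars t \<subseteq> A \<Longrightarrow> fvs_in (PU t) A"
  "tvars t \<subseteq> A \<Longrightarrow> fvs_in (K1 t) A"
  "tvars s \<subseteq> A \<Longrightarrow> tvars t \<subseteq> A \<Longrightarrow> fvs_in (K2 s t) A"
  "tvars t \<subseteq> A \<Longrightarrow> fvs_in (Tr t) A"
  "tvars t \<subseteq> A \<Longrightarrow> fvs_in (Ag t) A"
  "fvs_in \<phi> A \<Longrightarrow> fvs_in (\<^bold>\<not> \<phi>) A"
  "fvs_in \<phi> A \<Longrightarrow> fvs_in \<psi> A \<Longrightarrow> fvs_in (\<phi> \<^bold>\<longrightarrow> \<psi>) A"
  "fvs_in \<phi> A \<Longrightarrow> fvs_in \<psi> A \<Longrightarrow> fvs_in (\<phi> \<^bold>\<and> \<psi>) A"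
  "fvs_in \<phi> A \<Longrightarrow> fvs_in \<psi> A \<Longrightarrow> fvs_in (\<phi> \<^bold>\<or> \<psi>) A"
  "fvs_in \<phi> A \<Longrightarrow> fvs_in \<psi> A \<Longrightarrow> fvs_in (\<phi> \<^bold>\<longleftrightarrow> \<psi>) A"
  by (auto simp: fvs_in_def Iff_def)

lemma [fvI]:
  "(\<And>v. fvs_in (F (Var v)) (insert v A)) \<Longrightarrow> fvs_in (ex_fm F) A"
  "(\<And>v. fvs_in (F (Var v)) (insert v A)) \<Longrightarrow> fvs_in (all_fm F) A"
  "(\<And>v. fvs_in (P (Var v)) (insert v A)) \<Longrightarrow> (\<And>v. fvs_in (F (Var v)) (insert v A)) \<Longrightarrow> fvs_in (all_in P F) A"
  "(\<And>v. fvs_in (P (Var v)) (insert v A)) \<Longrightarrow> (\<And>v. fvs_in (F (Var v)) (insert v A)) \<Longrightarrow> fvs_in (ex_in P F) A"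
  by (auto simp: fvs_in_def ex_fm_def all_fm_def Let_def all_in_def ex_in_def)

lemma [fvI]:
  "(\<And>\<phi>. \<phi> \<in> set \<phi>s \<Longrightarrow> fvs_in \<phi> A) \<Longrightarrow> fvs_in (Disj \<phi>s) A"
  "(\<And>\<phi>. \<phi> \<in> set \<phi>s \<Longrightarrow> fvs_in \<phi> A) \<Longrightarrow> fvs_in (Conj \<phi>s) A"
  unfolding Disj_def Conj_def fvs_in_def by (induction \<phi>s) auto

lemma tvars_num [simp]: "tvars (num n) = {}"
  by (induction n) auto
lemma tvars_gq [simp]: "tvars (gq \<phi>) = {}" "tvars (gq_tm t) = {}"
  by (simp_all add: gq_def gq_tm_def)

lemma [fvI]: "tvars s \<subseteq> A \<Longrightarrow> tvars t \<subseteq> A \<Longrightarrow> fvs_in (lessF s t) A"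
  unfolding lessF_def by (auto intro!: fvI simp: subset_insertI2)
lemma [fvI]: "tvars x \<subseteq> A \<Longrightarrow> tvars y \<subseteq> A \<Longrightarrow> tvars z \<subseteq> A \<Longrightarrow> fvs_in (pairF x y z) A"
  unfolding pairF_def by (auto intro!: fvI simp: subset_insertI2)
lemma [fvI]: "tvars x \<subseteq> A \<Longrightarrow> tvars y \<subseteq> A \<Longrightarrow> fvs_in (nodeF k x y) A"
  unfolding nodeF_def by (auto intro!: fvI simp: subset_insertI2)
lemma [fvI]: "tvars x \<subseteq> A \<Longrightarrow> tvars y \<subseteq> A \<Longrightarrow> tvars z \<subseteq> A \<Longrightarrow> fvs_in (node2F k x y z) A"
  unfolding node2F_def by (auto intro!: fvI simp: subset_insertI2)
lemma [fvI]: "tvars a \<subseteq> A \<Longrightarrow> tvars b \<subseteq> A \<Longrightarrow> tvars i \<subseteq> A \<Longrightarrow> tvars y \<subseteq> A \<Longrightarrow> fvs_in (betaF a b i y) A"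
  unfolding betaF_def by (auto intro!: fvI simp: subset_insertI2)

lemma [fvI]:
  assumes "\<And>y prev B. A \<subseteq> B \<Longrightarrow> tvars y \<subseteq> B \<Longrightarrow>
      (\<And>z C. B \<subseteq> C \<Longrightarrow> tvars z \<subseteq> C \<Longrightarrow> fvs_in (prev z) C) \<Longrightarrow> fvs_in (step y prev) B"
    and "tvars x \<subseteq> A"
  shows "fvs_in (inductiveF step x) A"
  unfolding inductiveF_def using assms(2)
  by (auto intro!: fvI assms(1) simp: subset_insertI2)

lemma [fvI]: "tvars x \<subseteq> A \<Longrightarrow> fvs_in (varF x) A"
  unfolding varF_def by (auto intro!: fvI simp: subset_insertI2)
lemma [fvI]: "tvars x \<subseteq> A \<Longrightarrow> fvs_in (pa_ctermF x) A"
  unfolding pa_ctermF_def by (auto intro!: fvI simp: subset_insertI2)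
lemma [fvI]: "tvars x \<subseteq> A \<Longrightarrow> fvs_in (ctermF x) A"
  unfolding ctermF_def by (auto intro!: fvI simp: subset_insertI2)
lemma [fvI]: "tvars x \<subseteq> A \<Longrightarrow> fvs_in (termF x) A"
  unfolding termF_def by (auto intro!: fvI simp: subset_insertI2)
lemma [fvI]: "tvars x \<subseteq> A \<Longrightarrow> fvs_in (atomF x) A"
  unfolding atomF_def by (auto intro!: fvI simp: subset_insertI2)
lemma [fvI]: "tvars x \<subseteq> A \<Longrightarrow> fvs_in (formulaF x) A"
  unfolding formulaF_def by (auto intro!: fvI simp: subset_insertI2)
lemma [fvI]: "tvars x \<subseteq> A \<Longrightarrow> tvars t \<subseteq> A \<Longrightarrow> tvars v \<subseteq> A \<Longrightarrow> tvars y \<subseteq> A \<Longrightarrow> fvs_in (sbtF x t v y) A"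
  unfolding sbtF_def by (auto intro!: fvI simp: subset_insertI2; blast)
lemma [fvI]: "tvars x \<subseteq> A \<Longrightarrow> tvars v \<subseteq> A \<Longrightarrow> fvs_in (not_freeF v x) A"
  unfolding not_freeF_def by (auto intro!: fvI simp: subset_insertI2)
lemma [fvI]: "tvars x \<subseteq> A \<Longrightarrow> tvars v \<subseteq> A \<Longrightarrow> fvs_in (freeF v x) A"
  unfolding freeF_def by (auto intro!: fvI simp: subset_insertI2)
lemma [fvI]: "tvars x \<subseteq> A \<Longrightarrow> fvs_in (sentenceF x) A"
  unfolding sentenceF_def by (auto intro!: fvI simp: subset_insertI2)
lemma [fvI]: "tvars x \<subseteq> A \<Longrightarrow> tvars v \<subseteq> A \<Longrightarrow> fvs_in (formula1F v x) A"
  unfolding formula1F_def by (auto intro!: fvI simp: subset_insertI2)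
lemma [fvI]: "tvars t \<subseteq> A \<Longrightarrow> tvars v \<subseteq> A \<Longrightarrow> tvars x \<subseteq> A \<Longrightarrow> fvs_in (free_forF t v x) A"
  unfolding free_forF_def by (auto intro!: fvI simp: subset_insertI2)
lemma [fvI]: "tvars n \<subseteq> A \<Longrightarrow> tvars x \<subseteq> A \<Longrightarrow> fvs_in (numF n x) A"
  unfolding numF_def by (auto intro!: fvI simp: subset_insertI2)
lemma [fvI]: "tvars n \<subseteq> A \<Longrightarrow> tvars x \<subseteq> A \<Longrightarrow> fvs_in (valF x n) A"
  unfolding valF_def by (auto intro!: fvI simp: subset_insertI2)

primrec dvars :: "dx \<Rightarrow> nat set" where
  "dvars \<langle>t\<rangle> = tvars t"
| "dvars (Node k d) = dvars d"
| "dvars (Node2 k d e) = dvars d \<union> dvars e"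
| "dvars (dSbt d e f) = dvars d \<union> dvars e \<union> dvars f"
| "dvars (dNum d) = dvars d"

lemma [fvI]: "dvars d \<subseteq> A \<Longrightarrow> tvars z \<subseteq> A \<Longrightarrow> fvs_in (z \<doteq> d) A"
  by (induction d arbitrary: A z) (auto intro!: fvI simp: subset_insertI2)
lemma [fvI]: "dvars d \<subseteq> A \<Longrightarrow> (\<And>v. fvs_in (P (Var v)) (insert v A)) \<Longrightarrow> fvs_in (P \<bullet> d) A"
  unfolding at_value_def by (auto intro!: fvI simp: subset_insertI2)

lemma [fvI]: "tvars x \<subseteq> A \<Longrightarrow> fvs_in (logical_schemesF x) A"
  unfolding logical_schemesF_def by (auto intro!: fvI simp: subset_insertI2)
lemma [fvI]: "tvars x \<subseteq> A \<Longrightarrow> fvs_in (induction_instancesF x) A"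
  unfolding induction_instancesF_def by (auto intro!: fvI simp: subset_insertI2)
lemma [fvI]: "(\<And>y B. A \<subseteq> B \<Longrightarrow> tvars y \<subseteq> B \<Longrightarrow> fvs_in (Q y) B) \<Longrightarrow> tvars x \<subseteq> A \<Longrightarrow> fvs_in (generalizationsF Q x) A"
  unfolding generalizationsF_def by (auto intro!: fvI simp: subset_insertI2)
lemma [fvI]: "tvars x \<subseteq> A \<Longrightarrow> fvs_in (listF \<phi>s x) A"
  unfolding listF_def by (auto intro!: fvI simp: subset_insertI2)
lemma [fvI]: "tvars x \<subseteq> A \<Longrightarrow> fvs_in (logical_axiomsF x) A"
  unfolding logical_axiomsF_def by (auto intro!: fvI simp: subset_insertI2)
lemma [fvI]: "tvars x \<subseteq> A \<Longrightarrow> fvs_in (PA_axiomsF x) A"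
  unfolding PA_axiomsF_def by (auto intro!: fvI simp: subset_insertI2)
lemma [fvI]: "(\<And>y B. A \<subseteq> B \<Longrightarrow> tvars y \<subseteq> B \<Longrightarrow> fvs_in (Q y) B) \<Longrightarrow> tvars x \<subseteq> A \<Longrightarrow> fvs_in (provableF Q x) A"
  unfolding provableF_def by (auto intro!: fvI simp: subset_insertI2)
lemma [fvI]: "tvars x \<subseteq> A \<Longrightarrow> tvars d \<subseteq> A \<Longrightarrow> fvs_in (DCB_axiomsF d x) A"
  unfolding DCB_axiomsF_def by (auto intro!: fvI simp: subset_insertI2)
lemma [fvI]: "tvars x \<subseteq> A \<Longrightarrow> fvs_in (Pr_DCB x) A"
  unfolding Pr_DCB_def by (auto intro!: fvI simp: subset_insertI2)

lemma sentence_iff: "sentence \<phi> \<longleftrightarrow> fvs_in \<phi> {}"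
  by (simp add: sentence_def fvs_in_def)

lemma sent_DCB: "sentence Nontriviality" "sentence K1_K2" "sentence UK" "sentence R_DCB"
  unfolding sentence_iff Nontriviality_def K1_K2_def UK_def R_DCB_def by (auto intro!: fvI simp: subset_insertI2)

lemma sent_FS: "sentence T_neg" "sentence T_imp" "sentence T_and" "sentence T_or" "sentence T_all" "sentence T_ex"
  unfolding sentence_iff T_neg_def T_imp_def T_and_def T_or_def T_all_def T_ex_def by (auto intro!: fvI simp: subset_insertI2)

lemma sent_KT: "sentence V" "sentence UBF" "sentence IA" "sentence In_plus" "sentence In_minus"
  unfolding sentence_iff V_def UBF_def IA_def In_plus_def In_minus_def by (auto intro!: fvI simp: subset_insertI2)

lemma fvs_Foralls: "fvs_in \<phi> (set xs \<union> A) \<Longrightarrow> fvs_in (Foralls xs \<phi>) A"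
  unfolding Foralls_def by (induction xs arbitrary: A) (auto simp: fvs_in_def)

lemma finite_tvars: "finite (tvars t)" by (induction t) auto
lemma finite_fv: "finite (fv \<phi>)" by (induction \<phi>) (auto simp: finite_tvars)

lemma sent_T_atomic: "sentence (T_atomic R)"
proof -
  have *: "dvars (fold (\<lambda>x d. dSbt d \<langle>Var (N + x)\<rangle> \<langle>gq_tm (Var x)\<rangle>) xs d) \<subseteq> A"
    if "dvars d \<subseteq> A" "(\<lambda>x. N + x) ` set xs \<subseteq> A" for N xs d A
    using that by (induction xs arbitrary: d) auto
  have fin: "set (sorted_list_of_set (fv R)) = fv R"
    by (simp add: finite_fv)
  show ?thesis
    unfolding sentence_iff T_atomic_def Let_def
    by (intro fvs_Foralls fvI *) (auto intro!: fvs_Foralls fvI simp: fin fvs_in_def[of R])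
qed

lemma sent_eq: "\<phi> \<in> set equality_axioms \<union> set successor_axioms \<Longrightarrow> sentence \<phi>"
  unfolding sentence_iff equality_axioms_def successor_axioms_def by (auto intro!: fvI simp: subset_insertI2)


lemma sentence_theorem:
  "\<phi> \<in> theorems (KT \<oplus> {UBF, IA, In_plus, In_minus}) \<Longrightarrow> sentence \<phi>"
proof (induction rule: theorems.induct)
  case (logical \<phi>)
  then show ?case by (auto simp: logical_axioms_def sent_eq)
next
  case (axiom \<phi>)
  then show ?case
    by (auto simp: KT_def FS_def DCB_def Base_def join_def add_axioms_def add_rule_def PA_axioms_def
        sent_DCB sent_FS sent_KT sent_T_atomic sent_eq)
next
  case (mp \<phi> \<psi>)
  then show ?case by (simp add: sentence_def)
next
  case (rule \<phi> \<psi>)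
  have "sentence (\<^bold>\<forall>\<alpha>\<^bold>\<in>Ag. K2 \<alpha> (gq \<chi>))" for \<chi>
    unfolding sentence_iff by (auto intro!: fvI)
  then show ?case using rule
    by (auto simp: KT_def FS_def DCB_def Base_def join_def add_axioms_def add_rule_def
        NEC_T_def CONEC_T_def NEC_K_def sentence_def)
qed

lemma tsbt_idle: "v \<notin> tvars s \<Longrightarrow> tsbt s t v = s"
  by (induction s) auto
lemma sbt_idle: "v \<notin> fv \<phi> \<Longrightarrow> sbt \<phi> t v = \<phi>"
  by (induction \<phi>) (auto simp: tsbt_idle)

lemma tmax_num [simp]: "tmax (num n) = 0" by (induction n) auto
lemma tmax_gq [simp]: "tmax (gq \<phi>) = 0" "tmax (gq_tm t) = 0" by (simp_all add: gq_def gq_tm_def)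

lemma tmax_tsbt: "tmax t = 0 \<Longrightarrow> tmax (tsbt s t 0) = tmax s"
  by (induction s) auto
lemma fmax_sbt: "tmax t = 0 \<Longrightarrow> fmax (sbt \<phi> t 0) = fmax \<phi>"
  by (induction \<phi>) (auto simp: tmax_tsbt)

lemma sbt_ex_fm:
  assumes "tmax n = 0" "\<And>t. 0 \<notin> tvars t \<Longrightarrow> sbt (F t) n 0 = G t"
  shows "sbt (ex_fm F) n 0 = ex_fm G"
  using assms(2)[of Zero] assms(2)[of "Var (Suc k)" for k] fmax_sbt[OF assms(1), of "F Zero"]
  by (auto simp: ex_fm_def Let_def)

lemma sbt_all_fm:
  assumes "tmax n = 0" "\<And>t. 0 \<notin> tvars t \<Longrightarrow> sbt (F t) n 0 = G t"
  shows "sbt (all_fm F) n 0 = all_fm G"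
  using assms(2)[of Zero] assms(2)[of "Var (Suc k)" for k] fmax_sbt[OF assms(1), of "F Zero"]
  by (auto simp: all_fm_def Let_def)

lemma sbt_fvs_in: "fvs_in \<phi> (- {0}) \<Longrightarrow> sbt \<phi> t 0 = \<phi>"
  by (rule sbt_idle) (auto simp: fvs_in_def)

lemma sbt_inductiveF:
  assumes "tmax n = 0" "0 \<notin> tvars x"
    "\<And>y prev. 0 \<notin> tvars y \<Longrightarrow> (\<And>z. 0 \<notin> tvars z \<Longrightarrow> sbt (prev z) n 0 = prev z) \<Longrightarrow> sbt (step y prev) n 0 = step' y prev"
  shows "sbt (inductiveF step x) n 0 = inductiveF step' x"
  unfolding inductiveF_def
  by (intro sbt_ex_fm assms; simp)
     (auto intro!: sbt_fvs_in sbt_all_fm sbt_ex_fm assms fvI simp: assms(2))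

lemma R_DCB_fixed_point: "R_DCB = sbt R_template (gq R_template) 0"
proof -
  let ?n = "gq R_template"
  have 1: "sbt (x \<doteq> dSbt \<langle>Var 0\<rangle> (dNum \<langle>Var 0\<rangle>) \<langle>gq_tm (Var 0)\<rangle>) ?n 0 = (x \<doteq> dSbt \<langle>?n\<rangle> (dNum \<langle>?n\<rangle>) \<langle>gq_tm (Var 0)\<rangle>)"
    if "0 \<notin> tvars x" for x
    using that
    apply simp
    apply (intro sbt_ex_fm)
    apply (simp_all add: tsbt_idle)
    apply (auto intro!: sbt_fvs_in fvI)
    apply (intro sbt_ex_fm)
    apply (auto simp: tsbt_idle intro!: sbt_fvs_in fvI)
    done
  have 2: "sbt (DCB_axiomsF (Var 0) x) ?n 0 = DCB_axiomsF ?n x" if "0 \<notin> tvars x" for x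
    using that unfolding DCB_axiomsF_def by (auto simp: 1 simp del: is_value.simps intro!: sbt_fvs_in fvI)
  have 3: "sbt (provableF (DCB_axiomsF (Var 0)) x) ?n 0 = provableF (DCB_axiomsF ?n) x" if "0 \<notin> tvars x" for x
    using that unfolding provableF_def
    apply (auto simp: 2 at_value_def simp del: is_value.simps intro!: sbt_inductiveF sbt_ex_fm)
    apply (auto intro!: sbt_fvs_in fvI)
    done
  have "sbt R_template ?n 0 = R_DCB"
    unfolding R_DCB_def Pr_DCB_def by (subst R_template_def)
      (auto simp: all_in_def 3 tsbt_idle intro!: sbt_all_fm sbt_fvs_in fvI)
  then show ?thesis ..
qed

end

theory Submission
  imports Defs "HOL-Number_Theory.Cong"
begin

text \<open>All systems are interpreted in the standard model of arithmetic, with every number an agent and with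
  knowledge (of every agent) the same as truth. The extension of truth is revised: it is everything in the
  model 0, and in the model \<open>n + 1\<close> it consists of the codes of the sentences that hold in the
  model \<open>n\<close>. The rules shift the model by one, so every theorem holds in all but finitely many of
  the models, and a sentence and its negation cannot both be theorems. That \<open>R_DCB\<close> holds needs the
  soundness of the formula \<open>Pr_DCB\<close>, and then by induction on \<open>n\<close> all theorems of DCB hold in every
  model; this is why truth starts as everything.\<close>

subsection \<open>Standard models\<close>

text \<open>No single one of these models can serve. By McGee's theorem \<open>FS\<close> is
  omega-inconsistent, so its theorems cannot all hold over the standard numbers at once. What
  remains is that a derivation is finite: it uses finitely many axioms and rule applications, so the
  stage from which its conclusion holds is finite too.

  Most of the work lies in evaluating the concrete formulas of the arithmetization, and how much
  must be shown about each of them depends on where the axioms use it. \<open>sentenceF\<close>,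
  \<open>formula1F\<close>, \<open>valF\<close> and \<open>Pr_DCB\<close> occur as guards, so it is
  enough that they hold of nothing but what they are meant to describe. Substitution and numerals
  stand for functions under \<open>at_value\<close>, so on codes they must have exactly one value.
  The formulas for closed terms must be sound and must also admit every numeral, because the truth
  of a quantified sentence is compared with the truth of its instances.\<close>

primrec tval :: "(nat \<Rightarrow> nat) \<Rightarrow> tm \<Rightarrow> nat" where
  "tval e (Var n) = e n"
| "tval e Zero = 0"
| "tval e (Sc t) = Suc (tval e t)"
| "tval e (Plus s t) = tval e s + tval e t"
| "tval e (Times s t) = tval e s * tval e t"
| "tval e (Fu t) = tval e t"

text \<open>The symbols \<open>U\<close> and \<open>u\<close> are governed by general schemes only,
  so \<open>U\<close> is taken empty and \<open>u\<close> the identity. Nothing but the set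
  \<open>T\<close> changes between the models; this lets \<open>sat_atomic_minus\<close> carry
  atomic formulas from one model to the next.\<close>

primrec sat :: "nat set \<Rightarrow> (nat \<Rightarrow> nat) \<Rightarrow> fm \<Rightarrow> bool" where
  "sat T e (s \<^bold>= t) \<longleftrightarrow> tval e s = tval e t"
| "sat T e (PU t) \<longleftrightarrow> False"
| "sat T e (K1 t) \<longleftrightarrow> tval e t \<in> T"
| "sat T e (K2 s t) \<longleftrightarrow> tval e t \<in> T"
| "sat T e (Tr t) \<longleftrightarrow> tval e t \<in> T"
| "sat T e (Ag t) \<longleftrightarrow> True"
| "sat T e (\<^bold>\<not> \<phi>) \<longleftrightarrow> \<not> sat T e \<phi>"
| "sat T e (\<phi> \<^bold>\<longrightarrow> \<psi>) \<longleftrightarrow> (sat T e \<phi> \<longrightarrow> sat T e \<psi>)"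
| "sat T e (\<phi> \<^bold>\<and> \<psi>) \<longleftrightarrow> sat T e \<phi> \<and> sat T e \<psi>"
| "sat T e (\<phi> \<^bold>\<or> \<psi>) \<longleftrightarrow> sat T e \<phi> \<or> sat T e \<psi>"
| "sat T e (Forall v \<phi>) \<longleftrightarrow> (\<forall>n. sat T (e(v := n)) \<phi>)"
| "sat T e (Exists v \<phi>) \<longleftrightarrow> (\<exists>n. sat T (e(v := n)) \<phi>)"

lemma tval_cong: "(\<And>x. x \<in> tvars t \<Longrightarrow> e x = e' x) \<Longrightarrow> tval e t = tval e' t"
  by (induction t) auto

lemma sat_cong: "(\<And>x. x \<in> fv \<phi> \<Longrightarrow> e x = e' x) \<Longrightarrow> sat T e \<phi> = sat T e' \<phi>"
proof (induction \<phi> arbitrary: e e')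
  case (Forall v \<phi>)
  have "sat T (e(v := n)) \<phi> = sat T (e'(v := n)) \<phi>" for n
    by (rule Forall.IH) (use Forall.prems in auto)
  then show ?case by simp
next
  case (Exists v \<phi>)
  have "sat T (e(v := n)) \<phi> = sat T (e'(v := n)) \<phi>" for n
    by (rule Exists.IH) (use Exists.prems in auto)
  then show ?case by simp
next
  case (Neg \<phi>)
  show ?case using Neg.IH[of e e'] Neg.prems by simp
next
  case (Imp \<phi> \<psi>)
  show ?case using Imp.IH[of e e'] Imp.prems by simp
next
  case (And \<phi> \<psi>)
  show ?case using And.IH[of e e'] And.prems by simp
next
  case (Or \<phi> \<psi>)
  show ?case using Or.IH[of e e'] Or.prems by simp
next
  case (Eq s t)
  then show ?case using tval_cong[of s e e'] tval_cong[of t e e'] by simp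
next
  case (K2 s t)
  then show ?case using tval_cong[of t e e'] by simp
next
  case (PU t)
  then show ?case using tval_cong[of t e e'] by simp
next
  case (K1 t)
  then show ?case using tval_cong[of t e e'] by simp
next
  case (Tr t)
  then show ?case using tval_cong[of t e e'] by simp
next
  case (Ag t)
  then show ?case using tval_cong[of t e e'] by simp
qed

lemma sat_sentence: "sentence \<phi> \<Longrightarrow> sat T e \<phi> = sat T e' \<phi>"
  by (rule sat_cong) (simp add: sentence_def)

lemma tval_tsbt: "tval e (tsbt s t v) = tval (e(v := tval e t)) s"
  by (induction s) auto

lemma sat_sbt: "free_for t v \<phi> \<Longrightarrow> sat T e (sbt \<phi> t v) = sat T (e(v := tval e t)) \<phi>"
proof (induction \<phi> arbitrary: e)
  case (Forall w \<phi>)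
  show ?case
  \<comment> \<open>\<open>free_for\<close> demands something of the body only if \<open>v\<close>
    is free in the quantified formula, so the induction hypothesis is available in the first case
    alone. In the second the substitution is idle.\<close>
  proof (cases "v \<in> fv (Forall w \<phi>)")
    case True
    then have "w \<noteq> v" "tval (e(w := n)) t = tval e t" for n
      using Forall.prems by (auto intro: tval_cong)
    with Forall True show ?thesis by (simp add: fun_upd_twist del: fun_upd_apply)
  next
    case False
    then show ?thesis by (auto simp: sbt_idle simp del: sat.simps sbt.simps intro!: sat_cong)
  qed
next
  case (Exists w \<phi>)
  show ?case
  proof (cases "v \<in> fv (Exists w \<phi>)")
    case True
    then have "w \<noteq> v" "tval (e(w := n)) t = tval e t" for n
      using Exists.prems by (auto intro: tval_cong)
    with Exists True show ?thesis by (simp add: fun_upd_twist del: fun_upd_apply)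
  next
    case False
    then show ?thesis by (auto simp: sbt_idle simp del: sat.simps sbt.simps intro!: sat_cong)
  qed
qed (simp_all add: tval_tsbt)

lemma free_for_closed: "tvars t = {} \<Longrightarrow> free_for t v \<phi>"
  by (induction \<phi>) auto

text \<open>The only variable that could be captured is \<open>v\<close>, and under a quantifier
  binding \<open>v\<close> there is no free \<open>v\<close> left to replace. The step of an
  induction instance substitutes this term.\<close>

lemma free_for_Sc: "free_for (Sc (Var v)) v \<phi>"
  by (induction \<phi>) auto

lemma tvars_tsbt_closed: "tvars t = {} \<Longrightarrow> tvars (tsbt s t v) = tvars s - {v}"
  by (induction s) auto

lemma fv_sbt_closed: "tvars t = {} \<Longrightarrow> fv (sbt \<phi> t v) = fv \<phi> - {v}"
  by (induction \<phi>) (auto simp: tvars_tsbt_closed)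

lemma sat_logical_schemes: "\<phi> \<in> logical_schemes \<Longrightarrow> sat T e \<phi>"
proof (induction rule: logical_schemes.induct)
  case (10 t v \<phi>)
  then show ?case by (simp add: sat_sbt)
next
  case (12 v \<phi>)
  then have "sat T (e(v := n)) \<phi> = sat T e \<phi>" for n
    by (intro sat_cong) auto
  then show ?case by simp
qed auto

lemma sat_generalizations:
  "\<phi> \<in> generalizations \<Gamma> \<Longrightarrow> (\<And>\<psi> e. \<psi> \<in> \<Gamma> \<Longrightarrow> sat T e \<psi>) \<Longrightarrow> sat T e \<phi>"
  by (induction arbitrary: e rule: generalizations.induct) auto

lemma sat_induction_instances:
  assumes "\<phi> \<in> induction_instances" shows "sat T e \<phi>"
proof -
  obtain \<psi> v where \<phi>: "\<phi> = ((sbt \<psi> Zero v \<^bold>\<and> Forall v (\<psi> \<^bold>\<longrightarrow> sbt \<psi> (Sc (Var v)) v)) \<^bold>\<longrightarrow> Forall v \<psi>)"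
    using assms by (auto simp: induction_instances_def)
  have *: "sat T e \<phi> \<longleftrightarrow> (sat T (e(v := 0)) \<psi> \<and>
      (\<forall>n. sat T (e(v := n)) \<psi> \<longrightarrow> sat T (e(v := Suc n)) \<psi>) \<longrightarrow> (\<forall>n. sat T (e(v := n)) \<psi>))"
    by (simp add: \<phi> sat_sbt free_for_closed free_for_Sc del: fun_upd_apply add: fun_upd_same)
  show ?thesis
    unfolding * by (intro impI allI, elim conjE) (rule nat_induct; blast)
qed

subsection \<open>Evaluation of quantifiers\<close>

lemma sat_Iff [simp]: "sat T e (\<phi> \<^bold>\<longleftrightarrow> \<psi>) \<longleftrightarrow> (sat T e \<phi> \<longleftrightarrow> sat T e \<psi>)"
  by (auto simp: Iff_def)

lemma sat_Conj [simp]: "sat T e (Conj \<phi>s) \<longleftrightarrow> (\<forall>\<phi>\<in>set \<phi>s. sat T e \<phi>)"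
  unfolding Conj_def by (induction \<phi>s) auto

lemma sat_Disj [simp]: "sat T e (Disj \<phi>s) \<longleftrightarrow> (\<exists>\<phi>\<in>set \<phi>s. sat T e \<phi>)"
  unfolding Disj_def by (induction \<phi>s) auto

text \<open>A quantifier \<open>\<^bold>\<forall>x. F x\<close> binds a variable \<open>v\<close> that is above every \<open>k\<close> with \<open>occ k (F Zero)\<close>,
  hence above the variables of the parameters of \<open>F\<close>. The two inequalities behind this are kept opaque,
  since the arithmetic solvers get lost in the nested maxima.\<close>

definition occt :: "nat \<Rightarrow> tm \<Rightarrow> bool"
  where "occt k t \<longleftrightarrow> k \<le> tmax t"

definition occ :: "nat \<Rightarrow> fm \<Rightarrow> bool"
  where "occ k \<phi> \<longleftrightarrow> k \<le> fmax \<phi>"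

definition above :: "nat \<Rightarrow> nat \<Rightarrow> bool"
  where "above v k \<longleftrightarrow> k < v"

lemma occt_simps [simp]:
  "occt n (Var n)"
  "occt (tmax t) t"
  "occt k (Sc t) = occt k t"
  "occt k (Plus s t) \<longleftrightarrow> occt k s \<or> occt k t"
  "occt k (Times s t) \<longleftrightarrow> occt k s \<or> occt k t"
  "occt k (Fu t) = occt k t"
  by (auto simp: occt_def)

lemma occ_simps [simp]:
  "occ k (s \<^bold>= t) \<longleftrightarrow> occt k s \<or> occt k t"
  "occ k (PU t) \<longleftrightarrow> occt k t"
  "occ k (K1 t) \<longleftrightarrow> occt k t"
  "occ k (K2 s t) \<longleftrightarrow> occt k s \<or> occt k t"
  "occ k (Tr t) \<longleftrightarrow> occt k t"
  "occ k (Ag t) \<longleftrightarrow> occt k t"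
  "occ k (\<^bold>\<not> \<phi>) \<longleftrightarrow> occ k \<phi>"
  "occ k (\<phi> \<^bold>\<longrightarrow> \<psi>) \<longleftrightarrow> occ k \<phi> \<or> occ k \<psi>"
  "occ k (\<phi> \<^bold>\<and> \<psi>) \<longleftrightarrow> occ k \<phi> \<or> occ k \<psi>"
  "occ k (\<phi> \<^bold>\<or> \<psi>) \<longleftrightarrow> occ k \<phi> \<or> occ k \<psi>"
  by (auto simp: occt_def occ_def)

lemma occ_Disj [simp]: "\<exists>\<phi>\<in>set \<phi>s. occ k \<phi> \<Longrightarrow> occ k (Disj \<phi>s)"
  unfolding Disj_def by (induction \<phi>s) auto

text \<open>\<open>fmax\<close> counts bound variables, and the variable chosen by the binder
  exceeds \<open>fmax (F Zero)\<close>. Hence nothing has to be known about how \<open>F\<close>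
  depends on its argument.\<close>

lemma occ_quant [simp]:
  "occ k (F Zero) \<Longrightarrow> occ k (ex_fm F)"
  "occ k (F Zero) \<Longrightarrow> occ k (all_fm F)"
  "occ k (P Zero) \<or> occ k (F Zero) \<Longrightarrow> occ k (all_in P F)"
  "occ k (P Zero) \<or> occ k (F Zero) \<Longrightarrow> occ k (ex_in P F)"
  by (auto simp: occ_def le_max_iff_disj ex_fm_def all_fm_def all_in_def ex_in_def Let_def)

lemma occ_Iff [simp]: "occ k (\<phi> \<^bold>\<longleftrightarrow> \<psi>) \<longleftrightarrow> occ k \<phi> \<or> occ k \<psi>"
  by (auto simp: Iff_def)

named_theorems satI

text \<open>The right-hand side copies the formula connective by connective, with \<open>P\<close>
  found by unification. This is why the truth conditions proved by \<open>intro satI\<close> below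
  keep forms such as \<open>\<exists>q. q = c \<and> Q q\<close>.\<close>

lemma sat_quant [satI]:
  "(\<And>v n. (\<And>k. occ k (F Zero) \<Longrightarrow> above v k) \<Longrightarrow> sat T (e(v := n)) (F (Var v)) = P n) \<Longrightarrow>
    sat T e (ex_fm F) = (\<exists>n. P n)"
  "(\<And>v n. (\<And>k. occ k (F Zero) \<Longrightarrow> above v k) \<Longrightarrow> sat T (e(v := n)) (F (Var v)) = P n) \<Longrightarrow>
    sat T e (all_fm F) = (\<forall>n. P n)"
  by (simp_all add: ex_fm_def all_fm_def Let_def occ_def above_def)

lemma sat_connective [satI]:
  "sat T e \<phi> = A \<Longrightarrow> sat T e (\<^bold>\<not> \<phi>) = (\<not> A)"
  "sat T e \<phi> = A \<Longrightarrow> sat T e \<psi> = B \<Longrightarrow> sat T e (\<phi> \<^bold>\<longrightarrow> \<psi>) = (A \<longrightarrow> B)"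
  "sat T e \<phi> = A \<Longrightarrow> sat T e \<psi> = B \<Longrightarrow> sat T e (\<phi> \<^bold>\<and> \<psi>) = (A \<and> B)"
  "sat T e \<phi> = A \<Longrightarrow> sat T e \<psi> = B \<Longrightarrow> sat T e (\<phi> \<^bold>\<or> \<psi>) = (A \<or> B)"
  "sat T e \<phi> = A \<Longrightarrow> sat T e \<psi> = B \<Longrightarrow> sat T e (\<phi> \<^bold>\<longleftrightarrow> \<psi>) = (A \<longleftrightarrow> B)"
  by auto

lemma sat_bounded_quant [satI]:
  "(\<And>v n. (\<And>k. occ k (A Zero) \<or> occ k (F Zero) \<Longrightarrow> above v k) \<Longrightarrow>
      sat T (e(v := n)) (A (Var v)) = Q n) \<Longrightarrow>
   (\<And>v n. (\<And>k. occ k (A Zero) \<or> occ k (F Zero) \<Longrightarrow> above v k) \<Longrightarrow>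
      sat T (e(v := n)) (F (Var v)) = P n) \<Longrightarrow>
    sat T e (all_in A F) = (\<forall>n. Q n \<longrightarrow> P n)"
  "(\<And>v n. (\<And>k. occ k (A Zero) \<or> occ k (F Zero) \<Longrightarrow> above v k) \<Longrightarrow>
      sat T (e(v := n)) (A (Var v)) = Q n) \<Longrightarrow>
   (\<And>v n. (\<And>k. occ k (A Zero) \<or> occ k (F Zero) \<Longrightarrow> above v k) \<Longrightarrow>
      sat T (e(v := n)) (F (Var v)) = P n) \<Longrightarrow>
    sat T e (ex_in A F) = (\<exists>n. Q n \<and> P n)"
  unfolding all_in_def ex_in_def by (intro satI; simp)+

lemma tval_upd [simp]: "above v (tmax t) \<Longrightarrow> tval (e(v := n)) t = tval e t"
  by (induction t) (auto simp: above_def)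

lemma upd_less [simp]: "above v w \<Longrightarrow> (e(v := n)) w = e w" for v :: nat
  by (simp add: above_def)

text \<open>Environments are updated at fresh variables only. \<open>above\<close> decides every
  lookup, while \<open>fun_upd_apply\<close> would split each of them into cases.\<close>

lemmas [simp] = fun_upd_same
declare fun_upd_apply [simp del]

lemma tval_num [simp]: "tval e (num n) = n"
  by (induction n) auto

lemma tval_gq [simp]: "tval e (gq \<phi>) = code \<phi>" "tval e (gq_tm t) = code_tm t"
  by (simp_all add: gq_def gq_tm_def)

section \<open>Truth conditions of order, pairing and the beta function\<close>

lemma sat_lessF [simp]: "sat T e (lessF s t) \<longleftrightarrow> tval e s < tval e t"
proof -
  have "sat T e (lessF s t) \<longleftrightarrow> (\<exists>d. tval e s + Suc d = tval e t)"
    unfolding lessF_def by (intro satI) simp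
  then show ?thesis by (metis add_Suc_right less_iff_Suc_add)
qed

lemma occ_lessF [simp]: "occt k s \<or> occt k t \<Longrightarrow> occ k (lessF s t)"
  by (auto simp: lessF_def)

lemma sat_pairF [simp]: "sat T e (pairF x y z) \<longleftrightarrow> tval e z = prod_encode (tval e x, tval e y)"
proof -
  have "z + z = (x + y) * Suc (x + y) + (x + x) \<longleftrightarrow> z = triangle (x + y) + x" for x y z :: nat
  proof -
    \<comment> \<open>\<open>triangle n\<close> is a quotient by 2. Evenness makes the division
      exact, so the doubled equation of \<open>pairF\<close> loses nothing.\<close>
    have "even (n * Suc n)" for n :: nat by simp
    then have "n * Suc n = triangle n + triangle n" for n
      unfolding triangle_def by (subst mult_2[symmetric]) (simp only: dvd_mult_div_cancel)
    then show ?thesis by (simp only:) linarith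
  qed
  then show ?thesis by (simp add: pairF_def prod_encode_def)
qed

lemma occ_pairF [simp]: "occ k (pairF x y z) \<longleftrightarrow> occt k x \<or> occt k y \<or> occt k z"
  by (auto simp: pairF_def)

lemma sat_nodeF [simp]: "sat T e (nodeF k x z) \<longleftrightarrow> tval e z = prod_encode (k, tval e x)"
  by (simp add: nodeF_def)

lemma occ_nodeF [simp]: "occt i x \<or> occt i z \<Longrightarrow> occ i (nodeF k x z)"
  by (auto simp: nodeF_def)

lemma sat_node2F [simp]:
  "sat T e (node2F k x y z) \<longleftrightarrow> tval e z = prod_encode (k, prod_encode (tval e x, tval e y))"
proof -
  have "sat T e (node2F k x y z) \<longleftrightarrow>
      (\<exists>p. p = prod_encode (tval e x, tval e y) \<and> tval e z = prod_encode (k, p))"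
    unfolding node2F_def by (intro satI) simp_all
  then show ?thesis by simp
qed

lemma occ_node2F [simp]:
  "occt i x \<or> occt i y \<or> occt i z \<Longrightarrow> occ i (node2F k x y z)"
  by (auto simp: node2F_def)

definition beta :: "nat \<Rightarrow> nat \<Rightarrow> nat \<Rightarrow> nat"
  where "beta a b i = a mod Suc (Suc i * b)"

lemma eq_mod_iff: "y = a mod m \<longleftrightarrow> y < m \<and> (\<exists>q. a = q * m + y)" if "0 < m" for a m y :: nat
  using that by (metis mod_less_divisor mod_mult_self3 mod_less div_mult_mod_eq)

lemma sat_betaF [simp]:
  "sat T e (betaF a b i y) \<longleftrightarrow> tval e y = beta (tval e a) (tval e b) (tval e i)"
proof -
  have "sat T e (betaF a b i y) \<longleftrightarrow> tval e y < Suc (Suc (tval e i) * tval e b) \<and>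
      (\<exists>q. tval e a = q * Suc (Suc (tval e i) * tval e b) + tval e y)"
    unfolding betaF_def by (intro satI) simp_all
  also have "\<dots> \<longleftrightarrow> tval e y = beta (tval e a) (tval e b) (tval e i)"
    unfolding beta_def by (rule eq_mod_iff[symmetric]) simp
  finally show ?thesis .
qed

lemma occ_betaF [simp]:
  "occt k a \<or> occt k b \<or> occt k i \<or> occt k y \<Longrightarrow> occ k (betaF a b i y)"
  by (auto simp: betaF_def)

subsection \<open>Finite sequences and inductive definitions\<close>

text \<open>Each modulus is 1 plus a multiple of N!, hence coprime to N!. Two moduli differ by (j -
  i) N!, and j - i divides N! because it is positive and at most \<open>N\<close>. So a modulus is
  coprime to its difference from the other one.\<close>

lemma coprime_beta_moduli:
  assumes "i < j" "j < n" "n \<le> N"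
  shows "coprime (Suc (Suc i * fact N)) (Suc (Suc j * fact N :: nat))"
proof -
  let ?m = "Suc (Suc i * fact N) :: nat"
  have b: "coprime ?m (fact N)"
    by (metis coprime_Suc_right_nat coprime_commute coprime_mult_left_iff mult.commute coprime_mult_right_iff)
  have "(j - i) dvd (fact N :: nat)"
    using assms by (intro dvd_fact) auto
  then have "coprime ?m ((j - i) * fact N)"
    using b by (meson coprime_mult_right_iff coprime_divisors dvd_refl)
  moreover have "Suc (Suc j * fact N) = ?m + (j - i) * fact N"
    using assms by (auto simp: algebra_simps diff_mult_distrib)
  ultimately show ?thesis
    by (metis coprime_iff_gcd_eq_1 gcd_add2)
qed

lemma beta_list: "\<exists>a b. \<forall>i<length xs. beta a b i = xs ! i"
proof -
  \<comment> \<open>\<open>N\<close> bounds two things: the length, for the coprimality of the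
    moduli, and every entry, so that each entry lies below its modulus and is the remainder
    itself.\<close>
  define N where "N = length xs + sum_list xs"
  define m where "m i = Suc (Suc i * fact N)" for i
  have "\<exists>a. \<forall>i\<in>{..<length xs}. [a = xs ! i] (mod m i)"
  proof (rule chinese_remainder_nat)
    show "\<forall>i\<in>{..<length xs}. \<forall>j\<in>{..<length xs}. i \<noteq> j \<longrightarrow> coprime (m i) (m j)"
      unfolding m_def using coprime_beta_moduli[of _ _ "length xs" N]
      by (auto simp: N_def) (metis coprime_commute le_add1 linorder_neqE_nat)
  qed simp
  then obtain a where a: "\<forall>i<length xs. [a = xs ! i] (mod m i)" by auto
  have "beta a (fact N) i = xs ! i" if "i < length xs" for i
  proof -
    have "xs ! i \<le> sum_list xs" using that by (simp add: elem_le_sum_list)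
    also have "\<dots> \<le> N" by (simp add: N_def)
    also have "\<dots> \<le> fact N" by (rule fact_ge_self)
    also have "\<dots> < m i" by (simp add: m_def)
    finally show ?thesis using a that by (simp add: beta_def m_def cong_def)
  qed
  then show ?thesis by blast
qed

section \<open>Sets generated by finite derivation sequences\<close>

definition chain :: "(nat \<Rightarrow> (nat \<Rightarrow> bool) \<Rightarrow> bool) \<Rightarrow> nat list \<Rightarrow> bool"
  where "chain S xs \<longleftrightarrow> (\<forall>i<length xs. S (xs ! i) (\<lambda>z. z \<in> set (take i xs)))"

text \<open>This is the meaning of \<open>inductiveF\<close>, with lists in place of beta codes.
  \<open>Ind_induct\<close> and \<open>Ind_step\<close> turn it into an inductive definition with
  rule \<open>S\<close>, so that later arguments never touch sequences.\<close>

definition Ind :: "(nat \<Rightarrow> (nat \<Rightarrow> bool) \<Rightarrow> bool) \<Rightarrow> nat \<Rightarrow> bool"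
  where "Ind S x \<longleftrightarrow> (\<exists>xs. chain S (xs @ [x]))"

text \<open>Strong induction on the position in the sequence; \<open>Q\<close> stands for being an
  earlier entry.\<close>

lemma Ind_induct [consumes 1, case_names step]:
  assumes "Ind S x" and step: "\<And>y Q. S y Q \<Longrightarrow> (\<And>z. Q z \<Longrightarrow> P z) \<Longrightarrow> P y"
  shows "P x"
proof -
  obtain xs where xs: "chain S (xs @ [x])" using assms(1) by (auto simp: Ind_def)
  have "P ((xs @ [x]) ! i)" if "i \<le> length xs" for i
    using that
  proof (induction i rule: less_induct)
    case (less i)
    have "S ((xs @ [x]) ! i) (\<lambda>z. z \<in> set (take i (xs @ [x])))"
      using xs less.prems by (simp add: chain_def)
    then show ?case
    proof (rule step)
      fix z assume "z \<in> set (take i (xs @ [x]))"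
      then obtain j where "j < i" "z = (xs @ [x]) ! j"
        by (auto simp: in_set_conv_nth simp del: take_append)
      then show "P z" using less by simp
    qed
  qed
  from this[of "length xs"] show ?thesis by simp
qed

lemma chain_append:
  assumes "chain S xs" "chain S ys" and mono: "\<And>y Q R. S y Q \<Longrightarrow> (\<And>z. Q z \<Longrightarrow> R z) \<Longrightarrow> S y R"
  shows "chain S (xs @ ys)"
  unfolding chain_def
proof (intro allI impI)
  fix i assume i: "i < length (xs @ ys)"
  show "S ((xs @ ys) ! i) (\<lambda>z. z \<in> set (take i (xs @ ys)))"
  proof (cases "i < length xs")
    case True
    with assms(1) show ?thesis by (simp add: chain_def nth_append)
  next
    case False
    with i have "S (ys ! (i - length xs)) (\<lambda>z. z \<in> set (take (i - length xs) ys))"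
      using assms(2) by (simp add: chain_def)
    then show ?thesis using False by (auto simp: nth_append elim: mono)
  qed
qed

lemma chain_snoc:
  assumes "chain S xs" "S x (\<lambda>z. z \<in> set xs)" shows "chain S (xs @ [x])"
  unfolding chain_def
proof (intro allI impI)
  fix i assume "i < length (xs @ [x])"
  then show "S ((xs @ [x]) ! i) (\<lambda>z. z \<in> set (take i (xs @ [x])))"
    using assms by (cases "i < length xs") (auto simp: chain_def nth_append less_Suc_eq)
qed

text \<open>The derivations of the finitely many premises in \<open>Z\<close> are concatenated.
  Monotonicity keeps each step valid when more entries precede it.\<close>

lemma Ind_step:
  assumes "finite Z" "\<And>z. z \<in> Z \<Longrightarrow> Ind S z" "S x (\<lambda>z. z \<in> Z)"
    and mono: "\<And>y Q R. S y Q \<Longrightarrow> (\<And>z. Q z \<Longrightarrow> R z) \<Longrightarrow> S y R"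
  shows "Ind S x"
proof -
  have "\<exists>xs. chain S xs \<and> Z \<subseteq> set xs"
    using assms(1,2)
  proof (induction Z)
    case empty
    then show ?case by (intro exI[of _ "[]"]) (simp add: chain_def)
  next
    case (insert z Z)
    then obtain xs ys where "chain S xs" "Z \<subseteq> set xs" "chain S (ys @ [z])"
      unfolding Ind_def by (metis insertCI)
    then show ?case
      using chain_append[OF _ _ mono, where xs = xs and ys = "ys @ [z]"]
      by (intro exI[of _ "xs @ ys @ [z]"]) auto
  qed
  then obtain xs where "chain S xs" "Z \<subseteq> set xs" by blast
  then have "chain S (xs @ [x])"
    using assms(3) by (intro chain_snoc) (auto elim: mono)
  then show ?thesis by (auto simp: Ind_def)
qed

lemma Ind_iff_beta:
  "Ind S x \<longleftrightarrow> (\<exists>a b n. x = beta a b n \<and>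
      (\<forall>i<Suc n. \<exists>y. y = beta a b i \<and> S y (\<lambda>z. \<exists>j<i. z = beta a b j)))"
    (is "_ \<longleftrightarrow> ?R")
proof
  assume "Ind S x"
  then obtain xs where xs: "chain S (xs @ [x])" by (auto simp: Ind_def)
  obtain a b where ab: "\<forall>i<length (xs @ [x]). beta a b i = (xs @ [x]) ! i"
    using beta_list by blast
  have "S (beta a b i) (\<lambda>z. \<exists>j<i. z = beta a b j)" if "i < Suc (length xs)" for i
  proof -
    have "(\<lambda>z. z \<in> set (take i (xs @ [x]))) = (\<lambda>z. \<exists>j<i. z = beta a b j)"
      using that ab by (auto simp: in_set_conv_nth fun_eq_iff simp del: take_append)
    moreover have "S ((xs @ [x]) ! i) (\<lambda>z. z \<in> set (take i (xs @ [x])))"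
      using xs that by (simp add: chain_def)
    ultimately show ?thesis using that ab by simp
  qed
  moreover have "x = beta a b (length xs)" using ab by simp
  ultimately show ?R by blast
next
  assume ?R
  then obtain a b n where x: "x = beta a b n"
    and S: "\<And>i. i < Suc n \<Longrightarrow> S (beta a b i) (\<lambda>z. \<exists>j<i. z = beta a b j)" by blast
  have "chain S (map (beta a b) [0..<Suc n])"
    unfolding chain_def
  proof (intro allI impI)
    fix i assume i: "i < length (map (beta a b) [0..<Suc n])"
    then have "(\<lambda>z. z \<in> set (take i (map (beta a b) [0..<Suc n]))) = (\<lambda>z. \<exists>j<i. z = beta a b j)"
      by (auto simp: take_map fun_eq_iff simp del: upt_Suc)
    then show "S (map (beta a b) [0..<Suc n] ! i) (\<lambda>z. z \<in> set (take i (map (beta a b) [0..<Suc n])))"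
      using S[of i] i by (simp del: upt_Suc)
  qed
  then show "Ind S x"
    unfolding Ind_def x by (auto intro!: exI[of _ "map (beta a b) [0..<n]"])
qed

section \<open>Evaluation of \<open>inductiveF\<close>\<close>

definition agree :: "nat \<Rightarrow> (nat \<Rightarrow> nat) \<Rightarrow> (nat \<Rightarrow> nat) \<Rightarrow> bool"
  where "agree m e e' \<longleftrightarrow> (\<forall>k\<le>m. e k = e' k)"

lemma agree_refl [simp]: "agree m e e"
  by (simp add: agree_def)

lemma agree_upd [simp]: "above v m \<Longrightarrow> agree m (e(v := n)) e' = agree m e e'"
  by (auto simp: agree_def above_def)

lemma tval_agree: "agree m e e' \<Longrightarrow> tmax t \<le> m \<Longrightarrow> tval e t = tval e' t"
  by (induction t) (auto simp: agree_def)

text \<open>The hypothesis asks for the value of one step in an environment \<open>e'\<close> met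
  under the quantifiers of \<open>inductiveF\<close>. A term that occurs in every instance of
  \<open>step\<close> is a parameter, and the bound variables lie above it, so its value is still
  that in \<open>e\<close>. The formula \<open>prev\<close> is opaque: it means \<open>Q\<close>
  wherever the variables up to \<open>m\<close> are unchanged, and \<open>occ m (prev z)\<close>
  forces the quantifiers inside \<open>step\<close> to bind variables above
  \<open>m\<close>.\<close>

lemma sat_inductiveF:
  assumes step: "\<And>e' y prev Q m.
      (\<And>t. (\<And>y prev. occ (tmax t) (step y prev)) \<Longrightarrow> tval e' t = tval e t) \<Longrightarrow>
      (\<And>e'' z. agree m e'' e' \<Longrightarrow> sat T e'' (prev z) = Q (tval e'' z)) \<Longrightarrow>
      (\<And>z. occ m (prev z)) \<Longrightarrow> sat T e' (step y prev) = S (tval e' y) Q"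
  shows "sat T e (inductiveF step x) \<longleftrightarrow> Ind S (tval e x)"
proof -
  have step': "sat T e' (step (Var vy) (\<lambda>z. \<^bold>\<exists>j. lessF j (Var vi) \<^bold>\<and> betaF (Var va) (Var vb) j z)) =
     S (e' vy) (\<lambda>z. \<exists>j<e' vi. z = beta (e' va) (e' vb) j)"
    if "\<And>k. (\<And>y prev. occ k (step y prev)) \<Longrightarrow> e' k = e k" for e' va vb vi vy
  proof -
    have "sat T e' (step (Var vy) (\<lambda>z. \<^bold>\<exists>j. lessF j (Var vi) \<^bold>\<and> betaF (Var va) (Var vb) j z)) =
     S (tval e' (Var vy)) (\<lambda>z. \<exists>j<e' vi. z = beta (e' va) (e' vb) j)"
    \<comment> \<open>Besides those of its argument, \<open>prev\<close> has just the free variables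
      \<open>va\<close>, \<open>vb\<close> and \<open>vi\<close>.\<close>
    proof (rule step[where m = "max vi (max va vb)"])
      fix t assume "\<And>y prev. occ (tmax t) (step y prev)"
      then have "agree (tmax t) e' e"
        unfolding agree_def occ_def by (metis that occ_def le_trans)
      then show "tval e' t = tval e t"
        by (rule tval_agree) simp
    next
      fix e'' z assume *: "agree (max vi (max va vb)) e'' e'"
      have "sat T e'' (\<^bold>\<exists>j. lessF j (Var vi) \<^bold>\<and> betaF (Var va) (Var vb) j z) =
        (\<exists>j. j < e'' vi \<and> tval e'' z = beta (e'' va) (e'' vb) j)"
        by (intro satI) simp_all
      then show "sat T e'' (\<^bold>\<exists>j. lessF j (Var vi) \<^bold>\<and> betaF (Var va) (Var vb) j z) =
        (\<exists>j<e' vi. tval e'' z = beta (e' va) (e' vb) j)"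
        using * by (simp add: agree_def)
    next
      show "occ (max vi (max va vb)) (\<^bold>\<exists>j. lessF j (Var vi) \<^bold>\<and> betaF (Var va) (Var vb) j z)" for z
        by (simp add: max_def)
    qed
    then show ?thesis by simp
  qed
  have "sat T e (inductiveF step x) \<longleftrightarrow> (\<exists>a b n. tval e x = beta a b n \<and>
      (\<forall>i. i < Suc n \<longrightarrow> (\<exists>y. y = beta a b i \<and> S y (\<lambda>z. \<exists>j<i. z = beta a b j))))"
    unfolding inductiveF_def by (intro satI) (simp_all add: step')
  then show ?thesis by (simp add: Ind_iff_beta)
qed

lemma occ_inductiveF [simp]:
  "occt k x \<or> (\<forall>y prev. occ k (step y prev)) \<Longrightarrow> occ k (inductiveF step x)"
  by (auto simp: inductiveF_def)

subsection \<open>Terms and formulas\<close>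

lemma code_tm_eq_iff [simp]: "code_tm s = code_tm t \<longleftrightarrow> s = t"
proof (induction s arbitrary: t)
  case (Var n) show ?case by (cases t) auto
next
  case Zero show ?case by (cases t) auto
next
  case (Sc s) then show ?case by (cases t) auto
next
  case (Plus s1 s2) then show ?case by (cases t) auto
next
  case (Times s1 s2) then show ?case by (cases t) auto
next
  case (Fu s) then show ?case by (cases t) auto
qed

lemma code_eq_iff [simp]: "code \<phi> = code \<psi> \<longleftrightarrow> \<phi> = \<psi>"
proof (induction \<phi> arbitrary: \<psi>)
  case (Eq s t) show ?case by (cases \<psi>) auto
next
  case (PU t) show ?case by (cases \<psi>) auto
next
  case (K1 t) show ?case by (cases \<psi>) auto
next
  case (K2 s t) show ?case by (cases \<psi>) auto
next
  case (Tr t) show ?case by (cases \<psi>) auto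
next
  case (Ag t) show ?case by (cases \<psi>) auto
next
  case (Neg \<phi>) then show ?case by (cases \<psi>) auto
next
  case (Imp \<phi>1 \<phi>2) then show ?case by (cases \<psi>) auto
next
  case (And \<phi>1 \<phi>2) then show ?case by (cases \<psi>) auto
next
  case (Or \<phi>1 \<phi>2) then show ?case by (cases \<psi>) auto
next
  case (Forall v \<phi>) then show ?case by (cases \<psi>) auto
next
  case (Exists v \<phi>) then show ?case by (cases \<psi>) auto
qed

text \<open>Since \<open>triangle n\<close> is at least \<open>n\<close>, the code is at least a + b
  + a, and a positive tag \<open>a\<close> makes the inequality strict. Variables alone carry the
  tag 0.\<close>

lemma less_prod_encode: "0 < a \<Longrightarrow> x \<le> b \<Longrightarrow> x < prod_encode (a, b)"
proof -
  assume "0 < a" "x \<le> b"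
  moreover have "n \<le> triangle n" for n
    by (cases n) (simp_all add: triangle_Suc)
  from this[of "a + b"] have "a + b \<le> triangle (a + b)" .
  ultimately show ?thesis by (simp add: prod_encode_def)
qed

lemma less_prod_encode2:
  "0 < a \<Longrightarrow> x \<le> b \<Longrightarrow> x < prod_encode (a, prod_encode (b, c))"
  "0 < a \<Longrightarrow> x \<le> c \<Longrightarrow> x < prod_encode (a, prod_encode (b, c))"
  by (rule less_prod_encode; use le_prod_encode_1 le_prod_encode_2 le_trans in blast)+

lemma tvars_code: "n \<in> tvars t \<Longrightarrow> code_tm (Var n) \<le> code_tm t"
  by (induction t)
    (auto simp: less_prod_encode less_prod_encode2 intro: less_imp_le)

text \<open>This matches the bound \<open>lessF v x\<close> in \<open>sentenceF\<close> and
  \<open>formula1F\<close>: the bounded quantifier reaches every free variable.\<close>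

lemma fv_code: "n \<in> fv \<phi> \<Longrightarrow> code_tm (Var n) < code \<phi>"
  by (induction \<phi>)
    (use tvars_code in \<open>auto simp: less_prod_encode less_prod_encode2 less_imp_le\<close>)

lemma sat_varF [simp]: "sat T e (varF x) \<longleftrightarrow> (\<exists>n. tval e x = code_tm (Var n))"
  unfolding varF_def by (intro satI) simp

lemma occ_varF [simp]: "occt k x \<Longrightarrow> occ k (varF x)"
  by (simp add: varF_def)

definition "pa_cterm_step x Q \<longleftrightarrow> x = code_tm Zero \<or> (\<exists>y. Q y \<and> x = prod_encode (2, y)) \<or>
  (\<exists>y z. Q y \<and> Q z \<and> (x = prod_encode (3, prod_encode (y, z)) \<or> x = prod_encode (4, prod_encode (y, z))))"

definition "cterm_step x Q \<longleftrightarrow> x = code_tm Zero \<or>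
  (\<exists>y. Q y \<and> (x = prod_encode (2, y) \<or> x = prod_encode (5, y))) \<or>
  (\<exists>y z. Q y \<and> Q z \<and> (x = prod_encode (3, prod_encode (y, z)) \<or> x = prod_encode (4, prod_encode (y, z))))"

definition "term_step x Q \<longleftrightarrow> (\<exists>n. x = code_tm (Var n)) \<or> x = code_tm Zero \<or>
  (\<exists>y. Q y \<and> (x = prod_encode (2, y) \<or> x = prod_encode (5, y))) \<or>
  (\<exists>y z. Q y \<and> Q z \<and> (x = prod_encode (3, prod_encode (y, z)) \<or> x = prod_encode (4, prod_encode (y, z))))"

lemma sat_pa_ctermF [simp]: "sat T e (pa_ctermF x) \<longleftrightarrow> Ind pa_cterm_step (tval e x)"
  unfolding pa_ctermF_def pa_cterm_step_def
  by (rule sat_inductiveF) (intro satI | simp)+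

lemma sat_ctermF [simp]: "sat T e (ctermF x) \<longleftrightarrow> Ind cterm_step (tval e x)"
  unfolding ctermF_def cterm_step_def
  by (rule sat_inductiveF) (intro satI | simp)+

lemma sat_termF [simp]: "sat T e (termF x) \<longleftrightarrow> Ind term_step (tval e x)"
  unfolding termF_def term_step_def
  by (rule sat_inductiveF) (intro satI | simp)+

lemma occ_termF [simp]:
  "occt k x \<Longrightarrow> occ k (pa_ctermF x)"
  "occt k x \<Longrightarrow> occ k (ctermF x)"
  "occt k x \<Longrightarrow> occ k (termF x)"
  by (simp_all add: pa_ctermF_def ctermF_def termF_def)

lemma Ind_term_sound: "Ind term_step x \<Longrightarrow> \<exists>t. x = code_tm t"
proof (erule Ind_induct)
  fix y Q assume "term_step y Q" and Q: "\<And>z. Q z \<Longrightarrow> \<exists>t. z = code_tm t"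
  then show "\<exists>t. y = code_tm t"
    unfolding term_step_def by (auto simp flip: code_tm.simps dest!: Q)
qed

lemma Ind_cterm_sound: "Ind cterm_step x \<Longrightarrow> \<exists>t. x = code_tm t \<and> tvars t = {}"
proof (erule Ind_induct)
  fix y Q assume "cterm_step y Q" and Q: "\<And>z. Q z \<Longrightarrow> \<exists>t. z = code_tm t \<and> tvars t = {}"
  then show "\<exists>t. y = code_tm t \<and> tvars t = {}"
    unfolding cterm_step_def by (auto simp flip: code_tm.simps dest!: Q)
qed

lemma Ind_pa_cterm_sound: "Ind pa_cterm_step x \<Longrightarrow> \<exists>t. x = code_tm t \<and> tvars t = {}"
proof (erule Ind_induct)
  fix y Q assume "pa_cterm_step y Q" and Q: "\<And>z. Q z \<Longrightarrow> \<exists>t. z = code_tm t \<and> tvars t = {}"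
  then show "\<exists>t. y = code_tm t \<and> tvars t = {}"
    unfolding pa_cterm_step_def by (auto simp flip: code_tm.simps dest!: Q)
qed

text \<open>Every element of the standard model is named by a numeral, so with the numerals among
  the closed terms, quantifying over closed terms amounts to quantifying over numbers.\<close>

lemma Ind_pa_cterm_num: "Ind pa_cterm_step (code_tm (num n))"
proof (induction n)
  case 0
  show ?case by (rule Ind_step[where Z = "{}"]) (auto simp: pa_cterm_step_def)
next
  case (Suc n)
  show ?case
    by (rule Ind_step[where Z = "{code_tm (num n)}"]) (use Suc in \<open>auto simp: pa_cterm_step_def\<close>)
qed

lemma Ind_cterm_num: "Ind cterm_step (code_tm (num n))"
proof (induction n)
  case 0
  show ?case by (rule Ind_step[where Z = "{}"]) (auto simp: cterm_step_def)
next
  case (Suc n)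
  show ?case
    by (rule Ind_step[where Z = "{code_tm (num n)}"]) (use Suc in \<open>auto simp: cterm_step_def\<close>)
qed

definition "atom x \<longleftrightarrow>
   (\<exists>s. Ind term_step s \<and> (\<exists>k\<in>{7, 8, 10, 11}. x = prod_encode (k, s))) \<or>
   (\<exists>s t. Ind term_step s \<and> Ind term_step t \<and>
     (x = prod_encode (6, prod_encode (s, t)) \<or> x = prod_encode (9, prod_encode (s, t))))"

lemma sat_atomF [simp]: "sat T e (atomF x) \<longleftrightarrow> atom (tval e x)"
  unfolding atomF_def atom_def by (intro satI) simp_all

text \<open>Atomic formulas have no binders; the second conclusion is the base case of
  \<open>Ind_free_for_sound\<close>.\<close>

lemma atom_sound: assumes "atom x" obtains \<phi> where "x = code \<phi>" "\<And>t v. free_for t v \<phi>"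
  using assms unfolding atom_def
proof (elim disjE exE conjE bexE)
  fix s k assume s: "Ind term_step s" and k: "k \<in> {7, 8, 10, 11}" "x = prod_encode (k, s)"
  from Ind_term_sound[OF s] obtain s' where "s = code_tm s'" ..
  with k that[of "PU s'"] that[of "K1 s'"] that[of "Tr s'"] that[of "Ag s'"]
  show thesis by auto
next
  fix s t assume s: "Ind term_step s" and t: "Ind term_step t" and x: "x = prod_encode (6, prod_encode (s, t))"
  from Ind_term_sound[OF s] Ind_term_sound[OF t] obtain s' t' where "s = code_tm s'" "t = code_tm t'" by blast
  with x that[of "Eq s' t'"] show thesis by auto
next
  fix s t assume s: "Ind term_step s" and t: "Ind term_step t" and x: "x = prod_encode (9, prod_encode (s, t))"
  from Ind_term_sound[OF s] Ind_term_sound[OF t] obtain s' t' where "s = code_tm s'" "t = code_tm t'" by blast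
  with x that[of "K2 s' t'"] show thesis by auto
qed

definition "formula_step x Q \<longleftrightarrow> atom x \<or> (\<exists>y. Q y \<and> x = prod_encode (12, y)) \<or>
  (\<exists>y z. Q y \<and> Q z \<and> (\<exists>k\<in>{13, 14, 15}. x = prod_encode (k, prod_encode (y, z)))) \<or>
  (\<exists>v y. (\<exists>n. v = code_tm (Var n)) \<and> Q y \<and>
    (x = prod_encode (16, prod_encode (v, y)) \<or> x = prod_encode (17, prod_encode (v, y))))"

lemma sat_formulaF [simp]: "sat T e (formulaF x) \<longleftrightarrow> Ind formula_step (tval e x)"
  unfolding formulaF_def formula_step_def
  by (rule sat_inductiveF) (intro satI | simp)+

lemma occ_formulaF [simp]: "occt k x \<Longrightarrow> occ k (formulaF x)"
  by (simp add: formulaF_def)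

lemma Ind_formula_sound: "Ind formula_step x \<Longrightarrow> \<exists>\<phi>. x = code \<phi>"
proof (erule Ind_induct)
  fix y Q assume "formula_step y Q" and Q: "\<And>z. Q z \<Longrightarrow> \<exists>\<phi>. z = code \<phi>"
  then show "\<exists>\<phi>. y = code \<phi>"
    unfolding formula_step_def
    by (auto simp flip: code.simps simp del: code_tm.simps dest!: Q elim: atom_sound)
qed

subsection \<open>Substitution\<close>

text \<open>The long clauses of \<open>sbtF\<close> get names of their own. Each is evaluated once,
  and \<open>sat_sbtF\<close> then meets a short disjunction.\<close>

definition "unary_sbtF x y prev = (\<^bold>\<exists>x1. \<^bold>\<exists>y1. (\<^bold>\<exists>q. pairF x1 y1 q \<^bold>\<and> prev q) \<^bold>\<and>
  Disj (map (\<lambda>k. nodeF k x1 x \<^bold>\<and> nodeF k y1 y) [2, 5, 7, 8, 10, 11, 12]))"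

definition "binary_sbtF x y prev = (\<^bold>\<exists>x1. \<^bold>\<exists>y1. \<^bold>\<exists>x2. \<^bold>\<exists>y2.
  (\<^bold>\<exists>q. pairF x1 y1 q \<^bold>\<and> prev q) \<^bold>\<and> (\<^bold>\<exists>q. pairF x2 y2 q \<^bold>\<and> prev q) \<^bold>\<and>
  Disj (map (\<lambda>k. node2F k x1 x2 x \<^bold>\<and> node2F k y1 y2 y) [3, 4, 6, 9, 13, 14, 15]))"

definition "bound_sbtF v x y = (\<^bold>\<exists>x1. Disj (map (\<lambda>k. node2F k v x1 x) [16, 17]) \<^bold>\<and> y \<^bold>= x)"

definition "quant_sbtF v x y prev = (\<^bold>\<exists>w. \<^bold>\<exists>x1. \<^bold>\<exists>y1. varF w \<^bold>\<and> \<^bold>\<not> w \<^bold>= v \<^bold>\<and>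
  (\<^bold>\<exists>q. pairF x1 y1 q \<^bold>\<and> prev q) \<^bold>\<and> Disj (map (\<lambda>k. node2F k w x1 x \<^bold>\<and> node2F k w y1 y) [16, 17]))"

definition "unary_sbt x y Q \<longleftrightarrow> (\<exists>x1 y1. (\<exists>q. q = prod_encode (x1, y1) \<and> Q q) \<and>
  (\<exists>k\<in>{2, 5, 7, 8, 10, 11, 12}. x = prod_encode (k, x1) \<and> y = prod_encode (k, y1)))"

definition "binary_sbt x y Q \<longleftrightarrow> (\<exists>x1 y1 x2 y2.
  (\<exists>q. q = prod_encode (x1, y1) \<and> Q q) \<and> (\<exists>q. q = prod_encode (x2, y2) \<and> Q q) \<and>
  (\<exists>k\<in>{3, 4, 6, 9, 13, 14, 15}.
     x = prod_encode (k, prod_encode (x1, x2)) \<and> y = prod_encode (k, prod_encode (y1, y2))))"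

definition "bound_sbt v x y \<longleftrightarrow> (\<exists>x1. (\<exists>k\<in>{16, 17}. x = prod_encode (k, prod_encode (v, x1))) \<and> y = x)"

definition "quant_sbt v x y Q \<longleftrightarrow> (\<exists>w x1 y1. (\<exists>n. w = code_tm (Var n)) \<and> \<not> w = v \<and>
  (\<exists>q. q = prod_encode (x1, y1) \<and> Q q) \<and>
  (\<exists>k\<in>{16, 17}. x = prod_encode (k, prod_encode (w, x1)) \<and> y = prod_encode (k, prod_encode (w, y1))))"

lemma sat_sbt_clauses:
  assumes Q: "\<And>e' z. agree m e' e \<Longrightarrow> sat T e' (prev z) = Q (tval e' z)"
    and m: "\<And>z. occ m (prev z)"
  shows "sat T e (unary_sbtF x y prev) = unary_sbt (tval e x) (tval e y) Q"
    and "sat T e (binary_sbtF x y prev) = binary_sbt (tval e x) (tval e y) Q"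
    and "sat T e (quant_sbtF v x y prev) = quant_sbt (tval e v) (tval e x) (tval e y) Q"
  subgoal
    unfolding unary_sbtF_def unary_sbt_def
    by (intro satI) (simp_all add: Q m)
  subgoal
    unfolding binary_sbtF_def binary_sbt_def
    by (intro satI) (simp_all add: Q m)
  subgoal
    unfolding quant_sbtF_def quant_sbt_def
    by (intro satI) (simp_all add: Q m)
  done

lemma sat_bound_sbtF [simp]:
  "sat T e (bound_sbtF v x y) = bound_sbt (tval e v) (tval e x) (tval e y)"
  unfolding bound_sbtF_def bound_sbt_def by (intro satI) simp_all

lemma occ_sbt_clauses [simp]:
  "occt k x \<or> occt k y \<or> (\<forall>z. occ k (prev z)) \<Longrightarrow> occ k (unary_sbtF x y prev)"
  "occt k x \<or> occt k y \<or> (\<forall>z. occ k (prev z)) \<Longrightarrow> occ k (binary_sbtF x y prev)"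
  "occt k x \<or> occt k y \<or> occt k v \<Longrightarrow> occ k (bound_sbtF v x y)"
  "occt k x \<or> occt k y \<or> occt k v \<or> (\<forall>z. occ k (prev z)) \<Longrightarrow>
    occ k (quant_sbtF v x y prev)"
  by (auto simp: unary_sbtF_def binary_sbtF_def bound_sbtF_def quant_sbtF_def)

definition "sbt_step t v p Q \<longleftrightarrow> (\<exists>x y. p = prod_encode (x, y) \<and>
   (  (x = v \<and> y = t)
    \<or> ((\<exists>n. x = code_tm (Var n)) \<and> \<not> x = v \<and> y = x)
    \<or> (x = code_tm Zero \<and> y = x)
    \<or> unary_sbt x y Q \<or> binary_sbt x y Q \<or> bound_sbt v x y \<or> quant_sbt v x y Q))"

definition "SBT x t v y \<longleftrightarrow> Ind (sbt_step t v) (prod_encode (x, y))"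

lemma sat_sbtF [simp]: "sat T e (sbtF x t v y) \<longleftrightarrow> SBT (tval e x) (tval e t) (tval e v) (tval e y)"
proof -
  let ?step = "\<lambda>p prev. \<^bold>\<exists>x. \<^bold>\<exists>y. pairF x y p \<^bold>\<and>
     (  (x \<^bold>= v \<^bold>\<and> y \<^bold>= t)
      \<^bold>\<or> (varF x \<^bold>\<and> \<^bold>\<not> x \<^bold>= v \<^bold>\<and> y \<^bold>= x)
      \<^bold>\<or> (x \<^bold>= gq_tm Zero \<^bold>\<and> y \<^bold>= x)
      \<^bold>\<or> unary_sbtF x y prev \<^bold>\<or> binary_sbtF x y prev \<^bold>\<or> bound_sbtF v x y \<^bold>\<or> quant_sbtF v x y prev)"
  have eq: "sbtF x t v y = (\<^bold>\<exists>p. pairF x y p \<^bold>\<and> inductiveF ?step p)"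
    unfolding sbtF_def unary_sbtF_def binary_sbtF_def bound_sbtF_def quant_sbtF_def ..
  have step: "sat T e (inductiveF ?step p) \<longleftrightarrow> Ind (sbt_step (tval e t) (tval e v)) (tval e p)" for e p
  proof (rule sat_inductiveF)
    fix e' p m Q and prev :: "tm \<Rightarrow> fm"
    assume tv: "\<And>s. (\<And>p prev. occ (tmax s) (?step p prev)) \<Longrightarrow> tval e' s = tval e s"
      and Q: "\<And>e'' z. agree m e'' e' \<Longrightarrow> sat T e'' (prev z) = Q (tval e'' z)"
      and m: "\<And>z. occ m (prev z)"
    have t: "tval e' t = tval e t" and v: "tval e' v = tval e v" by (simp_all add: tv)
    have clauses: "sat T e'' (unary_sbtF x y prev) = unary_sbt (tval e'' x) (tval e'' y) Q"
       "sat T e'' (binary_sbtF x y prev) = binary_sbt (tval e'' x) (tval e'' y) Q"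
       "sat T e'' (quant_sbtF v x y prev) = quant_sbt (tval e'' v) (tval e'' x) (tval e'' y) Q"
      if "agree m e'' e'" for e'' x y v
      by (rule sat_sbt_clauses[OF Q m]; use that in \<open>simp add: agree_def\<close>)+
    show "sat T e' (?step p prev) = sbt_step (tval e t) (tval e v) (tval e' p) Q"
      unfolding sbt_step_def by (intro satI) (simp_all add: t v clauses m)
  qed
  have "sat T e (sbtF x t v y) \<longleftrightarrow>
      (\<exists>p. p = prod_encode (tval e x, tval e y) \<and> Ind (sbt_step (tval e t) (tval e v)) p)"
    unfolding eq by (intro satI) (simp_all add: step)
  then show ?thesis by (simp add: SBT_def)
qed

lemma occ_sbtF [simp]:
  "occt k x \<or> occt k t \<or> occt k v \<or> occt k y \<Longrightarrow> occ k (sbtF x t v y)"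
  by (auto simp: sbtF_def)

lemma sbt_step_mono: "sbt_step t v y Q \<Longrightarrow> (\<And>z. Q z \<Longrightarrow> R z) \<Longrightarrow> sbt_step t v y R"
proof -
  assume QR: "\<And>z. Q z \<Longrightarrow> R z"
  have "unary_sbt x y Q \<Longrightarrow> unary_sbt x y R" "binary_sbt x y Q \<Longrightarrow> binary_sbt x y R"
    "quant_sbt v x y Q \<Longrightarrow> quant_sbt v x y R" for x y
    unfolding unary_sbt_def binary_sbt_def quant_sbt_def by (meson QR, meson QR, blast intro: QR)
  then show "sbt_step t v y Q \<Longrightarrow> sbt_step t v y R"
    unfolding sbt_step_def by (elim ex_forward conj_forward disj_forward)
qed

lemma SBT_sound:
  assumes "SBT x (code_tm t) (code_tm (Var v)) y"
  shows "x = code_tm s \<Longrightarrow> y = code_tm (tsbt s t v)" and "x = code \<phi> \<Longrightarrow> y = code (sbt \<phi> t v)"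
proof -
  \<comment> \<open>A derivation may contain entries that code no expression, such as a connective
    tag put on a term. \<open>P\<close> therefore speaks only of entries whose first component is a
    code. There the tag of the input selects the clause, and injectivity identifies the
    components.\<close>
  define P where "P p \<longleftrightarrow> (\<forall>s y. p = prod_encode (code_tm s, y) \<longrightarrow> y = code_tm (tsbt s t v)) \<and>
    (\<forall>\<phi> y. p = prod_encode (code \<phi>, y) \<longrightarrow> y = code (sbt \<phi> t v))" for p
  have "P (prod_encode (x, y))"
    using assms unfolding SBT_def
  proof (rule Ind_induct)
    fix p Q assume step: "sbt_step (code_tm t) (code_tm (Var v)) p Q" and Q: "\<And>z. Q z \<Longrightarrow> P z"
    have Q1: "Q (prod_encode (code_tm s, y)) \<Longrightarrow> y = code_tm (tsbt s t v)" for s y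
      using Q P_def by blast
    have Q2: "Q (prod_encode (code \<phi>, y)) \<Longrightarrow> y = code (sbt \<phi> t v)" for \<phi> y
      using Q P_def by blast
    have "y = code_tm (tsbt s t v)" if "p = prod_encode (code_tm s, y)" for s y
      using step that
      by (cases s) (auto simp: sbt_step_def unary_sbt_def binary_sbt_def bound_sbt_def quant_sbt_def dest!: Q1)
    moreover have "y = code (sbt \<phi> t v)" if "p = prod_encode (code \<phi>, y)" for \<phi> y
      using step that
      by (cases \<phi>) (auto simp: sbt_step_def unary_sbt_def binary_sbt_def bound_sbt_def quant_sbt_def dest!: Q1 Q2)
    ultimately show "P p" by (simp add: P_def)
  qed
  then show "x = code_tm s \<Longrightarrow> y = code_tm (tsbt s t v)" and "x = code \<phi> \<Longrightarrow> y = code (sbt \<phi> t v)"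
    by (auto simp: P_def)
qed

section \<open>Existence of the result of a substitution\<close>

lemma SBT_step:
  assumes "finite Z" "\<And>z. z \<in> Z \<Longrightarrow> Ind (sbt_step t v) z"
    "sbt_step t v (prod_encode (x, y)) (\<lambda>z. z \<in> Z)"
  shows "SBT x t v y"
  unfolding SBT_def using assms sbt_step_mono by (rule Ind_step)

lemma SBT_leaf:
  "SBT v t v t"
  "code_tm (Var n) \<noteq> v \<Longrightarrow> SBT (code_tm (Var n)) t v (code_tm (Var n))"
  "SBT (code_tm Zero) t v (code_tm Zero)"
  "k = 16 \<or> k = 17 \<Longrightarrow> SBT (prod_encode (k, prod_encode (v, x))) t v (prod_encode (k, prod_encode (v, x)))"
  by (rule SBT_step[where Z = "{}"]; auto simp: sbt_step_def bound_sbt_def; fail)+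

lemma SBT_unary:
  assumes "SBT x t v y" "k \<in> {2, 5, 7, 8, 10, 11, 12}"
  shows "SBT (prod_encode (k, x)) t v (prod_encode (k, y))"
proof (rule SBT_step[where Z = "{prod_encode (x, y)}"])
  have "unary_sbt (prod_encode (k, x)) (prod_encode (k, y)) (\<lambda>z. z \<in> {prod_encode (x, y)})"
    using assms(2) unfolding unary_sbt_def by blast
  then show "sbt_step t v (prod_encode (prod_encode (k, x), prod_encode (k, y))) (\<lambda>z. z \<in> {prod_encode (x, y)})"
    unfolding sbt_step_def by blast
qed (use assms(1) in \<open>auto simp: SBT_def\<close>)

lemma SBT_binary:
  assumes "SBT x t v y" "SBT x' t v y'" "k \<in> {3, 4, 6, 9, 13, 14, 15}"
  shows "SBT (prod_encode (k, prod_encode (x, x'))) t v (prod_encode (k, prod_encode (y, y')))"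
proof (rule SBT_step[where Z = "{prod_encode (x, y), prod_encode (x', y')}"])
  have "binary_sbt (prod_encode (k, prod_encode (x, x'))) (prod_encode (k, prod_encode (y, y')))
     (\<lambda>z. z \<in> {prod_encode (x, y), prod_encode (x', y')})"
    using assms(3) unfolding binary_sbt_def by blast
  then show "sbt_step t v (prod_encode (prod_encode (k, prod_encode (x, x')), prod_encode (k, prod_encode (y, y'))))
     (\<lambda>z. z \<in> {prod_encode (x, y), prod_encode (x', y')})"
    unfolding sbt_step_def by blast
qed (use assms(1,2) in \<open>auto simp: SBT_def\<close>)

lemma SBT_quant:
  assumes "SBT x t v y" "k \<in> {16, 17}" "code_tm (Var w) \<noteq> v"
  shows "SBT (prod_encode (k, prod_encode (code_tm (Var w), x))) t v (prod_encode (k, prod_encode (code_tm (Var w), y)))"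
proof (rule SBT_step[where Z = "{prod_encode (x, y)}"])
  have "quant_sbt v (prod_encode (k, prod_encode (code_tm (Var w), x))) (prod_encode (k, prod_encode (code_tm (Var w), y)))
     (\<lambda>z. z \<in> {prod_encode (x, y)})"
    using assms(2,3) unfolding quant_sbt_def by blast
  then show "sbt_step t v (prod_encode (prod_encode (k, prod_encode (code_tm (Var w), x)), prod_encode (k, prod_encode (code_tm (Var w), y))))
     (\<lambda>z. z \<in> {prod_encode (x, y)})"
    unfolding sbt_step_def by blast
qed (use assms(1) in \<open>auto simp: SBT_def\<close>)

lemma SBT_complete_tm: "SBT (code_tm s) (code_tm t) (code_tm (Var v)) (code_tm (tsbt s t v))"
proof (induction s)
  case (Var n)
  then show ?case
    using SBT_leaf(1)[of "code_tm (Var v)" "code_tm t"] SBT_leaf(2)[of n "code_tm (Var v)" "code_tm t"] by auto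
next
  case Zero
  then show ?case using SBT_leaf(3) by simp
qed (use SBT_unary SBT_binary in simp_all)

lemma SBT_complete: "SBT (code \<phi>) (code_tm t) (code_tm (Var v)) (code (sbt \<phi> t v))"
proof (induction \<phi>)
  case (Forall w \<phi>)
  then show ?case
    using SBT_leaf(4)[of 16 "code_tm (Var v)"] SBT_quant[OF Forall, of 16 w] by auto
next
  case (Exists w \<phi>)
  then show ?case
    using SBT_leaf(4)[of 17 "code_tm (Var v)"] SBT_quant[OF Exists, of 17 w] by auto
qed (use SBT_unary SBT_binary SBT_complete_tm in simp_all)

text \<open>Soundness gives uniqueness of the value and completeness its existence. Both count:
  \<open>at_value\<close> asks for a value, and the tests for free variables compare it with the
  input.\<close>

lemma SBT_iff:
  "SBT (code_tm s) (code_tm t) (code_tm (Var v)) y \<longleftrightarrow> y = code_tm (tsbt s t v)"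
  "SBT (code \<phi>) (code_tm t) (code_tm (Var v)) y \<longleftrightarrow> y = code (sbt \<phi> t v)"
  using SBT_sound SBT_complete SBT_complete_tm by blast+

text \<open>As \<open>Zero\<close> is closed, the result has no free \<open>v\<close>, so it can
  equal the input only if \<open>v\<close> was not free to begin with.\<close>

lemma sbt_Zero_eq_iff: "tsbt s Zero v = s \<longleftrightarrow> v \<notin> tvars s" "sbt \<phi> Zero v = \<phi> \<longleftrightarrow> v \<notin> fv \<phi>"
  using tvars_tsbt_closed[of Zero s v] fv_sbt_closed[of Zero \<phi> v] tsbt_idle sbt_idle by auto

lemma sat_not_freeF [simp]:
  "sat T e (not_freeF v x) \<longleftrightarrow> SBT (tval e x) (code_tm Zero) (tval e v) (tval e x)"
  by (simp add: not_freeF_def)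

lemma occ_not_freeF [simp]: "occt k v \<or> occt k x \<Longrightarrow> occ k (not_freeF v x)"
  by (simp add: not_freeF_def)

text \<open>A free variable outside \<open>A\<close> would have a code below \<open>x\<close>, hence
  pass to the second hypothesis, although putting \<open>Zero\<close> for it changes the formula.
  The set \<open>A\<close> is empty for sentences and a singleton for
  \<open>formula1F\<close>.\<close>

lemma closed_except_sound:
  assumes "Ind formula_step x"
    and "\<And>v. v < x \<Longrightarrow> (\<exists>n. v = code_tm (Var n)) \<Longrightarrow> v \<notin> code_tm ` Var ` A \<Longrightarrow> SBT x (code_tm Zero) v x"
  shows "\<exists>\<phi>. x = code \<phi> \<and> fv \<phi> \<subseteq> A"
proof -
  obtain \<phi> where \<phi>: "x = code \<phi>" using Ind_formula_sound[OF assms(1)] by blast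
  have "n \<in> A" if "n \<in> fv \<phi>" for n
  proof (rule ccontr)
    assume "n \<notin> A"
    then have "SBT x (code_tm Zero) (code_tm (Var n)) x"
      using fv_code[OF that] \<phi> by (intro assms(2)) auto
    then show False using that by (simp only: \<phi> SBT_iff code_eq_iff) (use sbt_Zero_eq_iff in metis)
  qed
  then show ?thesis using \<phi> by blast
qed

definition "sentence_code x \<longleftrightarrow> Ind formula_step x \<and>
  (\<forall>v. v < x \<longrightarrow> (\<exists>n. v = code_tm (Var n)) \<longrightarrow> SBT x (code_tm Zero) v x)"

lemma sat_sentenceF [simp]: "sat T e (sentenceF x) \<longleftrightarrow> sentence_code (tval e x)"
  unfolding sentenceF_def sentence_code_def by (intro satI) simp_all

lemma sentence_code_sound: "sentence_code x \<Longrightarrow> \<exists>\<phi>. x = code \<phi> \<and> sentence \<phi>"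
  using closed_except_sound[of x "{}"] by (auto simp: sentence_code_def sentence_def)

lemma sat_freeF [simp]:
  "sat T e (freeF v x) \<longleftrightarrow> (\<exists>z. SBT (tval e x) (code_tm Zero) (tval e v) z \<and> \<not> z = tval e x)"
  unfolding freeF_def by (intro satI) simp_all

lemma occ_freeF [simp]: "occt k v \<or> occt k x \<Longrightarrow> occ k (freeF v x)"
  by (auto simp: freeF_def)

definition "formula1_code v x \<longleftrightarrow> Ind formula_step x \<and>
  (\<exists>z. SBT x (code_tm Zero) v z \<and> \<not> z = x) \<and>
  (\<forall>w. w < x \<longrightarrow> (\<exists>n. w = code_tm (Var n)) \<longrightarrow> \<not> w = v \<longrightarrow> SBT x (code_tm Zero) w x)"

lemma sat_formula1F [simp]: "sat T e (formula1F v x) \<longleftrightarrow> formula1_code (tval e v) (tval e x)"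
  unfolding formula1F_def formula1_code_def by (intro satI) simp_all

lemma formula1_code_sound: "formula1_code (code_tm (Var n)) x \<Longrightarrow> \<exists>\<phi>. x = code \<phi> \<and> fv \<phi> \<subseteq> {n}"
  using closed_except_sound[of x "{n}"] by (auto simp: formula1_code_def)

lemma occ_formula1F [simp]: "occt k v \<or> occt k x \<Longrightarrow> occ k (formula1F v x)"
  by (auto simp: formula1F_def)

definition "free_for_step t v x Q \<longleftrightarrow> atom x
  \<or> (\<exists>y. Q y \<and> x = prod_encode (12, y))
  \<or> (\<exists>y z. Q y \<and> Q z \<and> (\<exists>k\<in>{13, 14, 15}. x = prod_encode (k, prod_encode (y, z))))
  \<or> (\<exists>w y. (\<exists>n. w = code_tm (Var n)) \<and>
       (x = prod_encode (16, prod_encode (w, y)) \<or> x = prod_encode (17, prod_encode (w, y))) \<and>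
       (SBT x (code_tm Zero) v x \<or> (SBT t (code_tm Zero) w t \<and> Q y)))"

lemma sat_free_forF [simp]:
  "sat T e (free_forF t v x) \<longleftrightarrow> Ind (free_for_step (tval e t) (tval e v)) (tval e x)"
  unfolding free_forF_def
proof (rule sat_inductiveF)
  let ?step = "\<lambda>x prev. atomF x
    \<^bold>\<or> (\<^bold>\<exists>y. prev y \<^bold>\<and> nodeF 12 y x)
    \<^bold>\<or> (\<^bold>\<exists>y. \<^bold>\<exists>z. prev y \<^bold>\<and> prev z \<^bold>\<and> Disj (map (\<lambda>k. node2F k y z x) [13, 14, 15]))
    \<^bold>\<or> (\<^bold>\<exists>w. \<^bold>\<exists>y. varF w \<^bold>\<and> (node2F 16 w y x \<^bold>\<or> node2F 17 w y x) \<^bold>\<and>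
          (not_freeF v x \<^bold>\<or> (not_freeF w t \<^bold>\<and> prev y)))"
  fix e' x m Q and prev :: "tm \<Rightarrow> fm"
  assume tv: "\<And>s. (\<And>x prev. occ (tmax s) (?step x prev)) \<Longrightarrow> tval e' s = tval e s"
    and Q: "\<And>e'' z. agree m e'' e' \<Longrightarrow> sat T e'' (prev z) = Q (tval e'' z)"
    and m: "\<And>z. occ m (prev z)"
  have t: "tval e' t = tval e t" and v: "tval e' v = tval e v" by (simp_all add: tv)
  show "sat T e' (?step x prev) = free_for_step (tval e t) (tval e v) (tval e' x) Q"
    unfolding free_for_step_def by (intro satI) (simp_all add: t v Q m)
qed

lemma occ_free_forF [simp]: "occt k t \<or> occt k v \<or> occt k x \<Longrightarrow> occ k (free_forF t v x)"
  by (auto simp: free_forF_def)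

lemma Ind_free_for_sound:
  "Ind (free_for_step (code_tm t) (code_tm (Var v))) x \<Longrightarrow> x = code \<phi> \<Longrightarrow> free_for t v \<phi>"
proof (induction arbitrary: \<phi> rule: Ind_induct)
  case (step x Q)
  from step(1) show ?case unfolding free_for_step_def
  proof (elim disjE)
    assume "atom x"
    then obtain \<psi> where "x = code \<psi>" "free_for t v \<psi>" by (metis atom_sound)
    then show ?thesis using step by simp
  next
    assume "\<exists>y. Q y \<and> x = prod_encode (12, y)"
    then show ?thesis using step by (cases \<phi>) auto
  next
    assume "\<exists>y z. Q y \<and> Q z \<and> (\<exists>k\<in>{13, 14, 15}. x = prod_encode (k, prod_encode (y, z)))"
    then show ?thesis using step by (cases \<phi>) auto
  next
    assume "\<exists>w y. (\<exists>n. w = code_tm (Var n)) \<and>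
       (x = prod_encode (16, prod_encode (w, y)) \<or> x = prod_encode (17, prod_encode (w, y))) \<and>
       (SBT x (code_tm Zero) (code_tm (Var v)) x \<or> (SBT (code_tm t) (code_tm Zero) w (code_tm t) \<and> Q y))"
    then obtain n y where x: "x = prod_encode (16, prod_encode (code_tm (Var n), y)) \<or>
        x = prod_encode (17, prod_encode (code_tm (Var n), y))"
      and s: "SBT x (code_tm Zero) (code_tm (Var v)) x \<or>
        (SBT (code_tm t) (code_tm Zero) (code_tm (Var n)) (code_tm t) \<and> Q y)"
      by blast
    \<comment> \<open>With actual codes for all arguments, both freeness tests become equations
      between an expression and its substitution instance.\<close>
    from s have "v \<notin> fv \<phi> \<or> n \<notin> tvars t \<and> Q y"
      unfolding step(3) SBT_iff code_eq_iff code_tm_eq_iff using sbt_Zero_eq_iff by metis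
    then show ?thesis using x step by (cases \<phi>) auto
  qed
qed

subsection \<open>Numerals, values and dotted expressions\<close>

definition "num_step p Q \<longleftrightarrow> p = prod_encode (0, code_tm Zero) \<or>
  (\<exists>m y z. (\<exists>q. q = prod_encode (m, y) \<and> Q q) \<and> z = prod_encode (2, y) \<and> p = prod_encode (Suc m, z))"

lemma Ind_num_iff: "Ind num_step (prod_encode (n, x)) \<longleftrightarrow> x = code_tm (num n)"
proof
  have "\<exists>m. p = prod_encode (m, code_tm (num m))" if "Ind num_step p" for p
    using that
  proof (induction rule: Ind_induct)
    case (step p Q)
    have Q: "\<exists>m. z = prod_encode (m, code_tm (num m))" if "Q z" for z using step(2) that .
    show ?case
    proof (cases "p = prod_encode (0, code_tm Zero)")
      case True
      then show ?thesis by (intro exI[of _ 0]) simp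
    next
      case False
      then obtain m y where "Q (prod_encode (m, y))" "p = prod_encode (Suc m, prod_encode (2, y))"
        using step(1) by (auto simp: num_step_def)
      then show ?thesis using Q[of "prod_encode (m, y)"] by (intro exI[of _ "Suc m"]) auto
    qed
  qed
  then show "Ind num_step (prod_encode (n, x)) \<Longrightarrow> x = code_tm (num n)" by fastforce
next
  have mono: "num_step y Q \<Longrightarrow> (\<And>z. Q z \<Longrightarrow> R z) \<Longrightarrow> num_step y R" for y Q R
    unfolding num_step_def by (elim disj_forward ex_forward conj_forward)
  assume x: "x = code_tm (num n)"
  show "Ind num_step (prod_encode (n, x))"
    unfolding x
  proof (induction n)
    case 0
    show ?case by (rule Ind_step[where Z = "{}", OF _ _ _ mono]) (auto simp: num_step_def)
  next
    case (Suc n)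
    show ?case
      by (rule Ind_step[where Z = "{prod_encode (n, code_tm (num n))}", OF _ _ _ mono])
        (use Suc in \<open>auto simp: num_step_def\<close>)
  qed
qed

lemma sat_numF [simp]: "sat T e (numF n x) \<longleftrightarrow> tval e x = code_tm (num (tval e n))"
proof -
  have "sat T e (inductiveF (\<lambda>p prev. pairF Zero (gq_tm Zero) p
    \<^bold>\<or> (\<^bold>\<exists>m. \<^bold>\<exists>y. \<^bold>\<exists>z. (\<^bold>\<exists>q. pairF m y q \<^bold>\<and> prev q) \<^bold>\<and> nodeF 2 y z \<^bold>\<and> pairF (Sc m) z p)) p) \<longleftrightarrow>
    Ind num_step (tval e p)" for e p
    unfolding num_step_def by (rule sat_inductiveF) (intro satI | simp)+
  then have "sat T e (numF n x) \<longleftrightarrow> (\<exists>p. p = prod_encode (tval e n, tval e x) \<and> Ind num_step p)"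
    unfolding numF_def by (intro satI) simp_all
  then show ?thesis by (simp add: Ind_num_iff)
qed

lemma occ_numF [simp]: "occt k n \<or> occt k x \<Longrightarrow> occ k (numF n x)"
  by (auto simp: numF_def)

definition "val_step p Q \<longleftrightarrow> p = prod_encode (code_tm Zero, 0) \<or>
  (\<exists>y m z. (\<exists>q. q = prod_encode (y, m) \<and> Q q) \<and> z = prod_encode (2, y) \<and> p = prod_encode (z, Suc m)) \<or>
  (\<exists>y1 m1 y2 m2 z. (\<exists>q. q = prod_encode (y1, m1) \<and> Q q) \<and> (\<exists>q. q = prod_encode (y2, m2) \<and> Q q) \<and>
     (z = prod_encode (3, prod_encode (y1, y2)) \<and> p = prod_encode (z, m1 + m2) \<or>
      z = prod_encode (4, prod_encode (y1, y2)) \<and> p = prod_encode (z, m1 * m2)))"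

lemma Ind_val_sound: "Ind val_step p \<Longrightarrow> \<exists>t. p = prod_encode (code_tm t, tval e t)"
proof (induction rule: Ind_induct)
  case (step p Q)
  have Q: "\<exists>t. x = code_tm t \<and> n = tval e t" if "Q (prod_encode (x, n))" for x n
    using step(2)[OF that] by auto
  from step(1) consider "p = prod_encode (code_tm Zero, 0)"
    | y m where "Q (prod_encode (y, m))" "p = prod_encode (prod_encode (2, y), Suc m)"
    | y1 m1 y2 m2 where "Q (prod_encode (y1, m1))" "Q (prod_encode (y2, m2))"
        "p = prod_encode (prod_encode (3, prod_encode (y1, y2)), m1 + m2)"
    | y1 m1 y2 m2 where "Q (prod_encode (y1, m1))" "Q (prod_encode (y2, m2))"
        "p = prod_encode (prod_encode (4, prod_encode (y1, y2)), m1 * m2)"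
    unfolding val_step_def by blast
  then show ?case
  proof cases
    case 1
    then show ?thesis by (intro exI[of _ Zero]) simp
  next
    case 2
    from Q[OF 2(1)] obtain t where "y = code_tm t" "m = tval e t" by blast
    then show ?thesis using 2(2) by (intro exI[of _ "Sc t"]) simp
  next
    case 3
    from Q[OF 3(1)] Q[OF 3(2)] obtain s t where "y1 = code_tm s" "m1 = tval e s" "y2 = code_tm t" "m2 = tval e t"
      by blast
    then show ?thesis using 3(3) by (intro exI[of _ "Plus s t"]) simp
  next
    case 4
    from Q[OF 4(1)] Q[OF 4(2)] obtain s t where "y1 = code_tm s" "m1 = tval e s" "y2 = code_tm t" "m2 = tval e t"
      by blast
    then show ?thesis using 4(3) by (intro exI[of _ "Times s t"]) simp
  qed
qed

text \<open>\<open>valF\<close> stands in an antecedent of \<open>T_atomic\<close>, which calls for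
  this direction. The environment \<open>e'\<close> is arbitrary because \<open>val_step\<close>
  generates terms without variables.\<close>

lemma sat_valF:
  assumes "sat T e (valF x n)" "tval e x = code_tm t" shows "tval e n = tval e' t"
proof -
  have "sat T e (inductiveF (\<lambda>p prev.
      pairF (gq_tm Zero) Zero p
    \<^bold>\<or> (\<^bold>\<exists>y. \<^bold>\<exists>m. \<^bold>\<exists>z. (\<^bold>\<exists>q. pairF y m q \<^bold>\<and> prev q) \<^bold>\<and> nodeF 2 y z \<^bold>\<and> pairF z (Sc m) p)
    \<^bold>\<or> (\<^bold>\<exists>y1. \<^bold>\<exists>m1. \<^bold>\<exists>y2. \<^bold>\<exists>m2. \<^bold>\<exists>z.
          (\<^bold>\<exists>q. pairF y1 m1 q \<^bold>\<and> prev q) \<^bold>\<and> (\<^bold>\<exists>q. pairF y2 m2 q \<^bold>\<and> prev q) \<^bold>\<and>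
          (  (node2F 3 y1 y2 z \<^bold>\<and> pairF z (Plus m1 m2) p)
           \<^bold>\<or> (node2F 4 y1 y2 z \<^bold>\<and> pairF z (Times m1 m2) p)))) p) \<longleftrightarrow>
    Ind val_step (tval e p)" for e p
    unfolding val_step_def by (rule sat_inductiveF) (intro satI | simp)+
  then have "sat T e (valF x n) \<longleftrightarrow> (\<exists>p. p = prod_encode (tval e x, tval e n) \<and> Ind val_step p)"
    unfolding valF_def by (intro satI) simp_all
  with assms(1) have "Ind val_step (prod_encode (tval e x, tval e n))" by simp
  from Ind_val_sound[OF this, of e'] assms(2) show ?thesis by auto
qed

section \<open>Values of dotted expressions\<close>

primrec dmax :: "dx \<Rightarrow> nat" where
  "dmax \<langle>t\<rangle> = tmax t"
| "dmax (Node k d) = dmax d"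
| "dmax (Node2 k d e) = max (dmax d) (dmax e)"
| "dmax (dSbt d e f) = max (dmax d) (max (dmax e) (dmax f))"
| "dmax (dNum d) = dmax d"

definition occd :: "nat \<Rightarrow> dx \<Rightarrow> bool"
  where "occd k d \<longleftrightarrow> k \<le> dmax d"

lemma occd_simps [simp]:
  "occd k \<langle>t\<rangle> \<longleftrightarrow> occt k t"
  "occd k (Node i d) \<longleftrightarrow> occd k d"
  "occd k (Node2 i d e) \<longleftrightarrow> occd k d \<or> occd k e"
  "occd k (dSbt d e f) \<longleftrightarrow> occd k d \<or> occd k e \<or> occd k f"
  "occd k (dNum d) \<longleftrightarrow> occd k d"
  "occd (dmax d) d"
  by (auto simp: occd_def occt_def le_max_iff_disj)

lemma above_max [simp]: "above v (max j k) \<longleftrightarrow> above v j \<and> above v k"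
  by (simp add: above_def)

text \<open>A relation, since \<open>SBT\<close> need not be functional on numbers that are not
  codes of the right kind; with the code of \<open>Zero\<close> in the place of \<open>v\<close>,
  two clauses of \<open>sbt_step\<close> can compete.\<close>

primrec dval :: "(nat \<Rightarrow> nat) \<Rightarrow> dx \<Rightarrow> nat \<Rightarrow> bool" where
  "dval e \<langle>t\<rangle> z \<longleftrightarrow> z = tval e t"
| "dval e (Node k d) z \<longleftrightarrow> (\<exists>x. dval e d x \<and> z = prod_encode (k, x))"
| "dval e (Node2 k d d') z \<longleftrightarrow> (\<exists>x y. dval e d x \<and> dval e d' y \<and> z = prod_encode (k, prod_encode (x, y)))"
| "dval e (dSbt d d' d'') z \<longleftrightarrow> (\<exists>x t v. dval e d x \<and> dval e d' t \<and> dval e d'' v \<and> SBT x t v z)"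
| "dval e (dNum d) z \<longleftrightarrow> (\<exists>x. dval e d x \<and> z = code_tm (num x))"

lemma dval_upd: "above v (dmax d) \<Longrightarrow> dval (e(v := n)) d z = dval e d z"
  by (induction d arbitrary: z) simp_all

lemma occ_is_value [simp]: "occt k z \<or> occd k d \<Longrightarrow> occ k (z \<doteq> d)"
  by (induction d arbitrary: z) auto

lemma sat_is_value [simp]: "sat T e (z \<doteq> d) \<longleftrightarrow> dval e d (tval e z)"
proof (induction d arbitrary: e z)
  case (Cst t)
  show ?case by simp
next
  case (Node k d)
  show ?case unfolding is_value.simps dval.simps by (intro satI) (simp_all add: Node dval_upd)
next
  case (Node2 k d d')
  show ?case unfolding is_value.simps dval.simps by (intro satI) (simp_all add: Node2 dval_upd)
next
  case (dSbt d d' d'')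
  show ?case unfolding is_value.simps dval.simps by (intro satI) (simp_all add: dSbt dval_upd)
next
  case (dNum d)
  show ?case unfolding is_value.simps dval.simps by (intro satI) (simp_all add: dNum dval_upd)
qed

declare is_value.simps [simp del]

lemma sat_at_value [satI]:
  assumes "\<And>v n. (\<And>k. occ k (P Zero) \<or> occd k d \<Longrightarrow> above v k) \<Longrightarrow> sat T (e(v := n)) (P (Var v)) = Q n"
  shows "sat T e (P \<bullet> d) \<longleftrightarrow> (\<exists>z. dval e d z \<and> Q z)"
  unfolding at_value_def by (intro satI, simp add: dval_upd, rule assms, auto)

lemma occ_at_value [simp]: "occ k (P Zero) \<or> occd k d \<Longrightarrow> occ k (P \<bullet> d)"
  by (auto simp: at_value_def)

lemma sat_at_fun:
  assumes "\<And>v n. (\<And>k. occ k (P Zero) \<or> occd k d \<Longrightarrow> above v k) \<Longrightarrow> sat T (e(v := n)) (P (Var v)) = Q n"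
    and "\<And>z. dval e d z \<longleftrightarrow> z = c"
  shows "sat T e (P \<bullet> d) \<longleftrightarrow> Q c"
  using sat_at_value[of P d T e Q] assms by simp

subsection \<open>Provability\<close>

definition "cImp x y = prod_encode (13, prod_encode (x, y))"
definition "cAnd x y = prod_encode (14, prod_encode (x, y))"
definition "cOr x y = prod_encode (15, prod_encode (x, y))"
definition "cNeg x = prod_encode (12, x)"
definition "cAll v x = prod_encode (16, prod_encode (v, x))"
definition "cEx v x = prod_encode (17, prod_encode (v, x))"

lemmas code_ops = cImp_def cAnd_def cOr_def cNeg_def cAll_def cEx_def

lemma code_ops_code:
  "cImp (code \<phi>) (code \<psi>) = code (\<phi> \<^bold>\<longrightarrow> \<psi>)"
  "cAnd (code \<phi>) (code \<psi>) = code (\<phi> \<^bold>\<and> \<psi>)"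
  "cOr (code \<phi>) (code \<psi>) = code (\<phi> \<^bold>\<or> \<psi>)"
  "cNeg (code \<phi>) = code (\<^bold>\<not> \<phi>)"
  "cAll (code_tm (Var v)) (code \<phi>) = code (Forall v \<phi>)"
  "cEx (code_tm (Var v)) (code \<phi>) = code (Exists v \<phi>)"
  by (simp_all add: code_ops)

definition "is_scheme x \<longleftrightarrow> (\<exists>p q r v t.
   Ind formula_step p \<and> Ind formula_step q \<and> Ind formula_step r \<and> (\<exists>n. v = code_tm (Var n)) \<and>
   Ind term_step t \<and>
   (x = cImp p (cImp q p) \<or>
    x = cImp (cImp p (cImp q r)) (cImp (cImp p q) (cImp p r)) \<or>
    x = cImp (cImp (cNeg p) (cNeg q)) (cImp q p) \<or>
    x = cImp (cAnd p q) p \<or>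
    x = cImp (cAnd p q) q \<or>
    x = cImp p (cImp q (cAnd p q)) \<or>
    x = cImp p (cOr p q) \<or>
    x = cImp q (cOr p q) \<or>
    x = cImp (cImp p r) (cImp (cImp q r) (cImp (cOr p q) r)) \<or>
    (Ind (free_for_step t v) p \<and> (\<exists>y. SBT p t v y \<and> x = cImp (cAll v p) y)) \<or>
    x = cImp (cAll v (cImp p q)) (cImp (cAll v p) (cAll v q)) \<or>
    (SBT p (code_tm Zero) v p \<and> x = cImp p (cAll v p)) \<or>
    x = cImp (cEx v p) (cNeg (cAll v (cNeg p))) \<or>
    x = cImp (cNeg (cAll v (cNeg p))) (cEx v p)))"

lemma sat_logical_schemesF [simp]: "sat T e (logical_schemesF x) \<longleftrightarrow> is_scheme (tval e x)"
  unfolding logical_schemesF_def is_scheme_def Disj_def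
  by (intro satI) (simp_all add: code_ops)

lemma is_scheme_sound: "is_scheme x \<Longrightarrow> \<exists>\<phi>\<in>logical_schemes. x = code \<phi>"
proof -
  assume "is_scheme x"
  then obtain \<phi> \<psi> \<chi> n t where
   "x = cImp (code \<phi>) (cImp (code \<psi>) (code \<phi>)) \<or>
    x = cImp (cImp (code \<phi>) (cImp (code \<psi>) (code \<chi>))) (cImp (cImp (code \<phi>) (code \<psi>)) (cImp (code \<phi>) (code \<chi>))) \<or>
    x = cImp (cImp (cNeg (code \<phi>)) (cNeg (code \<psi>))) (cImp (code \<psi>) (code \<phi>)) \<or>
    x = cImp (cAnd (code \<phi>) (code \<psi>)) (code \<phi>) \<or>
    x = cImp (cAnd (code \<phi>) (code \<psi>)) (code \<psi>) \<or>
    x = cImp (code \<phi>) (cImp (code \<psi>) (cAnd (code \<phi>) (code \<psi>))) \<or>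
    x = cImp (code \<phi>) (cOr (code \<phi>) (code \<psi>)) \<or>
    x = cImp (code \<psi>) (cOr (code \<phi>) (code \<psi>)) \<or>
    x = cImp (cImp (code \<phi>) (code \<chi>)) (cImp (cImp (code \<psi>) (code \<chi>)) (cImp (cOr (code \<phi>) (code \<psi>)) (code \<chi>))) \<or>
    (Ind (free_for_step (code_tm t) (code_tm (Var n))) (code \<phi>) \<and> (\<exists>y. SBT (code \<phi>) (code_tm t) (code_tm (Var n)) y \<and> x = cImp (cAll (code_tm (Var n)) (code \<phi>)) y)) \<or>
    x = cImp (cAll (code_tm (Var n)) (cImp (code \<phi>) (code \<psi>))) (cImp (cAll (code_tm (Var n)) (code \<phi>)) (cAll (code_tm (Var n)) (code \<psi>))) \<or>
    (SBT (code \<phi>) (code_tm Zero) (code_tm (Var n)) (code \<phi>) \<and> x = cImp (code \<phi>) (cAll (code_tm (Var n)) (code \<phi>))) \<or>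
    x = cImp (cEx (code_tm (Var n)) (code \<phi>)) (cNeg (cAll (code_tm (Var n)) (cNeg (code \<phi>)))) \<or>
    x = cImp (cNeg (cAll (code_tm (Var n)) (cNeg (code \<phi>)))) (cEx (code_tm (Var n)) (code \<phi>))"
    unfolding is_scheme_def by (elim exE conjE) (metis Ind_formula_sound Ind_term_sound)
  \<comment> \<open>The side condition of the scheme for vacuous quantification, in the orientation
    that \<open>SBT_iff\<close> leaves it in.\<close>
  moreover have "\<phi> = sbt \<phi> Zero n \<longleftrightarrow> n \<notin> fv \<phi>"
    using sbt_Zero_eq_iff(2) by metis
  ultimately show ?thesis
    by (auto simp: code_ops_code SBT_iff simp del: code.simps code_tm.simps
        dest!: Ind_free_for_sound intro: logical_schemes.intros)
qed

definition "is_induction x \<longleftrightarrow> (\<exists>p v. Ind formula_step p \<and> (\<exists>n. v = code_tm (Var n)) \<and>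
  (\<exists>y z. SBT p (code_tm Zero) v y \<and> SBT p (prod_encode (2, v)) v z \<and>
     x = cImp (cAnd y (cAll v (cImp p z))) (cAll v p)))"

lemma sat_induction_instancesF [simp]:
  "sat T e (induction_instancesF x) \<longleftrightarrow> is_induction (tval e x)"
  unfolding induction_instancesF_def is_induction_def
  by (intro satI) (simp_all add: code_ops, blast)

lemma is_induction_sound: "is_induction x \<Longrightarrow> \<exists>\<phi>\<in>induction_instances. x = code \<phi>"
proof -
  assume "is_induction x"
  then obtain p n y z where p: "Ind formula_step p"
    and *: "SBT p (code_tm Zero) (code_tm (Var n)) y" "SBT p (prod_encode (2, code_tm (Var n))) (code_tm (Var n)) z"
      "x = cImp (cAnd y (cAll (code_tm (Var n)) (cImp p z))) (cAll (code_tm (Var n)) p)"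
    unfolding is_induction_def by blast
  obtain \<phi> where \<phi>: "p = code \<phi>" using Ind_formula_sound[OF p] by blast
  \<comment> \<open>What \<open>dSc\<close> builds from a variable is the code of an actual term, so
    \<open>SBT_iff\<close> applies to the induction step.\<close>
  have "prod_encode (2, code_tm (Var n)) = code_tm (Sc (Var n))" by simp
  with * have "x = code ((sbt \<phi> Zero n \<^bold>\<and> Forall n (\<phi> \<^bold>\<longrightarrow> sbt \<phi> (Sc (Var n)) n)) \<^bold>\<longrightarrow> Forall n \<phi>)"
    by (simp only: \<phi> SBT_iff code_ops_code)
  then show ?thesis unfolding induction_instances_def by blast
qed

definition "generalization_step A x Q \<longleftrightarrow> A x \<or>
  (\<exists>v y. (\<exists>n. v = code_tm (Var n)) \<and> Q y \<and> x = prod_encode (16, prod_encode (v, y)))"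

lemma sat_generalizationsF:
  assumes "\<And>e x. sat T e (F x) \<longleftrightarrow> A (tval e x)"
  shows "sat T e (generalizationsF F x) \<longleftrightarrow> Ind (generalization_step A) (tval e x)"
  unfolding generalizationsF_def generalization_step_def
  by (rule sat_inductiveF) (intro satI | simp add: assms)+

lemma Ind_generalization_sound:
  assumes "Ind (generalization_step A) x" and A: "\<And>x. A x \<Longrightarrow> \<exists>\<phi>\<in>\<Gamma>. x = code \<phi>"
  shows "\<exists>\<phi>\<in>generalizations \<Gamma>. x = code \<phi>"
  using assms(1)
proof (induction rule: Ind_induct)
  case (step x Q)
  from step(1) show ?case unfolding generalization_step_def
  proof (elim disjE exE conjE)
    assume "A x" then show ?thesis using A generalizations.intros(1) by blast
  next
    fix v y n assume "v = code_tm (Var n)" "Q y" and x: "x = prod_encode (16, prod_encode (v, y))"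
    moreover then obtain \<phi> where "\<phi> \<in> generalizations \<Gamma>" "y = code \<phi>" using step(2) by blast
    ultimately show ?thesis
      by (intro bexI[of _ "Forall n \<phi>"]) (auto intro: generalizations.intros)
  qed
qed

lemma sat_listF [simp]: "sat T e (listF \<phi>s x) \<longleftrightarrow> (\<exists>\<phi>\<in>set \<phi>s. tval e x = code \<phi>)"
  by (simp add: listF_def)

definition "is_logical_axiom x \<longleftrightarrow>
  Ind (generalization_step is_scheme) x \<and> sentence_code x \<or> x \<in> code ` set equality_axioms"

definition "is_PA_axiom x \<longleftrightarrow>
  x \<in> code ` set successor_axioms \<or> Ind (generalization_step is_induction) x \<and> sentence_code x"

lemma sat_logical_axiomsF [simp]: "sat T e (logical_axiomsF x) \<longleftrightarrow> is_logical_axiom (tval e x)"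
  by (auto simp: logical_axiomsF_def is_logical_axiom_def sat_generalizationsF)

lemma sat_PA_axiomsF [simp]: "sat T e (PA_axiomsF x) \<longleftrightarrow> is_PA_axiom (tval e x)"
  by (auto simp: PA_axiomsF_def is_PA_axiom_def sat_generalizationsF)

lemma is_logical_axiom_sound:
  assumes "is_logical_axiom x" shows "\<exists>\<phi>\<in>logical_axioms. x = code \<phi>"
  using assms unfolding is_logical_axiom_def
proof (elim disjE conjE)
  assume "Ind (generalization_step is_scheme) x" and s: "sentence_code x"
  then obtain \<phi> where "\<phi> \<in> generalizations logical_schemes" "x = code \<phi>"
    using Ind_generalization_sound[OF _ is_scheme_sound] by blast
  then show ?thesis using sentence_code_sound[OF s] by (auto simp: logical_axioms_def)
qed (auto simp: logical_axioms_def)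

lemma is_PA_axiom_sound:
  assumes "is_PA_axiom x" shows "\<exists>\<phi>\<in>PA_axioms. x = code \<phi>"
  using assms unfolding is_PA_axiom_def
proof (elim disjE conjE)
  assume "Ind (generalization_step is_induction) x" and s: "sentence_code x"
  then obtain \<phi> where "\<phi> \<in> generalizations induction_instances" "x = code \<phi>"
    using Ind_generalization_sound[OF _ is_induction_sound] by blast
  then show ?thesis using sentence_code_sound[OF s] by (auto simp: PA_axioms_def)
qed (auto simp: PA_axioms_def)

definition "is_DCB_axiom x \<longleftrightarrow> is_PA_axiom x \<or> x \<in> code ` {Nontriviality, K1_K2, UK, R_DCB}"

text \<open>The last disjunct describes the result of putting the numeral of the code of
  \<open>R_template\<close> into \<open>R_template\<close>. By \<open>SBT_iff\<close> just one
  number fits, and \<open>R_DCB_fixed_point\<close> names it as the code of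
  \<open>R_DCB\<close>.\<close>

lemma sat_DCB_axiomsF [simp]:
  "sat T e (DCB_axiomsF (gq R_template) x) \<longleftrightarrow> is_DCB_axiom (tval e x)"
proof -
  have "sat T e (DCB_axiomsF (gq R_template) x) \<longleftrightarrow> is_PA_axiom (tval e x) \<or>
      tval e x \<in> code ` {Nontriviality, K1_K2, UK} \<or>
      SBT (code R_template) (code_tm (gq R_template)) (code_tm (Var 0)) (tval e x)"
    by (auto simp: DCB_axiomsF_def gq_def)
  also have "\<dots> \<longleftrightarrow> is_DCB_axiom (tval e x)"
    unfolding SBT_iff R_DCB_fixed_point[symmetric] is_DCB_axiom_def by blast
  finally show ?thesis .
qed

definition "provable_step A x Q \<longleftrightarrow> is_logical_axiom x \<or> A x \<or> (\<exists>y. Q y \<and> Q (cImp y x))"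

lemma sat_Pr_DCB: "sat T e (Pr_DCB x) \<longleftrightarrow> Ind (provable_step is_DCB_axiom) (tval e x)"
  unfolding Pr_DCB_def provableF_def provable_step_def
proof (rule sat_inductiveF)
  fix e' x m Q and prev :: "tm \<Rightarrow> fm"
  assume Q: "\<And>e'' z. agree m e'' e' \<Longrightarrow> sat T e'' (prev z) = Q (tval e'' z)"
    and m: "\<And>z. occ m (prev z)"
  have mp: "sat T e'' (prev \<bullet> (\<langle>y\<rangle> \<rightarrow>\<^sub>d \<langle>x\<rangle>)) \<longleftrightarrow> Q (cImp (tval e'' y) (tval e'' x))"
    if "agree m e'' e'" for e'' y
    by (rule sat_at_fun[where Q = Q]) (use that in \<open>simp_all add: Q m cImp_def\<close>)
  show "sat T e' (logical_axiomsF x \<^bold>\<or> DCB_axiomsF (gq R_template) x \<^bold>\<or>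
      (\<^bold>\<exists>y. prev y \<^bold>\<and> prev \<bullet> (\<langle>y\<rangle> \<rightarrow>\<^sub>d \<langle>x\<rangle>))) \<longleftrightarrow>
    is_logical_axiom (tval e' x) \<or> is_DCB_axiom (tval e' x) \<or> (\<exists>y. Q y \<and> Q (cImp y (tval e' x)))"
    by (intro satI) (simp_all add: Q m mp)
qed

lemma Ind_provable_sound:
  "Ind (provable_step is_DCB_axiom) x \<Longrightarrow> \<exists>\<phi>\<in>theorems DCB. x = code \<phi>"
proof (induction rule: Ind_induct)
  case (step x Q)
  from step(1) consider "is_logical_axiom x" | "is_DCB_axiom x" | y where "Q y" "Q (cImp y x)"
    unfolding provable_step_def by blast
  then show ?case
  proof cases
    case 1
    then show ?thesis using is_logical_axiom_sound theorems.logical by blast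
  next
    case 2
    then have "\<exists>\<phi>\<in>axms DCB. x = code \<phi>"
      using is_PA_axiom_sound[of x] by (auto simp: is_DCB_axiom_def DCB_def Base_def add_axioms_def)
    then show ?thesis using theorems.axiom by blast
  next
    case (3 y)
    then obtain \<phi> \<psi> where \<phi>: "\<phi> \<in> theorems DCB" "y = code \<phi>" and \<psi>: "\<psi> \<in> theorems DCB" "cImp y x = code \<psi>"
      using step(2) by metis
    \<comment> \<open>The tag 13 forces the second premise to be an implication, and injectivity
      makes \<open>x\<close> the code of its conclusion.\<close>
    then obtain \<chi> where "\<psi> = (\<phi> \<^bold>\<longrightarrow> \<chi>)" "x = code \<chi>"
      by (cases \<psi>) (auto simp: cImp_def)
    with \<phi> \<psi> show ?thesis using theorems.mp by blast
  qed
qed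

subsection \<open>The models\<close>

primrec truth :: "nat \<Rightarrow> nat set" where
  "truth 0 = UNIV"
| "truth (Suc n) = {code \<phi> | \<phi>. sentence \<phi> \<and> sat (truth n) (\<lambda>_. 0) \<phi>}"

lemma code_in_truth: "sentence \<phi> \<Longrightarrow> code \<phi> \<in> truth (Suc n) \<longleftrightarrow> sat (truth n) e \<phi>"
  using sat_sentence[of \<phi> "truth n" e "\<lambda>_. 0"] by auto

lemma sbt_in_truth:
  assumes "fv \<phi> \<subseteq> {i}" "tvars t = {}"
  shows "code (sbt \<phi> t i) \<in> truth (Suc n) \<longleftrightarrow> sat (truth n) (e(i := tval e t)) \<phi>"
proof -
  have "sentence (sbt \<phi> t i)" using assms by (auto simp: sentence_def fv_sbt_closed)
  then show ?thesis using assms(2) by (simp add: code_in_truth[where e = e] sat_sbt free_for_closed del: truth.simps)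
qed

lemma sat_all_fmI:
  "(\<And>v n. (\<And>k. occ k (F Zero) \<Longrightarrow> above v k) \<Longrightarrow> sat T (e(v := n)) (F (Var v))) \<Longrightarrow> sat T e (all_fm F)"
  using sat_quant(2)[of F T e "\<lambda>_. True"] by simp

section \<open>Truth conditions of the axioms\<close>

lemma sat_equality_axioms: "\<phi> \<in> set equality_axioms \<Longrightarrow> sat T e \<phi>"
  unfolding equality_axioms_def by (auto intro!: sat_all_fmI)

lemma sat_successor_axioms: "\<phi> \<in> set successor_axioms \<Longrightarrow> sat T e \<phi>"
  unfolding successor_axioms_def by (auto intro!: sat_all_fmI)

lemma sat_logical_axioms: "\<phi> \<in> logical_axioms \<Longrightarrow> sat T e \<phi>"
  using sat_generalizations[OF _ sat_logical_schemes] sat_equality_axioms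
  by (auto simp: logical_axioms_def)

lemma sat_PA_axioms: "\<phi> \<in> PA_axioms \<Longrightarrow> sat T e \<phi>"
  using sat_generalizations[OF _ sat_induction_instances] sat_successor_axioms
  by (auto simp: PA_axioms_def)

lemma sat_at_predicate [simp]:
  "sat T e (Tr \<bullet> d) \<longleftrightarrow> (\<exists>z. dval e d z \<and> z \<in> T)"
  "sat T e (K2 s \<bullet> d) \<longleftrightarrow> (\<exists>z. dval e d z \<and> z \<in> T)"
  by (intro satI; simp)+

lemma sat_Nontriviality: "sat T e Nontriviality"
  unfolding Nontriviality_def ex_fm_def by (simp add: Let_def)

lemma sat_K1_K2: "sat T e K1_K2"
proof -
  have "sat T e K1_K2 \<longleftrightarrow> (\<forall>p. sentence_code p \<longrightarrow> (p \<in> T \<longleftrightarrow> (\<forall>a::nat. True \<longrightarrow> p \<in> T)))"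
    unfolding K1_K2_def by (intro satI) simp_all
  then show ?thesis by simp
qed

text \<open>The quantifier over agents survives as
  \<open>\<forall>a::nat. True \<longrightarrow>\<close>, because \<open>Ag\<close> holds of every
  number and the statement must keep the shape of the axiom for \<open>satI\<close>.\<close>

lemma sat_UK:
  "sat T e UK \<longleftrightarrow> (\<forall>a::nat. True \<longrightarrow> (\<forall>p. sentence_code p \<longrightarrow> (\<forall>q. sentence_code q \<longrightarrow>
     p \<in> T \<and> cImp p q \<in> T \<longrightarrow> q \<in> T)))"
  unfolding UK_def by (intro satI) (simp_all add: cImp_def)

lemma sat_R_DCB:
  "sat T e R_DCB \<longleftrightarrow> (\<forall>a::nat. True \<longrightarrow> (\<forall>p. sentence_code p \<longrightarrow>
     Ind (provable_step is_DCB_axiom) p \<longrightarrow> p \<in> T))"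
  unfolding R_DCB_def by (intro satI) (simp_all add: sat_Pr_DCB)

lemma sat_T_connectives:
  "sat T e T_neg \<longleftrightarrow> (\<forall>p. sentence_code p \<longrightarrow> (cNeg p \<in> T \<longleftrightarrow> \<not> p \<in> T))"
  "sat T e T_imp \<longleftrightarrow> (\<forall>p. sentence_code p \<longrightarrow> (\<forall>q. sentence_code q \<longrightarrow> (cImp p q \<in> T \<longleftrightarrow> (p \<in> T \<longrightarrow> q \<in> T))))"
  "sat T e T_and \<longleftrightarrow> (\<forall>p. sentence_code p \<longrightarrow> (\<forall>q. sentence_code q \<longrightarrow> (cAnd p q \<in> T \<longleftrightarrow> p \<in> T \<and> q \<in> T)))"
  "sat T e T_or \<longleftrightarrow> (\<forall>p. sentence_code p \<longrightarrow> (\<forall>q. sentence_code q \<longrightarrow> (cOr p q \<in> T \<longleftrightarrow> p \<in> T \<or> q \<in> T)))"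
  unfolding T_neg_def T_imp_def T_and_def T_or_def code_ops by (intro satI; simp)+

lemma sat_T_quantifiers:
  "sat T e T_all \<longleftrightarrow> (\<forall>v. (\<exists>i. v = code_tm (Var i)) \<longrightarrow> (\<forall>p. formula1_code v p \<longrightarrow>
     (cAll v p \<in> T \<longleftrightarrow> (\<forall>t. Ind cterm_step t \<longrightarrow> (\<exists>z. SBT p t v z \<and> z \<in> T)))))"
  "sat T e T_ex \<longleftrightarrow> (\<forall>v. (\<exists>i. v = code_tm (Var i)) \<longrightarrow> (\<forall>p. formula1_code v p \<longrightarrow>
     (cEx v p \<in> T \<longleftrightarrow> (\<exists>t. Ind cterm_step t \<and> (\<exists>z. SBT p t v z \<and> z \<in> T)))))"
  unfolding T_all_def T_ex_def code_ops by (intro satI; simp)+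

lemma sat_UBF:
  "sat T e UBF \<longleftrightarrow> (\<forall>a::nat. True \<longrightarrow> (\<forall>v. (\<exists>i. v = code_tm (Var i)) \<longrightarrow> (\<forall>p. formula1_code v p \<longrightarrow>
     (\<forall>t. Ind pa_cterm_step t \<longrightarrow> (\<exists>z. SBT p t v z \<and> z \<in> T)) \<longrightarrow> cAll v p \<in> T)))"
  unfolding UBF_def code_ops by (intro satI; simp)

lemma sat_V: "sat T e V"
proof -
  have "sat T e V \<longleftrightarrow> (\<forall>a::nat. True \<longrightarrow> (\<forall>p. sentence_code p \<longrightarrow> p \<in> T \<longrightarrow> p \<in> T))"
    unfolding V_def by (intro satI) simp_all
  then show ?thesis by simp
qed

lemma sat_IA:
  "sat T e IA \<longleftrightarrow> (\<forall>a::nat. True \<longrightarrow> (\<forall>p. sentence_code p \<longrightarrow>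
     (code (Tr (num p)) \<in> T \<longleftrightarrow> code (K2 (num a) (num p)) \<in> T)))"
  unfolding IA_def by (intro satI; simp)

lemma sat_In:
  "sat T e In_plus \<longleftrightarrow> (\<forall>a::nat. True \<longrightarrow> (\<forall>p. sentence_code p \<longrightarrow>
     code (Tr (num p)) \<in> T \<longrightarrow> code (K2 (num a) (num p)) \<in> T))"
  "sat T e In_minus \<longleftrightarrow> (\<forall>a::nat. True \<longrightarrow> (\<forall>p. sentence_code p \<longrightarrow>
     \<not> code (Tr (num p)) \<in> T \<longrightarrow> code (\<^bold>\<not> K2 (num a) (num p)) \<in> T))"
  unfolding In_plus_def In_minus_def by (intro satI; simp)+

lemma truth_connectives:
  assumes "sentence \<phi>" "sentence \<psi>"
  shows "cNeg (code \<phi>) \<in> truth (Suc n) \<longleftrightarrow> code \<phi> \<notin> truth (Suc n)"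
    and "cImp (code \<phi>) (code \<psi>) \<in> truth (Suc n) \<longleftrightarrow> (code \<phi> \<in> truth (Suc n) \<longrightarrow> code \<psi> \<in> truth (Suc n))"
    and "cAnd (code \<phi>) (code \<psi>) \<in> truth (Suc n) \<longleftrightarrow> code \<phi> \<in> truth (Suc n) \<and> code \<psi> \<in> truth (Suc n)"
    and "cOr (code \<phi>) (code \<psi>) \<in> truth (Suc n) \<longleftrightarrow> code \<phi> \<in> truth (Suc n) \<or> code \<psi> \<in> truth (Suc n)"
proof -
  have "sentence (\<^bold>\<not> \<phi>)" "sentence (\<phi> \<^bold>\<longrightarrow> \<psi>)" "sentence (\<phi> \<^bold>\<and> \<psi>)" "sentence (\<phi> \<^bold>\<or> \<psi>)"
    using assms by (auto simp: sentence_def)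
  with assms show "cNeg (code \<phi>) \<in> truth (Suc n) \<longleftrightarrow> code \<phi> \<notin> truth (Suc n)"
    "cImp (code \<phi>) (code \<psi>) \<in> truth (Suc n) \<longleftrightarrow> (code \<phi> \<in> truth (Suc n) \<longrightarrow> code \<psi> \<in> truth (Suc n))"
    "cAnd (code \<phi>) (code \<psi>) \<in> truth (Suc n) \<longleftrightarrow> code \<phi> \<in> truth (Suc n) \<and> code \<psi> \<in> truth (Suc n)"
    "cOr (code \<phi>) (code \<psi>) \<in> truth (Suc n) \<longleftrightarrow> code \<phi> \<in> truth (Suc n) \<or> code \<psi> \<in> truth (Suc n)"
    unfolding code_ops_code by (simp_all add: code_in_truth[where e = "\<lambda>_. 0"] del: truth.simps code.simps)
qed

lemma sat_DCB: "\<phi> \<in> theorems DCB \<Longrightarrow> sat (truth n) e \<phi>"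
proof (induction n arbitrary: \<phi> e)
  case 0
  \<comment> \<open>The conclusions of \<open>UK\<close> and \<open>R_DCB\<close> are memberships in
    \<open>truth 0\<close>, which is everything.\<close>
  have "sat (truth 0) e \<psi>" if "\<psi> \<in> axms DCB" for \<psi>
    using that by (auto simp: DCB_def Base_def add_axioms_def sat_PA_axioms sat_Nontriviality sat_K1_K2 sat_UK sat_R_DCB)
  with 0 show ?case
    by (induction rule: theorems.induct)
      (auto simp: sat_logical_axioms DCB_def Base_def add_axioms_def)
next
  case (Suc n)
  have "sat (truth (Suc n)) e UK" for e
    unfolding sat_UK
    by (auto dest!: sentence_code_sound simp: truth_connectives simp del: truth.simps)
  \<comment> \<open>Whatever \<open>Pr_DCB\<close> admits is a theorem of \<open>DCB\<close>, hence
    holds in the preceding model by the induction hypothesis, which is what membership in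
    \<open>truth (Suc n)\<close> means. The induction has to cover all theorems at once,
    \<open>R_DCB\<close> among them.\<close>
  moreover have "sat (truth (Suc n)) e R_DCB" for e
    unfolding sat_R_DCB
  proof (intro allI impI)
    fix p assume "sentence_code p" "Ind (provable_step is_DCB_axiom) p"
    then obtain \<phi> where "p = code \<phi>" "sentence \<phi>" "\<phi> \<in> theorems DCB"
      by (auto dest!: sentence_code_sound Ind_provable_sound)
    then show "p \<in> truth (Suc n)" using Suc.IH by auto
  qed
  ultimately have "sat (truth (Suc n)) e \<psi>" if "\<psi> \<in> axms DCB" for \<psi> e
    using that by (auto simp: DCB_def Base_def add_axioms_def sat_PA_axioms sat_Nontriviality sat_K1_K2 simp del: truth.simps)
  \<comment> \<open>\<open>DCB\<close> has no rule besides modus ponens, so a derivation never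
    leaves the model.\<close>
  with Suc.prems show ?case
    by (induction rule: theorems.induct)
      (auto simp: sat_logical_axioms DCB_def Base_def add_axioms_def simp del: truth.simps)
qed

lemma sat_T_connectives_truth: "\<phi> \<in> {T_neg, T_imp, T_and, T_or} \<Longrightarrow> sat (truth (Suc n)) e \<phi>"
  by (auto simp: sat_T_connectives truth_connectives dest!: sentence_code_sound simp del: truth.simps)

lemma quantifier_in_truth:
  assumes "formula1_code (code_tm (Var i)) p"
  obtains \<phi> where "p = code \<phi>" "\<And>t y. SBT p (code_tm t) (code_tm (Var i)) y \<longleftrightarrow> y = code (sbt \<phi> t i)"
    "\<And>t. tvars t = {} \<Longrightarrow> code (sbt \<phi> t i) \<in> truth (Suc n) \<longleftrightarrow> sat (truth n) (e(i := tval e t)) \<phi>"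
    "cAll (code_tm (Var i)) p \<in> truth (Suc n) \<longleftrightarrow> (\<forall>m. sat (truth n) (e(i := m)) \<phi>)"
    "cEx (code_tm (Var i)) p \<in> truth (Suc n) \<longleftrightarrow> (\<exists>m. sat (truth n) (e(i := m)) \<phi>)"
proof -
  obtain \<phi> where \<phi>: "p = code \<phi>" "fv \<phi> \<subseteq> {i}" using formula1_code_sound[OF assms] by blast
  then have "sentence (Forall i \<phi>)" "sentence (Exists i \<phi>)" by (auto simp: sentence_def)
  from this[THEN code_in_truth, of n e] \<phi> show ?thesis
    by (intro that[of \<phi>])
      (simp_all add: SBT_iff sbt_in_truth[where e = e] code_ops_code del: truth.simps code.simps code_tm.simps)
qed

text \<open>\<open>I\<close> abstracts from the two kinds of closed terms, those of the full
  language in \<open>T_all\<close> and \<open>T_ex\<close> and the arithmetical ones in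
  \<open>UBF\<close>. Both consist of closed terms and contain the numerals. As knowledge is truth,
  \<open>UBF\<close> is one half of the equivalence for the universal quantifier.\<close>

lemma sat_T_quantifiers_truth:
  "sat (truth (Suc n)) e T_all" "sat (truth (Suc n)) e T_ex" "sat (truth (Suc n)) e UBF"
proof -
  have all: "(\<forall>t. I t \<longrightarrow> (\<exists>z. SBT p t (code_tm (Var i)) z \<and> z \<in> truth (Suc n))) \<longleftrightarrow>
      cAll (code_tm (Var i)) p \<in> truth (Suc n)" (is ?all)
    and ex: "(\<exists>t. I t \<and> (\<exists>z. SBT p t (code_tm (Var i)) z \<and> z \<in> truth (Suc n))) \<longleftrightarrow>
      cEx (code_tm (Var i)) p \<in> truth (Suc n)" (is ?ex)
    if p: "formula1_code (code_tm (Var i)) p"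
      and I: "\<And>t. I t \<Longrightarrow> \<exists>s. t = code_tm s \<and> tvars s = {}" "\<And>m. I (code_tm (num m))"
    for i p I
  proof -
    let ?z = "\<lambda>_. 0 :: nat"
    obtain \<phi> where \<phi>: "p = code \<phi>" "\<And>t y. SBT p (code_tm t) (code_tm (Var i)) y \<longleftrightarrow> y = code (sbt \<phi> t i)"
      "\<And>t. tvars t = {} \<Longrightarrow> code (sbt \<phi> t i) \<in> truth (Suc n) \<longleftrightarrow> sat (truth n) (?z(i := tval ?z t)) \<phi>"
      "cAll (code_tm (Var i)) p \<in> truth (Suc n) \<longleftrightarrow> (\<forall>m. sat (truth n) (?z(i := m)) \<phi>)"
      "cEx (code_tm (Var i)) p \<in> truth (Suc n) \<longleftrightarrow> (\<exists>m. sat (truth n) (?z(i := m)) \<phi>)"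
      using quantifier_in_truth[OF p] by blast
    have closed: "(\<exists>z. SBT p (code_tm s) (code_tm (Var i)) z \<and> z \<in> truth (Suc n)) \<longleftrightarrow>
        sat (truth n) (?z(i := tval ?z s)) \<phi>" if "tvars s = {}" for s
      unfolding \<phi>(2) \<phi>(3)[OF that, symmetric] by blast
    from closed[of "num m" for m] have num: "(\<exists>z. SBT p (code_tm (num m)) (code_tm (Var i)) z \<and> z \<in> truth (Suc n)) \<longleftrightarrow>
        sat (truth n) (?z(i := m)) \<phi>" for m
      by simp
    \<comment> \<open>A closed term may be replaced by the numeral of its value.\<close>
    have *: "\<exists>m. (\<exists>z. SBT p t (code_tm (Var i)) z \<and> z \<in> truth (Suc n)) \<longleftrightarrow> sat (truth n) (?z(i := m)) \<phi>"
      if "I t" for t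
      using I(1)[OF that] closed by blast
    show ?all unfolding \<phi>(4) num[symmetric] using * num I(2) by meson
    show ?ex unfolding \<phi>(5) num[symmetric] using * num I(2) by meson
  qed
  show "sat (truth (Suc n)) e T_all" "sat (truth (Suc n)) e T_ex" "sat (truth (Suc n)) e UBF"
    unfolding sat_T_quantifiers sat_UBF
    using all[where I = "Ind cterm_step"] ex[where I = "Ind cterm_step"] all[where I = "Ind pa_cterm_step"]
      Ind_cterm_sound Ind_cterm_num Ind_pa_cterm_sound Ind_pa_cterm_num by blast+
qed

text \<open>The atoms for truth and for knowledge of \<open>p\<close> both ask whether
  \<open>p\<close> belongs to \<open>truth n\<close>, whoever the agent is; negation asks for the
  opposite.\<close>

lemma sat_IA_In_truth:
  "sat (truth (Suc n)) e IA" "sat (truth (Suc n)) e In_plus" "sat (truth (Suc n)) e In_minus"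
proof -
  have "code (Tr (num p)) \<in> truth (Suc n) \<longleftrightarrow> p \<in> truth n"
    "code (K2 (num a) (num p)) \<in> truth (Suc n) \<longleftrightarrow> p \<in> truth n"
    "code (\<^bold>\<not> K2 (num a) (num p)) \<in> truth (Suc n) \<longleftrightarrow> p \<notin> truth n" for a p
    by (subst code_in_truth[where e = "\<lambda>_. 0"]; simp add: sentence_def)+
  then show "sat (truth (Suc n)) e IA" "sat (truth (Suc n)) e In_plus" "sat (truth (Suc n)) e In_minus"
    unfolding sat_IA sat_In by blast+
qed

section \<open>Truth of atomic sentences\<close>

lemma sat_Foralls:
  "(\<And>e'. (\<And>x. x \<notin> set xs \<Longrightarrow> e' x = e x) \<Longrightarrow> sat T e' \<phi>) \<Longrightarrow> sat T e (Foralls xs \<phi>)"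
  unfolding Foralls_def
proof (induction xs arbitrary: e)
  case (Cons x xs)
  have "sat T (e(x := n)) (foldr Forall xs \<phi>)" for n
    by (rule Cons.IH) (use Cons.prems in \<open>auto simp: fun_upd_apply\<close>)
  then show ?case by simp
qed simp

lemma dval_fold_dSbt:
  assumes "\<And>z. dval e d z \<longleftrightarrow> z = code R" "\<And>x. x \<in> set xs \<Longrightarrow> e (N + x) = code_tm (s x)"
  shows "dval e (fold (\<lambda>x d. dSbt d \<langle>Var (N + x)\<rangle> \<langle>gq_tm (Var x)\<rangle>) xs d) z \<longleftrightarrow>
    z = code (fold (\<lambda>x R. sbt R (s x) x) xs R)"
  using assms
proof (induction xs arbitrary: d R)
  case (Cons x xs)
  have "dval e (dSbt d \<langle>Var (N + x)\<rangle> \<langle>gq_tm (Var x)\<rangle>) z \<longleftrightarrow> z = code (sbt R (s x) x)" for z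
    using Cons.prems by (simp add: SBT_iff del: code_tm.simps)
  then show ?case using Cons by simp
qed simp

text \<open>Each substituted term is closed and has the value that its variable already has, so the
  update in the substitution lemma changes nothing.\<close>

lemma sat_fold_sbt:
  assumes "\<And>x. x \<in> set xs \<Longrightarrow> tvars (s x) = {} \<and> e x = tval e (s x)"
  shows "sat T e (fold (\<lambda>x R. sbt R (s x) x) xs R) \<longleftrightarrow> sat T e R"
  using assms
proof (induction xs arbitrary: R)
  case (Cons x xs)
  then have "sat T e (sbt R (s x) x) \<longleftrightarrow> sat T e R"
    by (simp add: sat_sbt free_for_closed fun_upd_idem)
  then show ?case using Cons by simp
qed simp

lemma fv_fold_sbt:
  "(\<And>x. x \<in> set xs \<Longrightarrow> tvars (s x) = {}) \<Longrightarrow>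
    fv (fold (\<lambda>x R. sbt R (s x) x) xs R) = fv R - set xs"
  by (induction xs arbitrary: R) (auto simp: fv_sbt_closed)

lemma sat_atomic_minus: "atomic_minus R \<Longrightarrow> sat T e R = sat T' e R"
  by (cases R) auto

lemma tvars_le_tmax: "y \<in> tvars t \<Longrightarrow> y \<le> tmax t"
  by (induction t) auto

text \<open>The instance obtained by substituting closed terms is judged in the model
  \<open>n\<close>, whereas \<open>R\<close> itself is judged in the next one.
  \<open>sat_fold_sbt\<close> passes from the instance to \<open>R\<close> within the model
  \<open>n\<close>, and \<open>sat_atomic_minus\<close> crosses between the models.\<close>

lemma sat_T_atomic:
  assumes R: "atomic_minus R"
  shows "sat (truth (Suc n)) e (T_atomic R)"
proof -
  let ?xs = "sorted_list_of_set (fv R)" and ?N = "Suc (fmax R)"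
  have xs: "set ?xs = fv R" by (simp add: finite_fv)
  have "sat (truth (Suc n)) e (Tr \<bullet> fold (\<lambda>x d. dSbt d \<langle>Var (?N + x)\<rangle> \<langle>gq_tm (Var x)\<rangle>) ?xs \<langle>gq R\<rangle> \<^bold>\<longleftrightarrow> R)"
    if t: "\<And>x. x \<in> fv R \<Longrightarrow> Ind pa_cterm_step (e (?N + x))"
      and v: "\<And>x. x \<in> fv R \<Longrightarrow> sat (truth (Suc n)) e (valF (Var (?N + x)) (Var x))" for e
  proof -
    obtain s where s: "\<And>x. x \<in> fv R \<Longrightarrow> e (?N + x) = code_tm (s x) \<and> tvars (s x) = {}"
      using Ind_pa_cterm_sound[OF t] by metis
    have val: "e x = tval e (s x)" if "x \<in> fv R" for x
      using sat_valF[OF v[OF that], of "s x" e] s[OF that] by simp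
    let ?R = "fold (\<lambda>x R. sbt R (s x) x) ?xs R"
    have "sentence ?R"
      using fv_fold_sbt[of ?xs s R] s by (simp add: sentence_def xs)
    then have "code ?R \<in> truth (Suc n) \<longleftrightarrow> sat (truth n) e ?R"
      by (rule code_in_truth)
    also have "\<dots> \<longleftrightarrow> sat (truth n) e R"
      by (rule sat_fold_sbt) (use s val xs in auto)
    also have "\<dots> \<longleftrightarrow> sat (truth (Suc n)) e R"
      by (rule sat_atomic_minus[OF R])
    finally show ?thesis
      using dval_fold_dSbt[of e "\<langle>gq R\<rangle>" R ?xs ?N s] s xs by (simp del: truth.simps)
  qed
  note main = this
  show ?thesis
    unfolding T_atomic_def Let_def
  proof (intro sat_Foralls)
    fix e1
    show "sat (truth (Suc n)) e1 (Conj (map (\<lambda>x. pa_ctermF (Var (?N + x))) ?xs) \<^bold>\<longrightarrow>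
          Foralls ?xs (Conj (map (\<lambda>x. valF (Var (?N + x)) (Var x)) ?xs) \<^bold>\<longrightarrow>
              (Tr \<bullet> fold (\<lambda>x d. dSbt d \<langle>Var (?N + x)\<rangle> \<langle>gq_tm (Var x)\<rangle>) ?xs \<langle>gq R\<rangle> \<^bold>\<longleftrightarrow> R)))"
      unfolding sat.simps(8)
    proof (intro impI sat_Foralls)
      assume t: "sat (truth (Suc n)) e1 (Conj (map (\<lambda>x. pa_ctermF (Var (?N + x))) ?xs))"
      fix e2 assume e2: "\<And>x. x \<notin> set ?xs \<Longrightarrow> e2 x = e1 x"
      \<comment> \<open>The variables holding the terms exceed all variables of \<open>R\<close>, so
        the inner block of quantifiers leaves them alone.\<close>
      have "e2 (?N + x) = e1 (?N + x)" for x
      proof (rule e2)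
        have "y \<le> fmax R" if "y \<in> fv R" for y
          using R that tvars_le_tmax by (cases R) (auto simp: le_max_iff_disj)
        then show "?N + x \<notin> set ?xs" unfolding xs by fastforce
      qed
      with t main[of e2]
      show "sat (truth (Suc n)) e2 (Conj (map (\<lambda>x. valF (Var (?N + x)) (Var x)) ?xs) \<^bold>\<longrightarrow>
              (Tr \<bullet> fold (\<lambda>x d. dSbt d \<langle>Var (?N + x)\<rangle> \<langle>gq_tm (Var x)\<rangle>) ?xs \<langle>gq R\<rangle> \<^bold>\<longleftrightarrow> R))"
        by (simp add: xs finite_fv del: truth.simps sat_Iff sat_at_predicate)
    qed
  qed
qed

subsection \<open>Consistency\<close>

lemma eventually_true:
  assumes "\<phi> \<in> theorems (KT \<oplus> {UBF, IA, In_plus, In_minus})"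
  shows "\<exists>k. \<forall>n\<ge>k. sat (truth n) (\<lambda>_. 0) \<phi>"
  using assms
proof (induction rule: theorems.induct)
  case (logical \<phi>)
  then show ?case using sat_logical_axioms by blast
next
  case (axiom \<phi>)
  then consider "\<phi> \<in> axms DCB" | "\<phi> \<in> PA_axioms" | R where "atomic_minus R" "\<phi> = T_atomic R"
    | "\<phi> \<in> {T_neg, T_imp, T_and, T_or}" | "\<phi> \<in> {T_all, T_ex, UBF}" | "\<phi> = V" | "\<phi> \<in> {IA, In_plus, In_minus}"
    by (auto simp: KT_def FS_def Base_def join_def add_axioms_def add_rule_def)
  \<comment> \<open>The threshold for axioms is 1: in the model 0, where a sentence and its negation
    are both true, \<open>T_neg\<close> fails.\<close>
  then have "sat (truth (Suc n)) (\<lambda>_. 0) \<phi>" for n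
  proof cases
    case 1
    then show ?thesis by (intro sat_DCB theorems.axiom)
  next
    case 2
    then show ?thesis by (rule sat_PA_axioms)
  next
    case 3
    then show ?thesis using sat_T_atomic by blast
  next
    case 4
    then show ?thesis by (rule sat_T_connectives_truth)
  next
    case 5
    then show ?thesis using sat_T_quantifiers_truth by (elim insertE) simp_all
  next
    case 6
    then show ?thesis using sat_V by simp
  next
    case 7
    then show ?thesis using sat_IA_In_truth by (elim insertE) simp_all
  qed
  then have "sat (truth n) (\<lambda>_. 0) \<phi>" if "1 \<le> n" for n
    using that by (cases n) (simp_all del: truth.simps)
  then show ?case by blast
next
  case (mp \<phi> \<psi>)
  then obtain j k where "\<forall>n\<ge>j. sat (truth n) (\<lambda>_. 0) (\<phi> \<^bold>\<longrightarrow> \<psi>)" "\<forall>n\<ge>k. sat (truth n) (\<lambda>_. 0) \<phi>"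
    by blast
  then have "\<forall>n\<ge>max j k. sat (truth n) (\<lambda>_. 0) \<psi>" by simp
  then show ?case by blast
next
  case (rule \<phi> \<psi>)
  then obtain k where k: "\<And>n. k \<le> n \<Longrightarrow> sat (truth n) (\<lambda>_. 0) \<phi>" by blast
  from rule(2) consider "sentence \<phi>" "\<psi> = Tr (gq \<phi>)" | "sentence \<psi>" "\<phi> = Tr (gq \<psi>)"
    | "sentence \<phi>" "\<psi> = (\<^bold>\<forall>\<alpha>\<^bold>\<in>Ag. K2 \<alpha> (gq \<phi>))"
    by (auto simp: KT_def FS_def DCB_def Base_def join_def add_axioms_def add_rule_def
        NEC_T_def CONEC_T_def NEC_K_def)
  then show ?case
  proof cases
    case 1
    \<comment> \<open>Truth of \<open>\<phi>\<close> in one model makes its code true in the next,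
      so necessitation raises the threshold by one.\<close>
    then have "sat (truth n) (\<lambda>_. 0) \<psi>" if "Suc k \<le> n" for n
      using k that by (cases n) auto
    then show ?thesis by blast
  next
    case 2
    \<comment> \<open>Here the premise is read in the model \<open>Suc n\<close>, which is still
      past \<open>k\<close>, and it speaks of the model \<open>n\<close>; the threshold
      stays.\<close>
    then have "sat (truth n) (\<lambda>_. 0) \<psi>" if "k \<le> n" for n
      using k[of "Suc n"] that by simp
    then show ?thesis by blast
  next
    case 3
    then have "sat (truth n) (\<lambda>_. 0) \<psi>" if "Suc k \<le> n" for n
      using k that by (cases n) (auto simp: all_in_def intro!: sat_all_fmI)
    then show ?thesis by blast
  qed
qed

theorem corollary15:
  shows "consistent (KT \<oplus> {UBF, IA, In_plus, In_minus})"
  unfolding consistent_def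
proof
  assume "\<exists>\<phi>. \<phi> \<in> theorems (KT \<oplus> {UBF, IA, In_plus, In_minus}) \<and>
    (\<^bold>\<not> \<phi>) \<in> theorems (KT \<oplus> {UBF, IA, In_plus, In_minus})"
  then obtain \<phi> j k where "\<forall>n\<ge>j. sat (truth n) (\<lambda>_. 0) \<phi>" "\<forall>n\<ge>k. sat (truth n) (\<lambda>_. 0) (\<^bold>\<not> \<phi>)"
    using eventually_true by blast
  from this(1)[rule_format, of "max j k"] this(2)[rule_format, of "max j k"] show False by simp
qed

end
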